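(* Let $K$ be a number field of degree $d$ and discriminant $\Delta_K$, and let $A\in \operatorname{GL}_n(K)$. Then $$H(A^{-1}) \le \left(\sqrt{n}\, H(A)\right)^{n-1}$$ and $$h(A^{-1}) \le n^n |\Delta_K|^{\frac1d}\, h(A)^{2n-1}.$$
   Context: Heights: let $M(K)$ be the set of places of $K$, and for $v\in M(K)$ let $d_v = [K_v:\mathbb{Q}_v]$ be the local degree. The absolute value $|\cdot|_v$ is normalized to extend the usual archimedean or $p$-adic absolute value on $\mathbb{Q}$, so that $\prod_{v\in M(K)} |x|_v^{d_v} = 1$ for all nonzero $x\in K$. For a vector $\boldsymbol{x} = (x_1,\dots,x_N)$ over $K$ put $|\boldsymbol{x}|_v = \max_i |x_i|_v$ and $H(\boldsymbol{x}) = \left(\prod_{v\in M(K)} |\boldsymbol{x}|_v^{d_v}\right)^{1/d}$; the inhomogeneous (Weil) height is $h(\boldsymbol{x}) = H(1,\boldsymbol{x})$. For an $n\times n$ matrix $A$ over $K$, $H(A)$ and $h(A)$ are the heights of $A$ viewed as a vector in $K^{n^2}$. *)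

theory Defs
  imports
    "HOL-Analysis.Analysis"
    "HOL-Algebra.QuotRing"
    "HOL-Algebra.Embedded_Algebras"
    "HOL-Computational_Algebra.Computational_Algebra"
    "Jordan_Normal_Form.Determinant"
begin

section \<open>Number fields\<close>

global_interpretation rat_vs: vector_space "\<lambda>(q::rat) (x::'k::field_char_0). of_rat q * x"
  by unfold_locales (simp_all add: algebra_simps of_rat_add of_rat_mult)

class number_field = field_char_0 +
  assumes finite_over_rat: "\<exists>B. finite B \<and> (\<forall>x. \<exists>c. x = (\<Sum>b\<in>B. of_rat (c b) * b))"

definition field_degree :: "'k::number_field itself \<Rightarrow> nat" where
  "field_degree _ = rat_vs.dim (UNIV :: 'k set)"

text \<open>The trace of the \<open>\<rat>\<close>-linear map \<open>y \<mapsto> x * y\<close>, computed in some \<open>\<rat>\<close>-basis.\<close>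

definition field_trace :: "'k::number_field \<Rightarrow> rat" where
  "field_trace x =
    (let B = (SOME B::'k set. rat_vs.independent B \<and> rat_vs.span B = UNIV)
     in \<Sum>b\<in>B. rat_vs.representation B (x * b) b)"

definition ring_of_integers :: "'k::number_field set" where
  "ring_of_integers = {x. algebraic_int x}"

definition integral_basis :: "'k::number_field list \<Rightarrow> bool" where
  "integral_basis \<omega> \<longleftrightarrow>
     {\<Sum>i<length \<omega>. of_int (c i) * \<omega> ! i |c. True} = ring_of_integers \<and>
     (\<forall>c. (\<Sum>i<length \<omega>. of_int (c i) * \<omega> ! i) = 0 \<longrightarrow> (\<forall>i<length \<omega>. c i = 0))"

definition field_discriminant :: "'k::number_field itself \<Rightarrow> rat" where
  "field_discriminant _ =
    (let \<omega> = (SOME \<omega>::'k list. integral_basis \<omega>); m = length \<omega>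
     in Determinant.det (Matrix.mat m m (\<lambda>(i, j). field_trace (\<omega> ! i * \<omega> ! j))))"

section \<open>Places\<close>

definition absolute_value :: "('k::field \<Rightarrow> real) \<Rightarrow> bool" where
  "absolute_value v \<longleftrightarrow>
     (\<forall>x. v x \<ge> 0) \<and> (\<forall>x. v x = 0 \<longleftrightarrow> x = 0) \<and>
     (\<forall>x y. v (x * y) = v x * v y) \<and> (\<forall>x y. v (x + y) \<le> v x + v y)"

definition padic_abs :: "nat \<Rightarrow> rat \<Rightarrow> real" where
  "padic_abs p q =
    (if q = 0 then 0 else
     let (a, b) = quotient_of q
     in real p powi (int (multiplicity (int p) b) - int (multiplicity (int p) a)))"

text \<open>
  A place \<open>v\<close> is represented by its normalized absolute value \<open>|\<cdot>|\<^sub>v\<close>, that is, by the unique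
  member of the equivalence class that extends the usual archimedean or a \<open>p\<close>-adic absolute
  value on \<open>\<rat>\<close>.
\<close>

definition places :: "('k::number_field \<Rightarrow> real) set" where
  "places = {v. absolute_value v \<and>
     ((\<forall>q. v (of_rat q) = real_of_rat \<bar>q\<bar>) \<or>
      (\<exists>p. prime p \<and> (\<forall>q. v (of_rat q) = padic_abs p q)))}"

subsection \<open>Completions and local degrees\<close>

definition cauchy_ring :: "('k::field \<Rightarrow> real) \<Rightarrow> (nat \<Rightarrow> 'k) ring" where
  "cauchy_ring v =
    \<lparr>carrier = {X. \<forall>e>0. \<exists>N. \<forall>m\<ge>N. \<forall>n\<ge>N. v (X m - X n) < e},
     monoid.mult = (\<lambda>X Y n. X n * Y n), one = (\<lambda>n. 1),
     zero = (\<lambda>n. 0), add = (\<lambda>X Y n. X n + Y n)\<rparr>"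

definition null_sequences :: "('k::field \<Rightarrow> real) \<Rightarrow> (nat \<Rightarrow> 'k) set" where
  "null_sequences v = {X. (\<lambda>n. v (X n)) \<longlonglongrightarrow> 0}"

definition completion :: "('k::field \<Rightarrow> real) \<Rightarrow> (nat \<Rightarrow> 'k) set ring" where
  "completion v = cauchy_ring v Quot null_sequences v"

text \<open>The completion of \<open>\<rat>\<close> at \<open>v\<close>, as the subfield of \<^term>\<open>completion v\<close> formed by the classes
  of rational Cauchy sequences.\<close>

definition rat_completion :: "('k::field_char_0 \<Rightarrow> real) \<Rightarrow> (nat \<Rightarrow> 'k) set set" where
  "rat_completion v =
    {null_sequences v +>\<^bsub>cauchy_ring v\<^esub> X |X. X \<in> carrier (cauchy_ring v) \<and> range X \<subseteq> \<rat>}"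

definition local_degree :: "('k::number_field \<Rightarrow> real) \<Rightarrow> nat" where
  "local_degree v = ring.dim (completion v) (rat_completion v) (carrier (completion v))"

section \<open>Heights\<close>

definition vec_abs :: "('k \<Rightarrow> real) \<Rightarrow> 'k ^ 'N \<Rightarrow> real" where
  "vec_abs v x = Max (range (\<lambda>i. v (vec_nth x i)))"

text \<open>
  For a nonzero vector \<open>x\<close> all but finitely many places have \<open>|x|\<^sub>v = 1\<close>; the product
  over all places is the finite product over the remaining ones.
\<close>

definition height :: "'k::number_field ^ 'N \<Rightarrow> real" where
  "height x = (\<Prod>v\<in>{v \<in> places. vec_abs v x \<noteq> 1}. vec_abs v x ^ local_degree v)
                 powr (1 / real (field_degree TYPE('k)))"

text \<open>The vector \<open>(1, x)\<close> is indexed by \<^typ>\<open>'N option\<close>, its coordinate at \<^const>\<open>None\<close> being \<open>1\<close>.\<close>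

definition inhom_height :: "'k::number_field ^ 'N \<Rightarrow> real" where
  "inhom_height x =
    height ((\<chi> i. case i of None \<Rightarrow> 1 | Some j \<Rightarrow> vec_nth x j) :: 'k ^ 'N option)"

definition mat_to_vec :: "'k ^ 'n ^ 'm \<Rightarrow> 'k ^ ('m \<times> 'n)" where
  "mat_to_vec A = vec_lambda (\<lambda>(i, j). vec_nth (vec_nth A i) j)"

definition mat_height :: "'k::number_field ^ 'n ^ 'n \<Rightarrow> real" where
  "mat_height A = height (mat_to_vec A)"

definition mat_inhom_height :: "'k::number_field ^ 'n ^ 'n \<Rightarrow> real" where
  "mat_inhom_height A = inhom_height (mat_to_vec A)"

end

theory Submission
  imports Defs "Jordan_Normal_Form.Char_Poly"
begin

text \<open>
  By Cramer's rule the entries of \<open>A\<^sup>-\<^sup>1\<close> are cofactors of \<open>A\<close> divided by \<open>D = det A\<close>. The factors \<open>|D|\<^sub>v\<close>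
  drop out of a product over all places, by the product formula, so it suffices to bound the cofactors
  at each place separately. At a nonarchimedean place a cofactor is at most \<open>|A|\<^sub>v ^ (n - 1)\<close>, by the
  ultrametric inequality; at an archimedean place, which is the complex modulus of an embedding, it is
  at most \<open>(sqrt n * |A|\<^sub>v) ^ (n - 1)\<close>, by Hadamard's inequality. The local degrees at the archimedean
  places sum up to the degree of \<open>K\<close>, so the constant appears exactly once in the height. This gives the
  first estimate.

  For the second one, \<open>(1, A\<^sup>-\<^sup>1)\<close> is \<open>D\<^sup>-\<^sup>1\<close> times the vector of \<open>D\<close> and the cofactors. With \<open>a = max 1 |A|\<^sub>v\<close>,
  all of these are at most \<open>n ^ n * a ^ n\<close> at archimedean places and at most \<open>a ^ n\<close> at the others, which
  yields \<open>h(A\<^sup>-\<^sup>1) \<le> n ^ n * h(A) ^ n\<close>. This is stronger than the claim because \<open>h(A) \<ge> 1\<close> and because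
  the discriminant is a nonzero integer. The passage from local bounds to heights is
  \<open>height_comparison\<close>; the discriminant is treated in \<open>field_discriminant_ge_1\<close>.

  Most of the work lies in the product formula and the sum of the archimedean local degrees, where places
  are absolute values and local degrees are dimensions of completions. Both follow from one description of
  the places \<open>v\<close> that extend a given absolute value \<open>a\<close> of \<open>\<rat>\<close>, once \<open>a\<close> has an extension \<open>w\<close> to a field
  into which \<open>K\<close> has as many embeddings as its degree: the places are the functions \<open>w \<circ> s\<close> for embeddings
  \<open>s\<close>, and the local degree of \<open>v\<close> is the number of \<open>s\<close> that induce \<open>v\<close> (\<open>places_over_embeddings\<close> and
  \<open>local_degree_eq_card\<close>). Weighted products over the places above \<open>a\<close> thereby become products over all
  embeddings, the local factors of \<open>x\<close> become the absolute values of the norm of \<open>x\<close>, and the product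
  formula is reduced to the one for rational numbers. The proof of the description is a count: weak
  approximation bounds the sum of the local degrees from above, and Dedekind's independence of embeddings
  bounds each single one from below. The embeddings come from a primitive element. The
  extension \<open>w\<close> is the complex modulus for the archimedean absolute value; for a prime \<open>p\<close> it is obtained
  on the field of algebraic numbers from a subring that is maximal among those without \<open>1 / p\<close>
  (\<open>padic_extension_exists\<close>).
\<close>

(* Below, coeff, monom and smult refer to univariate polynomials. *)
hide_const (open) up_ring.coeff up_ring.monom Module.smult


section \<open>Algebraic integers\<close>

text \<open>If multiplication by \<open>z\<close> maps the span of finitely many \<open>b i\<close> into itself, then the \<open>b i\<close> form a
  nonzero vector in the kernel of \<open>z I - M\<close> for a coefficient matrix \<open>M\<close>, so \<open>z\<close> is a root of the
  characteristic polynomial of \<open>M\<close>. The coefficients come through a homomorphism \<open>h\<close>, because the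
  lemma is used with integer, rational and rational polynomial coefficients.\<close>
lemma monic_root_if_stable:
  fixes h :: "'r::comm_ring_1 \<Rightarrow> 'a::idom" and b :: "'i \<Rightarrow> 'a"
  assumes "comm_ring_hom h" and "finite I"
    and stable: "\<And>i. i \<in> I \<Longrightarrow> \<exists>c. z * b i = (\<Sum>j\<in>I. h (c j) * b j)"
    and "i0 \<in> I" "b i0 \<noteq> 0"
  shows "\<exists>p. lead_coeff p = 1 \<and> poly (map_poly h p) z = 0"
proof -
  interpret comm_ring_hom h by fact
  obtain c where c: "\<And>i. i \<in> I \<Longrightarrow> z * b i = (\<Sum>j\<in>I. h (c i j) * b j)"
    using stable by metis
  define n where "n = card I"
  obtain e where e: "bij_betw e {..<n} I"
    using ex_bij_betw_nat_finite[OF \<open>finite I\<close>] by (auto simp: n_def atLeast0LessThan)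
  define M where "M = mat n n (\<lambda>(i, j). c (e i) (e j))"
  have M: "M \<in> carrier_mat n n" by (simp add: M_def)
  have hM: "map_mat h M \<in> carrier_mat n n" using M by simp
  define N where "N = mat n n (\<lambda>(i, j). (if i = j then z else 0) - h (c (e i) (e j)))"
  have N: "N \<in> carrier_mat n n" by (simp add: N_def)
  define v where "v = vec n (\<lambda>i. b (e i))"
  have v: "v \<in> carrier_vec n" by (simp add: v_def)
  have "v \<noteq> 0\<^sub>v n"
  proof -
    obtain i where i: "i < n" "e i = i0"
      using e \<open>i0 \<in> I\<close> unfolding bij_betw_def by auto
    have "v $ i \<noteq> 0" using i \<open>b i0 \<noteq> 0\<close> by (simp add: v_def)
    thus ?thesis using i by auto
  qed
  moreover have "N *\<^sub>v v = 0\<^sub>v n"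
  proof (rule eq_vecI)
    fix i assume "i < dim_vec (0\<^sub>v n :: 'a vec)"
    hence i: "i < n" by simp
    hence ei: "e i \<in> I" using e by (auto simp: bij_betw_def)
    have "(N *\<^sub>v v) $ i = (\<Sum>j<n. ((if i = j then z else 0) - h (c (e i) (e j))) * b (e j))"
      using i by (simp add: N_def v_def scalar_prod_def atLeast0LessThan)
    also have "\<dots> = (\<Sum>j<n. (if i = j then z * b (e j) else 0)) - (\<Sum>j<n. h (c (e i) (e j)) * b (e j))"
      by (subst sum_subtractf [symmetric], rule sum.cong) (auto simp: algebra_simps)
    also have "(\<Sum>j<n. (if i = j then z * b (e j) else 0)) = z * b (e i)"
      using i by simp
    also have "(\<Sum>j<n. h (c (e i) (e j)) * b (e j)) = (\<Sum>j\<in>I. h (c (e i) j) * b j)"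
      by (rule sum.reindex_bij_betw[OF e])
    finally show "(N *\<^sub>v v) $ i = 0\<^sub>v n $ i" using c[OF ei] i by simp
  qed (use N in auto)
  ultimately have "Determinant.det N = 0"
    using det_0_iff_vec_prod_zero[OF N] v by blast
  moreover have "poly (char_poly (map_mat h M)) z = Determinant.det N"
    unfolding char_poly_def
    by (rule poly_det_cong[of _ n]) (auto simp: char_poly_matrix_def N_def M_def)
  ultimately have "poly (map_poly h (char_poly M)) z = 0"
    by (simp add: char_poly_hom[OF M, symmetric])
  moreover have "lead_coeff (char_poly M) = 1"
    using degree_monic_char_poly[OF M] by simp
  ultimately show ?thesis by blast
qed

lemma poly_expand_lessThan: "poly p (x :: 'a::comm_semiring_1) = (\<Sum>i<degree p. coeff p i * x ^ i) + lead_coeff p * x ^ degree p"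
proof -
  have "{..degree p} = insert (degree p) {..<degree p}" by auto
  thus ?thesis by (simp add: poly_altdef add.commute)
qed

lemma algebraic_int_stableE:
  fixes x :: "'a::field_char_0"
  assumes "algebraic_int x"
  obtains n a where "n > 0" "x ^ n = (\<Sum>i<n. of_int (a i) * x ^ i)"
proof -
  obtain p where p: "poly (map_poly of_int p) x = 0" "lead_coeff p = 1"
    using assms by (auto simp: algebraic_int_altdef_ipoly)
  have "degree p > 0"
  proof (rule ccontr)
    assume "\<not> degree p > 0"
    then obtain c where "p = [:c:]" using degree_eq_zeroE by blast
    thus False using p by auto
  qed
  moreover have "x ^ degree p = (\<Sum>i<degree p. of_int (- coeff p i) * x ^ i)"
    using p(1) p(2) by (simp add: poly_expand_lessThan degree_map_poly coeff_map_poly sum_negf add_eq_0_iff2)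
  ultimately show ?thesis using that[of "degree p" "\<lambda>i. - coeff p i"] by blast
qed

text \<open>The span over \<open>\<int>\<close> of the products \<open>x ^ i * y ^ j\<close> below the degrees of \<open>x\<close> and \<open>y\<close> is stable under
  multiplication by both numbers.\<close>
lemma algebraic_int_add_mult:
  fixes x y :: "'a::field_char_0"
  assumes "algebraic_int x" "algebraic_int y"
  shows "algebraic_int (x + y)" "algebraic_int (x * y)"
proof -
  interpret M: Modules.module "\<lambda>(k::int) (x::'a). of_int k * x"
    by unfold_locales (simp_all add: algebra_simps)
  obtain n a where n: "n > 0" "x ^ n = (\<Sum>i<n. of_int (a i) * x ^ i)"
    using algebraic_int_stableE[OF assms(1)] .
  obtain m c where m: "m > 0" "y ^ m = (\<Sum>i<m. of_int (c i) * y ^ i)"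
    using algebraic_int_stableE[OF assms(2)] .
  define B where "B = (\<lambda>(i, j). x ^ i * y ^ j) ` ({..<n} \<times> {..<m})"
  have fin: "finite B" by (simp add: B_def)
  have B_in: "x ^ i * y ^ j \<in> M.span B" if "i < n" "j < m" for i j
    using that by (intro M.span_base) (auto simp: B_def)
  have xB: "x * b \<in> M.span B" if "b \<in> B" for b
  proof -
    obtain i j where ij: "b = x ^ i * y ^ j" "i < n" "j < m" using \<open>b \<in> B\<close> by (auto simp: B_def)
    show ?thesis
    proof (cases "Suc i < n")
      case True
      thus ?thesis using B_in[of "Suc i" j] ij by (simp add: mult.assoc)
    next
      case False
      hence "Suc i = n" using ij by simp
      hence "x * b = x ^ n * y ^ j" by (auto simp: ij(1))
      also have "\<dots> = (\<Sum>l<n. of_int (a l) * (x ^ l * y ^ j))"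
        by (simp add: n(2) sum_distrib_right mult.assoc)
      also have "\<dots> \<in> M.span B" using ij by (intro M.span_sum M.span_scale B_in) auto
      finally show ?thesis .
    qed
  qed
  have yB: "y * b \<in> M.span B" if "b \<in> B" for b
  proof -
    obtain i j where ij: "b = x ^ i * y ^ j" "i < n" "j < m" using \<open>b \<in> B\<close> by (auto simp: B_def)
    show ?thesis
    proof (cases "Suc j < m")
      case True
      thus ?thesis using B_in[of i "Suc j"] ij by (simp add: mult.left_commute)
    next
      case False
      hence "Suc j = m" using ij by simp
      hence "y * b = x ^ i * y ^ m" by (auto simp: ij(1))
      also have "\<dots> = (\<Sum>l<m. of_int (c l) * (x ^ i * y ^ l))"
        by (simp add: m(2) sum_distrib_left mult.left_commute)
      also have "\<dots> \<in> M.span B" using ij by (intro M.span_sum M.span_scale B_in) auto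
      finally show ?thesis .
    qed
  qed
  have xS: "x * s \<in> M.span B" if "s \<in> M.span B" for s
    using that
  proof (induction rule: M.span_induct_alt)
    case (step k b s)
    have "x * (of_int k * b + s) = of_int k * (x * b) + x * s" by (simp add: algebra_simps)
    thus ?case using M.span_add[OF M.span_scale[OF xB[OF step(1)]] step(2)] by simp
  qed (simp add: M.span_zero)
  have conclude: "algebraic_int z" if z: "\<And>b. b \<in> B \<Longrightarrow> z * b \<in> M.span B" for z
  proof -
    have "\<exists>p::int poly. lead_coeff p = 1 \<and> poly (map_poly of_int p) z = 0"
    proof (rule monic_root_if_stable[OF of_int_hom.comm_ring_hom_axioms fin])
      show "\<exists>f. z * b = (\<Sum>j\<in>B. of_int (f j) * j)" if "b \<in> B" for b
        using z[OF that] unfolding M.span_finite[OF fin] by auto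
      show "1 \<in> B" using n m by (auto simp: B_def intro!: image_eqI[of _ _ "(0, 0)"])
    qed simp
    thus ?thesis by (auto simp: algebraic_int_altdef_ipoly)
  qed
  show "algebraic_int (x + y)"
    by (rule conclude) (simp add: distrib_right M.span_add xB yB)
  show "algebraic_int (x * y)"
    by (rule conclude) (simp add: mult.assoc xS yB)
qed

lemma algebraic_int_sum: "(\<And>i. i \<in> A \<Longrightarrow> algebraic_int (f i :: 'a::field_char_0)) \<Longrightarrow> algebraic_int (sum f A)"
  by (induction A rule: infinite_finite_induct) (auto intro: algebraic_int_add_mult)

text \<open>Multiplying the equation of \<open>x\<close> by the power \<open>n - 1\<close> of the leading coefficient \<open>g n\<close> turns it
  into a monic equation for \<open>g n * x\<close>.\<close>
lemma algebraic_imp_scaled_algebraic_int: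
  fixes x :: "'a::field_char_0"
  assumes "algebraic x"
  obtains N :: int where "N > 0" "algebraic_int (of_int N * x)"
proof -
  obtain p :: "'a poly" where p: "\<forall>i. coeff p i \<in> \<int>" "p \<noteq> 0" "poly p x = 0"
    using assms algebraicE by metis
  have "\<forall>i. \<exists>k::int. coeff p i = of_int k" using p(1) by (auto simp: Ints_def)
  then obtain g :: "nat \<Rightarrow> int" where g: "\<And>i. coeff p i = of_int (g i)" by metis
  define n where "n = degree p"
  have gn: "g n \<noteq> 0" using p(2) g[of n] by (auto simp: n_def)
  have n: "n > 0"
  proof (rule ccontr)
    assume "\<not> n > 0"
    then obtain c where "p = [:c:]" using degree_eq_zeroE[of p] n_def by auto
    thus False using p by auto
  qed
  define y where "y = of_int (g n) * x"
  have "(\<Sum>i<n. of_int (g i) * x ^ i) + of_int (g n) * x ^ n = 0"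
    using p(3) by (simp add: poly_expand_lessThan g n_def)
  hence "of_int (g n) ^ (n - 1) * ((\<Sum>i<n. of_int (g i) * x ^ i) + of_int (g n) * x ^ n) = 0"
    by simp
  hence "(\<Sum>i<n. of_int (g i * g n ^ (n - 1 - i)) * y ^ i) + y ^ n = 0"
  proof -
    have term_i: "of_int (g n) ^ (n - 1) * (of_int (g i) * x ^ i) = of_int (g i * g n ^ (n - 1 - i)) * y ^ i"
      if "i < n" for i
    proof -
      have "n - 1 = (n - 1 - i) + i" using that by simp
      hence "(of_int (g n) :: 'a) ^ (n - 1) = of_int (g n) ^ (n - 1 - i) * of_int (g n) ^ i"
        by (metis power_add)
      thus ?thesis by (simp add: y_def power_mult_distrib)
    qed
    have lead: "of_int (g n) ^ (n - 1) * (of_int (g n) * x ^ n) = y ^ n"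
      using n by (cases n) (simp_all add: y_def power_mult_distrib)
    have "(\<Sum>i<n. of_int (g i * g n ^ (n - 1 - i)) * y ^ i) =
        (\<Sum>i<n. of_int (g n) ^ (n - 1) * (of_int (g i) * x ^ i))"
      by (intro sum.cong refl) (simp only: term_i lessThan_iff)
    hence "(\<Sum>i<n. of_int (g i * g n ^ (n - 1 - i)) * y ^ i) + y ^ n =
        of_int (g n) ^ (n - 1) * ((\<Sum>i<n. of_int (g i) * x ^ i) + of_int (g n) * x ^ n)"
      unfolding distrib_left sum_distrib_left lead by (simp only:)
    thus ?thesis
      using \<open>of_int (g n) ^ (n - 1) * ((\<Sum>i<n. of_int (g i) * x ^ i) + of_int (g n) * x ^ n) = 0\<close>
      by metis
  qed
  hence "y ^ n = - (\<Sum>i<n. of_int (g i * g n ^ (n - 1 - i)) * y ^ i)"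
    by (simp add: add_eq_0_iff2)
  define c where "c = (\<lambda>i. if i < n then g i * g n ^ (n - 1 - i) else if i = n then 1 else 0)"
  define r :: "int poly" where "r = (\<Sum>i\<le>n. monom (c i) i)"
  have cr: "coeff r i = c i" for i
    by (simp add: r_def coeff_sum c_def)
  have dr: "degree r = n"
    by (rule antisym, rule degree_le) (auto simp: cr c_def intro: le_degree)
  have "lead_coeff r = 1" by (simp add: dr cr c_def)
  moreover have "poly (map_poly of_int r) y = 0"
    using \<open>y ^ n = _\<close> by (simp add: poly_expand_lessThan degree_map_poly coeff_map_poly dr cr c_def)
  ultimately have y: "algebraic_int y" by (auto simp: algebraic_int_altdef_ipoly)
  show ?thesis
  proof (rule that[of "\<bar>g n\<bar>"])
    show "algebraic_int (of_int \<bar>g n\<bar> * x)"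
      using y by (cases "g n > 0") (auto simp: y_def abs_if algebraic_int_minus_iff)
  qed (use gn in simp)
qed

lemma algebraic_if_scaled_algebraic_int:
  fixes x :: "'a::field_char_0"
  assumes "algebraic_int (of_int N * x)" "N \<noteq> 0"
  shows "algebraic x"
proof -
  obtain p where p: "poly (map_poly of_int p) (of_int N * x) = 0" "lead_coeff p = 1"
    using assms by (auto simp: algebraic_int_altdef_ipoly)
  define q :: "'a poly" where "q = pcompose (map_poly of_int p) [:0, of_int N:]"
  have "\<forall>i. coeff q i \<in> \<int>"
    unfolding q_def
    by (intro allI coeff_pcompose_semiring_closed) (auto simp: coeff_map_poly coeff_pCons split: nat.splits)
  moreover have "q \<noteq> 0"
    using p(2) assms(2) unfolding q_def by (subst pcompose_eq_0_iff) auto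
  moreover have "poly q x = 0" using p(1) by (simp add: q_def poly_pcompose mult.commute)
  ultimately show ?thesis by (auto intro: algebraicI)
qed

lemma algebraic_add_mult:
  fixes x y :: "'a::field_char_0"
  assumes "algebraic x" "algebraic y"
  shows "algebraic (x + y)" "algebraic (x * y)"
proof -
  obtain N where N: "N > 0" "algebraic_int (of_int N * x)"
    using algebraic_imp_scaled_algebraic_int[OF assms(1)] .
  obtain M where M: "M > 0" "algebraic_int (of_int M * y)"
    using algebraic_imp_scaled_algebraic_int[OF assms(2)] .
  have "algebraic_int (of_int M * (of_int N * x) + of_int N * (of_int M * y))"
    by (intro algebraic_int_add_mult(1) algebraic_int_add_mult(2)[OF _ N(2)]
          algebraic_int_add_mult(2)[OF _ M(2)]) (auto intro: int_imp_algebraic_int)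
  moreover have "of_int M * (of_int N * x) + of_int N * (of_int M * y) = of_int (N * M) * (x + y)"
    by (simp add: algebra_simps)
  ultimately have "algebraic_int (of_int (N * M) * (x + y))" by metis
  thus "algebraic (x + y)" by (rule algebraic_if_scaled_algebraic_int) (use N M in auto)
  have "algebraic_int ((of_int N * x) * (of_int M * y))"
    by (rule algebraic_int_add_mult(2)[OF N(2) M(2)])
  moreover have "(of_int N * x) * (of_int M * y) = of_int (N * M) * (x * y)"
    by (simp add: algebra_simps)
  ultimately have "algebraic_int (of_int (N * M) * (x * y))" by metis
  thus "algebraic (x * y)" by (rule algebraic_if_scaled_algebraic_int) (use N M in auto)
qed

text \<open>The \<open>p\<close>-adic absolute values will be extended to this field, which contains the image of every
  complex embedding of a number field. Since each of its elements is a root of a rational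
  polynomial, the values of an extension are determined by units and rational powers of \<open>p\<close>.\<close>

typedef algebraic_number = "{x::complex. algebraic x}"
  by (rule exI[of _ 0]) auto

setup_lifting type_definition_algebraic_number

instantiation algebraic_number :: field
begin
lift_definition zero_algebraic_number :: algebraic_number is 0 by simp
lift_definition one_algebraic_number :: algebraic_number is 1 by (auto intro: rat_imp_algebraic)
lift_definition plus_algebraic_number :: "algebraic_number \<Rightarrow> algebraic_number \<Rightarrow> algebraic_number"
  is "(+)" by (auto intro: algebraic_add_mult)
lift_definition times_algebraic_number :: "algebraic_number \<Rightarrow> algebraic_number \<Rightarrow> algebraic_number"
  is "(*)" by (auto intro: algebraic_add_mult)
lift_definition uminus_algebraic_number :: "algebraic_number \<Rightarrow> algebraic_number"
  is "uminus" by auto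
lift_definition minus_algebraic_number :: "algebraic_number \<Rightarrow> algebraic_number \<Rightarrow> algebraic_number"
  is "(-)" by (auto simp: diff_conv_add_uminus simp del: add_uminus_conv_diff intro: algebraic_add_mult)
lift_definition inverse_algebraic_number :: "algebraic_number \<Rightarrow> algebraic_number"
  is "inverse" by auto
lift_definition divide_algebraic_number :: "algebraic_number \<Rightarrow> algebraic_number \<Rightarrow> algebraic_number"
  is "(/)" by (auto simp: divide_inverse intro: algebraic_add_mult)
instance
  by standard (transfer; simp add: algebra_simps divide_inverse)+
end

instance algebraic_number :: field_char_0
proof
  have of_nat: "Rep_algebraic_number (of_nat n) = of_nat n" for n
    by (induction n) (simp_all add: zero_algebraic_number.rep_eq one_algebraic_number.rep_eq
          plus_algebraic_number.rep_eq)
  show "inj (of_nat :: nat \<Rightarrow> algebraic_number)"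
    by (rule injI) (metis of_nat of_nat_eq_iff)
qed


section \<open>Rational bases of a number field\<close>

text \<open>Bases are indexed by an initial segment of \<open>\<nat>\<close>, since they serve to index rows and columns of
  matrices below.\<close>
definition rat_indep :: "nat \<Rightarrow> (nat \<Rightarrow> 'k::field_char_0) \<Rightarrow> bool" where
  "rat_indep n b \<longleftrightarrow> (\<forall>c. (\<Sum>i<n. of_rat (c i) * b i) = 0 \<longrightarrow> (\<forall>i<n. c i = 0))"

definition rat_spanning :: "nat \<Rightarrow> (nat \<Rightarrow> 'k::field_char_0) \<Rightarrow> bool" where
  "rat_spanning n b \<longleftrightarrow> (\<forall>x. \<exists>c. x = (\<Sum>i<n. of_rat (c i) * b i))"

lemma rat_indep_iff:
  "rat_indep n b \<longleftrightarrow> inj_on b {..<n} \<and> rat_vs.independent (b ` {..<n})" for b :: "nat \<Rightarrow> 'k::field_char_0"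
proof
  assume ind: "rat_indep n b"
  have inj: "inj_on b {..<n}"
  proof (rule inj_onI, rule ccontr)
    fix i j assume ij: "i \<in> {..<n}" "j \<in> {..<n}" "b i = b j" "i \<noteq> j"
    define c :: "nat \<Rightarrow> rat" where "c = (\<lambda>k. (if k = i then 1 else 0) - (if k = j then 1 else 0))"
    have "(\<Sum>k<n. of_rat (c k) * b k) = (\<Sum>k<n. (if k = i then b k else 0) - (if k = j then b k else 0))"
      by (rule sum.cong) (auto simp: c_def of_rat_diff)
    also have "\<dots> = 0" using ij by (simp add: sum_subtractf)
    finally have "c i = 0" using ind ij by (auto simp: rat_indep_def)
    thus False using ij by (simp add: c_def)
  qed
  moreover have "rat_vs.independent (b ` {..<n})"
  proof (rule ccontr)
    assume "\<not> rat_vs.independent (b ` {..<n})"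
    then obtain u where u: "\<exists>v\<in>b ` {..<n}. u v \<noteq> 0" "(\<Sum>v\<in>b ` {..<n}. of_rat (u v) * v) = 0"
      using rat_vs.dependent_finite[of "b ` {..<n}"] by auto
    have "(\<Sum>i<n. of_rat (u (b i)) * b i) = 0"
      using u(2) by (simp add: sum.reindex[OF inj] o_def)
    hence "\<forall>i<n. u (b i) = 0" using ind[unfolded rat_indep_def, rule_format, of "\<lambda>i. u (b i)"] by auto
    thus False using u(1) by auto
  qed
  ultimately show "inj_on b {..<n} \<and> rat_vs.independent (b ` {..<n})" by simp
next
  assume *: "inj_on b {..<n} \<and> rat_vs.independent (b ` {..<n})"
  show "rat_indep n b"
    unfolding rat_indep_def
  proof (intro allI impI)
    fix c :: "nat \<Rightarrow> rat" and i assume c: "(\<Sum>i<n. of_rat (c i) * b i) = 0" and i: "i < n"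
    define u where "u = (\<lambda>v. c (the_inv_into {..<n} b v))"
    have ub: "u (b i) = c i" if "i < n" for i
      using that * by (simp add: u_def the_inv_into_f_f)
    have "(\<Sum>v\<in>b ` {..<n}. of_rat (u v) * v) = 0"
      using c * by (simp add: sum.reindex ub)
    hence "u (b i) = 0"
      using * i rat_vs.dependent_finite[of "b ` {..<n}"] by auto
    thus "c i = 0" using ub i by simp
  qed
qed

lemma rat_spanning_iff:
  "rat_spanning n b \<longleftrightarrow> rat_vs.span (b ` {..<n}) = UNIV" for b :: "nat \<Rightarrow> 'k::field_char_0"
proof
  assume s: "rat_spanning n b"
  show "rat_vs.span (b ` {..<n}) = UNIV"
  proof -
    have "x \<in> rat_vs.span (b ` {..<n})" for x
    proof -
      obtain c where c: "x = (\<Sum>i<n. of_rat (c i) * b i)" using s by (auto simp: rat_spanning_def)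
      show ?thesis unfolding c by (intro rat_vs.span_sum rat_vs.span_scale rat_vs.span_base) auto
    qed
    thus ?thesis by auto
  qed
next
  assume s: "rat_vs.span (b ` {..<n}) = UNIV"
  have "x \<in> rat_vs.span (b ` {..<n}) \<Longrightarrow> \<exists>c. x = (\<Sum>i<n. of_rat (c i) * b i)" for x
  proof (induction rule: rat_vs.span_induct_alt)
    case base
    show ?case by (rule exI[of _ "\<lambda>_. 0"]) simp
  next
    case (step q x y)
    then obtain c i where c: "y = (\<Sum>i<n. of_rat (c i) * b i)" and i: "i < n" "x = b i" by auto
    have "of_rat q * x = (\<Sum>k<n. of_rat (if k = i then q else 0) * b k)"
      using i by (simp add: if_distrib[of of_rat] if_distrib[of "\<lambda>t. t * _"] cong: if_cong)
    hence "of_rat q * x + y = (\<Sum>k<n. of_rat ((if k = i then q else 0) + c k) * b k)"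
      using c by (simp add: of_rat_add algebra_simps sum.distrib)
    thus ?case by (rule exI[of _ "\<lambda>k. (if k = i then q else 0) + c k"])
  qed
  thus "rat_spanning n b" using s by (auto simp: rat_spanning_def)
qed

lemma finite_rat_basis_exists:
  obtains B :: "'k::number_field set"
  where "finite B" "rat_vs.independent B" "rat_vs.span B = UNIV" "card B = field_degree TYPE('k)"
proof -
  obtain B0 :: "'k set" where B0: "finite B0" "\<forall>x. \<exists>c. x = (\<Sum>b\<in>B0. of_rat (c b) * b)"
    using finite_over_rat by blast
  have sp0: "x \<in> rat_vs.span B0" for x
  proof -
    obtain c where c: "x = (\<Sum>b\<in>B0. of_rat (c b) * b)" using B0(2) by blast
    show ?thesis unfolding c by (intro rat_vs.span_sum rat_vs.span_scale rat_vs.span_base)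
  qed
  obtain B where B: "B \<subseteq> B0" "rat_vs.independent B" "B0 \<subseteq> rat_vs.span B"
    using rat_vs.maximal_independent_subset[of B0] by blast
  have sp: "rat_vs.span B = UNIV"
    using sp0 rat_vs.span_mono[OF B(3)] unfolding rat_vs.span_span by blast
  have "card B = field_degree TYPE('k)"
    unfolding field_degree_def using rat_vs.dim_eq_card[of B UNIV] sp B(2) by simp
  with that B sp B0(1) show ?thesis by (meson finite_subset)
qed

lemma rat_indep_le_degree:
  fixes b :: "nat \<Rightarrow> 'k::number_field"
  assumes "rat_indep n b"
  shows "n \<le> field_degree TYPE('k)"
proof -
  obtain B :: "'k set" where B: "finite B" "rat_vs.span B = UNIV" "card B = field_degree TYPE('k)"
    using finite_rat_basis_exists by metis
  have *: "inj_on b {..<n}" "rat_vs.independent (b ` {..<n})" using assms by (auto simp: rat_indep_iff)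
  have "card (b ` {..<n}) \<le> card B"
    using rat_vs.independent_span_bound[OF B(1) *(2)] B(2) by simp
  thus ?thesis using B(3) *(1) by (simp add: card_image)
qed

lemma rat_independent_family_le_degree:
  fixes z :: "'i \<Rightarrow> 'k::number_field"
  assumes fin: "finite I" and ind: "\<And>q. (\<Sum>i\<in>I. of_rat (q i) * z i) = 0 \<Longrightarrow> \<forall>i\<in>I. q i = 0"
  shows "card I \<le> field_degree TYPE('k)"
proof -
  obtain f where f: "bij_betw f {..<card I} I"
    using ex_bij_betw_nat_finite[OF fin] by (auto simp: atLeast0LessThan)
  have "rat_indep (card I) (\<lambda>k. z (f k))"
    unfolding rat_indep_def
  proof (intro allI impI)
    fix r :: "nat \<Rightarrow> rat" and k
    assume r: "(\<Sum>k<card I. of_rat (r k) * z (f k)) = 0" and k: "k < card I"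
    define q where "q = (\<lambda>i. r (the_inv_into {..<card I} f i))"
    have qf: "q (f k) = r k" if "k < card I" for k
      using f that by (simp add: q_def bij_betw_def the_inv_into_f_f)
    have "(\<Sum>i\<in>I. of_rat (q i) * z i) = (\<Sum>k<card I. of_rat (q (f k)) * z (f k))"
      by (rule sum.reindex_bij_betw[OF f, symmetric])
    also have "\<dots> = 0" using r by (simp add: qf)
    finally have "\<forall>i\<in>I. q i = 0" by (rule ind)
    moreover have "f k \<in> I" using bij_betwE[OF f] k by blast
    ultimately show "r k = 0" using qf[OF k] by simp
  qed
  thus ?thesis by (rule rat_indep_le_degree)
qed

lemma rat_indep_degree_spanning:
  fixes b :: "nat \<Rightarrow> 'k::number_field"
  assumes "rat_indep (field_degree TYPE('k)) b"
  shows "rat_spanning (field_degree TYPE('k)) b"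
  unfolding rat_spanning_iff
proof (rule ccontr)
  let ?d = "field_degree TYPE('k)"
  assume "rat_vs.span (b ` {..<?d}) \<noteq> UNIV"
  then obtain x where x: "x \<notin> rat_vs.span (b ` {..<?d})" by blast
  obtain B :: "'k set" where B: "finite B" "rat_vs.span B = UNIV" "card B = field_degree TYPE('k)"
    using finite_rat_basis_exists by metis
  have *: "inj_on b {..<?d}" "rat_vs.independent (b ` {..<?d})" using assms by (auto simp: rat_indep_iff)
  have "rat_vs.independent (insert x (b ` {..<?d}))" using rat_vs.independent_insertI[OF x *(2)] .
  hence "card (insert x (b ` {..<?d})) \<le> card B"
    using rat_vs.independent_span_bound[OF B(1)] B(2) by simp
  moreover have "x \<notin> b ` {..<?d}" using x rat_vs.span_base[of x "b ` {..<?d}"] by auto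
  ultimately show False using B(3) *(1) by (simp add: card_image)
qed

lemma rat_basis_card:
  fixes b :: "nat \<Rightarrow> 'k::number_field"
  assumes "rat_indep n b" "rat_spanning n b"
  shows "n = field_degree TYPE('k)"
proof -
  have "field_degree TYPE('k) = card (b ` {..<n})"
    unfolding field_degree_def
    using assms rat_vs.dim_eq_card[of "b ` {..<n}" UNIV]
    by (simp add: rat_indep_iff rat_spanning_iff)
  thus ?thesis using assms by (simp add: rat_indep_iff card_image)
qed

lemma rat_basis_exists:
  obtains b :: "nat \<Rightarrow> 'k::number_field"
  where "rat_indep (field_degree TYPE('k)) b" "rat_spanning (field_degree TYPE('k)) b"
proof -
  obtain B :: "'k set" where B: "finite B" "rat_vs.independent B" "rat_vs.span B = UNIV"
      "card B = field_degree TYPE('k)"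
    using finite_rat_basis_exists .
  obtain b where "bij_betw b {..<field_degree TYPE('k)} B"
    using ex_bij_betw_nat_finite[OF B(1)] B(4) by (auto simp: atLeast0LessThan)
  thus ?thesis using that[of b] B by (auto simp: rat_indep_iff rat_spanning_iff bij_betw_def)
qed

lemma rat_spanning_nonzero:
  fixes b :: "nat \<Rightarrow> 'k::field_char_0"
  assumes "rat_spanning n b"
  obtains i where "i < n" "b i \<noteq> 0"
proof -
  obtain c where "1 = (\<Sum>i<n. of_rat (c i) * b i)" using assms unfolding rat_spanning_def by blast
  hence "(\<Sum>i<n. of_rat (c i) * b i) \<noteq> 0" by simp
  then obtain i where "i \<in> {..<n}" "of_rat (c i) * b i \<noteq> 0" by (rule sum.not_neutral_contains_not_neutral)
  thus ?thesis using that by simp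
qed

lemma field_degree_pos: "field_degree TYPE('k::number_field) > 0"
proof -
  obtain b :: "nat \<Rightarrow> 'k" where "rat_spanning (field_degree TYPE('k)) b"
    using rat_basis_exists by metis
  thus ?thesis using rat_spanning_nonzero by fastforce
qed

section \<open>Embeddings\<close>

definition embedding :: "('k::field \<Rightarrow> 'l::field) \<Rightarrow> bool" where
  "embedding s \<longleftrightarrow> s 1 = 1 \<and> (\<forall>x y. s (x + y) = s x + s y) \<and> (\<forall>x y. s (x * y) = s x * s y)"

lemma embedding_field_hom: "embedding s \<Longrightarrow> field_hom s"
proof -
  assume e: "embedding s"
  have "s 0 + s 0 = s 0" using e unfolding embedding_def by (metis add_0)
  hence "s 0 = 0" by (metis add_cancel_right_right)
  thus ?thesis using e by unfold_locales (auto simp: embedding_def)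
qed

lemma embedding_of_rat: "embedding s \<Longrightarrow> s (of_rat q) = of_rat q"
  for s :: "'k::field_char_0 \<Rightarrow> 'l::field_char_0"
proof -
  assume "embedding s"
  then interpret field_hom s by (rule embedding_field_hom)
  obtain a b where q: "q = Rat.Fract a b" "b > 0" by (cases q) auto
  have "s (of_int a / of_int b) = of_int a / of_int b"
    by (simp only: hom_div hom_of_int)
  thus ?thesis using q by (simp add: of_rat_rat)
qed

text \<open>Dedekind's argument: if \<open>s i y\<close> and \<open>s j y\<close> differ, then the relation at \<open>y * x\<close> minus \<open>s j y\<close> times
  the relation at \<open>x\<close> is a shorter relation that still involves \<open>s i\<close>.\<close>
lemma embeddings_independent:
  fixes s :: "'i \<Rightarrow> 'k::field \<Rightarrow> 'l::field"
  assumes "finite I" "\<And>i. i \<in> I \<Longrightarrow> embedding (s i)" "inj_on s I"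
    and "\<And>x. (\<Sum>i\<in>I. c i * s i x) = 0"
  shows "\<forall>i\<in>I. c i = 0"
  using assms
proof (induction I arbitrary: c rule: finite_induct)
  case (insert j I)
  have ej: "embedding (s j)" using insert.prems by simp
  have I0: "\<forall>i\<in>I. c i * (s i y - s j y) = 0" for y
  proof (rule insert.IH)
    show "embedding (s i)" if "i \<in> I" for i using that insert.prems by simp
    show "inj_on s I" using insert.prems by simp
    fix x
    have mult: "s i (y * x) = s i y * s i x" if "i \<in> insert j I" for i
      using insert.prems(1)[OF that] by (simp add: embedding_def)
    have "(\<Sum>i\<in>insert j I. c i * s i (y * x)) - s j y * (\<Sum>i\<in>insert j I. c i * s i x) = 0"
      using insert.prems(3) by simp
    moreover have "(\<Sum>i\<in>insert j I. c i * s i (y * x)) - s j y * (\<Sum>i\<in>insert j I. c i * s i x)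
       = (\<Sum>i\<in>insert j I. c i * (s i y - s j y) * s i x)"
      unfolding sum_distrib_left sum_subtractf [symmetric]
      by (intro sum.cong refl, subst mult) (auto simp: algebra_simps)
    ultimately show "(\<Sum>i\<in>I. c i * (s i y - s j y) * s i x) = 0"
      using insert.hyps by simp
  qed
  have cI: "c i = 0" if i: "i \<in> I" for i
  proof -
    have "s i \<noteq> s j" using insert.prems(2) insert.hyps i by (auto simp: inj_on_def)
    then obtain y where "s i y \<noteq> s j y" by blast
    thus ?thesis using I0[of y] i by auto
  qed
  moreover have "c j = 0"
    using insert.prems(3)[of 1] ej insert.hyps cI by (simp add: embedding_def)
  ultimately show ?case by simp
qed simp


definition rat_eval :: "rat poly \<Rightarrow> 'a::field_char_0 \<Rightarrow> 'a" where
  "rat_eval g x = poly (map_poly of_rat g) x"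

lemma map_poly_pCons_zero: "f 0 = 0 \<Longrightarrow> map_poly f (pCons a p) = pCons (f a) (map_poly f p)"
  by (simp add: poly_eq_iff coeff_map_poly coeff_pCons split: nat.split)

lemma rat_eval_simps [simp]:
  "rat_eval 0 x = 0" "rat_eval 1 x = 1" "rat_eval (pCons a p) x = of_rat a + x * rat_eval p x"
  "rat_eval (p + q) x = rat_eval p x + rat_eval q x" "rat_eval (p - q) x = rat_eval p x - rat_eval q x" "rat_eval (- p) x = - rat_eval p x"
  "rat_eval (p * q) x = rat_eval p x * rat_eval q x"
  "rat_eval (Polynomial.smult a p) x = of_rat a * rat_eval p x"
  for x :: "'a::field_char_0"
proof -
  interpret h: map_poly_comm_ring_hom "of_rat :: rat \<Rightarrow> 'a" ..
  show "rat_eval 0 x = 0" "rat_eval 1 x = 1" "rat_eval (pCons a p) x = of_rat a + x * rat_eval p x"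
    "rat_eval (p + q) x = rat_eval p x + rat_eval q x" "rat_eval (p - q) x = rat_eval p x - rat_eval q x" "rat_eval (- p) x = - rat_eval p x"
    "rat_eval (p * q) x = rat_eval p x * rat_eval q x"
    by (simp_all add: rat_eval_def h.hom_add h.hom_mult h.hom_minus h.hom_uminus map_poly_pCons_zero)
  show "rat_eval (Polynomial.smult a p) x = of_rat a * rat_eval p x"
    by (simp add: rat_eval_def of_rat_hom.map_poly_hom_smult)
qed

lemma rat_eval_pcompose: "rat_eval (pcompose p q) x = rat_eval p (rat_eval q x)"
  by (induction p) (simp_all add: pcompose_pCons)

lemma rat_eval_sum_lessThan:
  "degree p < n \<Longrightarrow> rat_eval p x = (\<Sum>i<n. of_rat (coeff p i) * x ^ i)"
  unfolding rat_eval_def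
  by (simp add: poly_altdef degree_map_poly coeff_map_poly)
     (rule sum.mono_neutral_left, auto intro: coeff_eq_0 simp: not_le)

lemma rat_eval_algebraic: "p \<noteq> 0 \<Longrightarrow> rat_eval p x = 0 \<Longrightarrow> algebraic x"
  unfolding rat_eval_def by (rule algebraicI') (auto simp: coeff_map_poly map_poly_eq_0_iff)

lemma number_field_algebraic_rat_poly:
  fixes x :: "'k::number_field"
  shows "\<exists>p. p \<noteq> 0 \<and> rat_eval p x = 0"
proof -
  obtain b :: "nat \<Rightarrow> 'k" where b: "rat_indep (field_degree TYPE('k)) b" "rat_spanning (field_degree TYPE('k)) b"
    using rat_basis_exists .
  obtain i where i: "i \<in> {..<field_degree TYPE('k)}" "b i \<noteq> 0" using rat_spanning_nonzero[OF b(2)] by auto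
  have "\<exists>p. lead_coeff p = 1 \<and> poly (map_poly of_rat p) x = 0"
    by (rule monic_root_if_stable[where b = b and I = "{..<field_degree TYPE('k)}", OF of_rat_hom.comm_ring_hom_axioms _ _ i])
       (use b(2) in \<open>auto simp: rat_spanning_def\<close>)
  then obtain p :: "rat poly" where "lead_coeff p = 1" "poly (map_poly of_rat p) x = 0" by auto
  thus ?thesis by (intro exI[of _ p]) (auto simp: rat_eval_def)
qed

lemma minimal_rat_poly:
  assumes "\<exists>p. p \<noteq> 0 \<and> rat_eval p x = 0"
  obtains q where "q \<noteq> 0" "rat_eval q x = 0" "\<And>r. r \<noteq> 0 \<Longrightarrow> rat_eval r x = 0 \<Longrightarrow> degree q \<le> degree r"
  using ex_has_least_nat[of "\<lambda>p. p \<noteq> 0 \<and> rat_eval p x = 0" _ degree] assms by metis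

lemma minimal_rat_poly_dvd:
  assumes "q \<noteq> 0" "rat_eval q x = 0" "\<And>r. r \<noteq> 0 \<Longrightarrow> rat_eval r x = 0 \<Longrightarrow> degree q \<le> degree r"
    and "rat_eval g x = 0"
  shows "q dvd g"
proof -
  have "g mod q = g - q * (g div q)" by (simp add: minus_mult_div_eq_mod)
  hence "rat_eval (g mod q) x = 0" using assms by simp
  hence "g mod q = 0" using assms(3)[of "g mod q"] degree_mod_less[OF assms(1), of g] by force
  thus ?thesis by auto
qed

text \<open>Only \<open>a + y * q' y = 0\<close> has to be solved for \<open>1 / y\<close>; minimality of the degree gives \<open>a \<noteq> 0\<close>.\<close>
lemma rat_eval_inverse:
  assumes alg: "\<exists>p. p \<noteq> 0 \<and> rat_eval p (rat_eval g x) = 0" and nz: "rat_eval g x \<noteq> 0"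
  shows "\<exists>h. inverse (rat_eval g x) = rat_eval h x"
proof -
  define y where "y = rat_eval g x"
  obtain q where q: "q \<noteq> 0" "rat_eval q y = 0" "\<And>r. r \<noteq> 0 \<Longrightarrow> rat_eval r y = 0 \<Longrightarrow> degree q \<le> degree r"
    using minimal_rat_poly[OF alg] unfolding y_def by blast
  obtain a q' where q': "q = pCons a q'" by (cases q) auto
  have a: "a \<noteq> 0"
  proof
    assume "a = 0"
    hence "q' \<noteq> 0" "rat_eval q' y = 0" using q(1,2) nz by (auto simp: q' y_def)
    hence "degree q \<le> degree q'" by (rule q(3))
    thus False using \<open>q' \<noteq> 0\<close> by (simp add: q')
  qed
  have "inverse y = rat_eval (Polynomial.smult (- 1 / a) q') y"
    using q(2) a nz by (simp add: q' y_def of_rat_divide of_rat_minus field_simps add_eq_0_iff minus_equation_iff)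
  thus ?thesis using rat_eval_pcompose[of _ g x] unfolding y_def by metis
qed

text \<open>The value \<open>P(t, \<alpha> + t \<beta>)\<close> of a polynomial \<open>P\<close> in two variables, as a polynomial in \<open>t\<close>: the
  coefficients of \<open>P\<close> are polynomials in \<open>t\<close>, and \<open>[:\<alpha>, \<beta>:]\<close> is \<open>\<alpha> + t \<beta>\<close>.\<close>
definition line_eval :: "'k \<Rightarrow> 'k \<Rightarrow> rat poly poly \<Rightarrow> 'k::field_char_0 poly" where
  "line_eval \<alpha> \<beta> P = poly (map_poly (map_poly of_rat) P) [:\<alpha>, \<beta>:]"

lemma line_eval_0 [simp]: "line_eval \<alpha> \<beta> 0 = 0" by (simp add: line_eval_def)

lemma line_eval_pCons [simp]:
  "line_eval \<alpha> \<beta> (pCons a P) = map_poly of_rat a + [:\<alpha>, \<beta>:] * line_eval \<alpha> \<beta> P"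
  by (simp add: line_eval_def map_poly_pCons_zero algebra_simps)

lemma line_eval_add [simp]: "line_eval \<alpha> \<beta> (P + Q) = line_eval \<alpha> \<beta> P + line_eval \<alpha> \<beta> Q"
  for \<alpha> :: "'k::field_char_0"
proof -
  interpret h: map_poly_comm_ring_hom "of_rat :: rat \<Rightarrow> 'k" ..
  interpret hh: map_poly_comm_ring_hom "map_poly (of_rat :: rat \<Rightarrow> 'k)" ..
  show ?thesis by (simp add: line_eval_def hh.hom_add)
qed

text \<open>The chain rule for \<open>P(t, \<alpha> + t \<beta>)\<close>.\<close>
lemma pderiv_line_eval:
  "pderiv (line_eval \<alpha> \<beta> P) = line_eval \<alpha> \<beta> (map_poly pderiv P) + Polynomial.smult \<beta> (line_eval \<alpha> \<beta> (pderiv P))"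
proof (induction P)
  case (pCons a P)
  have "pderiv (map_poly of_rat a) = (map_poly of_rat (pderiv a) :: 'a poly)"
    by (simp add: poly_eq_iff coeff_pderiv coeff_map_poly of_rat_mult of_rat_add)
  thus ?case using pCons
    by (simp add: pderiv_add pderiv_mult pderiv_pCons pderiv_smult map_poly_pCons_zero algebra_simps smult_add_right)
qed simp

lemma poly_line_eval:
  "poly (line_eval \<alpha> \<beta> P) (of_rat c) = rat_eval (map_poly (\<lambda>q. poly q c) P) (\<alpha> + of_rat c * \<beta>)"
proof (induction P)
  case (pCons a P)
  have "poly (map_poly of_rat a) (of_rat c) = (of_rat (poly a c) :: 'a)" by simp
  thus ?case using pCons by (simp add: map_poly_pCons_zero algebra_simps)
qed simp

text \<open>The line \<open>\<alpha> + t \<beta>\<close> is algebraic over \<open>\<rat>(t)\<close>: there is \<open>P \<noteq> 0\<close> with \<open>P(t, \<alpha> + t \<beta>) = 0\<close>, and its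
  degree in the second variable can be taken minimal. Differentiating in \<open>t\<close> gives
  \<open>P\<^sub>t(t, \<alpha> + t \<beta>) + \<beta> P\<^sub>X(t, \<alpha> + t \<beta>) = 0\<close>, where the second term is not zero by minimality. At a
  rational number \<open>c\<close> that is not a root of \<open>P\<^sub>X(t, \<alpha> + t \<beta>)\<close>, this equation expresses \<open>\<beta>\<close> by
  \<open>\<gamma> = \<alpha> + c \<beta>\<close>.\<close>
lemma generate_two_elements:
  fixes \<alpha> \<beta> :: "'k::number_field"
  shows "\<exists>\<gamma> g h. \<alpha> = rat_eval g \<gamma> \<and> \<beta> = rat_eval h \<gamma>"
proof -
  interpret h: map_poly_comm_ring_hom "of_rat :: rat \<Rightarrow> 'k" ..
  let ?d = "field_degree TYPE('k)"
  obtain b :: "nat \<Rightarrow> 'k" where b: "rat_indep ?d b" "rat_spanning ?d b"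
    using rat_basis_exists .
  obtain i0 where i0: "i0 \<in> {..<?d}" "[:b i0:] \<noteq> 0" using rat_spanning_nonzero[OF b(2)] by auto
  have "\<exists>P. lead_coeff P = 1 \<and> poly (map_poly (map_poly of_rat) P) [:\<alpha>, \<beta>:] = 0"
  proof (rule monic_root_if_stable[where b = "\<lambda>i. [:b i:]" and I = "{..<?d}", OF h.comm_ring_hom_axioms _ _ i0])
    fix i assume "i \<in> {..<?d}"
    obtain c where c: "\<alpha> * b i = (\<Sum>j<?d. of_rat (c j) * b j)" using b(2) unfolding rat_spanning_def by blast
    obtain c' where c': "\<beta> * b i = (\<Sum>j<?d. of_rat (c' j) * b j)" using b(2) unfolding rat_spanning_def by blast
    have "[:\<alpha>, \<beta>:] * [:b i:] = (\<Sum>j<?d. map_poly of_rat [:c j, c' j:] * [:b j:])"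
    proof (rule poly_eqI)
      fix n
      show "coeff ([:\<alpha>, \<beta>:] * [:b i:]) n = coeff (\<Sum>j<?d. map_poly of_rat [:c j, c' j:] * [:b j:]) n"
        using c c' by (auto simp: coeff_sum coeff_pCons coeff_map_poly mult.commute split: nat.split)
    qed
    thus "\<exists>c. [:\<alpha>, \<beta>:] * [:b i:] = (\<Sum>j<?d. map_poly of_rat (c j) * [:b j:])"
      by (rule exI[of _ "\<lambda>j. [:c j, c' j:]"])
  qed simp
  then obtain P0 where P0: "P0 \<noteq> 0" "line_eval \<alpha> \<beta> P0 = 0"
    unfolding line_eval_def by (metis lead_coeff_pCons(2) leading_coeff_0_iff zero_neq_one)
  obtain P where P: "P \<noteq> 0" "line_eval \<alpha> \<beta> P = 0"
      and Pmin: "\<And>R. R \<noteq> 0 \<Longrightarrow> line_eval \<alpha> \<beta> R = 0 \<Longrightarrow> degree P \<le> degree R"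
    using ex_has_least_nat[of "\<lambda>p. p \<noteq> 0 \<and> line_eval \<alpha> \<beta> p = 0" P0 degree] P0 by blast
  have "degree P > 0"
  proof (rule ccontr)
    assume "\<not> degree P > 0"
    then obtain p where "P = [:p:]" using degree_eq_zeroE[of P] by auto
    thus False using P by (auto simp: map_poly_eq_0_iff)
  qed
  hence "pderiv P \<noteq> 0" "degree (pderiv P) < degree P"
    by (auto simp: pderiv_eq_0_iff degree_pderiv)
  hence nz: "line_eval \<alpha> \<beta> (pderiv P) \<noteq> 0" using Pmin[of "pderiv P"] by force
  have "finite {x. poly (line_eval \<alpha> \<beta> (pderiv P)) x = 0}" using nz by (rule poly_roots_finite)
  hence "finite ((of_rat :: rat \<Rightarrow> 'k) -` {x. poly (line_eval \<alpha> \<beta> (pderiv P)) x = 0})"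
    by (rule finite_vimageI) (simp add: inj_on_def)
  then obtain c where c: "poly (line_eval \<alpha> \<beta> (pderiv P)) (of_rat c) \<noteq> 0"
    using ex_new_if_finite[OF infinite_UNIV_char_0] by auto
  define \<gamma> where "\<gamma> = \<alpha> + of_rat c * \<beta>"
  define g where "g = map_poly (\<lambda>q. poly q c) (pderiv P)"
  define k where "k = map_poly (\<lambda>q. poly q c) (map_poly pderiv P)"
  have "poly (pderiv (line_eval \<alpha> \<beta> P)) (of_rat c) = rat_eval k \<gamma> + \<beta> * rat_eval g \<gamma>"
    by (simp add: pderiv_line_eval poly_line_eval g_def k_def \<gamma>_def)
  hence eq: "rat_eval k \<gamma> + \<beta> * rat_eval g \<gamma> = 0" using P by simp
  have gnz: "rat_eval g \<gamma> \<noteq> 0" using c by (simp add: poly_line_eval g_def \<gamma>_def)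
  obtain u where u: "inverse (rat_eval g \<gamma>) = rat_eval u \<gamma>"
    using rat_eval_inverse[OF number_field_algebraic_rat_poly gnz] by blast
  have "\<beta> = - rat_eval k \<gamma> * inverse (rat_eval g \<gamma>)" using eq gnz by (simp add: field_simps add_eq_0_iff)
  hence \<beta>: "\<beta> = rat_eval (Polynomial.smult (-1) (k * u)) \<gamma>" by (simp add: u of_rat_minus)
  have "\<alpha> = \<gamma> - of_rat c * \<beta>" by (simp add: \<gamma>_def)
  also have "\<dots> = rat_eval ([:0, 1:] - Polynomial.smult c (Polynomial.smult (-1) (k * u))) \<gamma>"
    unfolding rat_eval_simps(5) rat_eval_simps(8)[of c] \<beta>[symmetric] by simp
  finally show ?thesis using \<beta> by blast
qed

lemma minimal_rat_poly_power_basis: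
  fixes x :: "'k::field_char_0"
  assumes "q \<noteq> 0" "rat_eval q x = 0" "\<And>r. r \<noteq> 0 \<Longrightarrow> rat_eval r x = 0 \<Longrightarrow> degree q \<le> degree r"
  shows "rat_indep (degree q) (\<lambda>i. x ^ i)" "\<exists>c. rat_eval g x = (\<Sum>i<degree q. of_rat (c i) * x ^ i)"
proof -
  show "rat_indep (degree q) (\<lambda>i. x ^ i)"
    unfolding rat_indep_def
  proof (intro allI impI)
    fix c i assume c: "(\<Sum>i<degree q. of_rat (c i) * x ^ i) = 0" and i: "i < degree q"
    define r where "r = (\<Sum>i<degree q. monom (c i) i)"
    have cr: "coeff r j = (if j < degree q then c j else 0)" for j
      by (simp add: r_def coeff_sum)
    have dr: "degree r < degree q"
      by (rule degree_lessI) (use i cr in auto)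
    have "rat_eval r x = 0" using c by (simp add: rat_eval_sum_lessThan[OF dr] cr)
    hence "r = 0" using assms(3)[of r] dr by force
    thus "c i = 0" using cr[of i] i by simp
  qed
  have dq: "degree q > 0"
  proof (rule ccontr)
    assume "\<not> degree q > 0"
    then obtain a where "q = [:a:]" using degree_eq_zeroE[of q] by auto
    thus False using assms by auto
  qed
  have "g mod q = g - q * (g div q)" by (simp add: minus_mult_div_eq_mod)
  hence "rat_eval (g mod q) x = rat_eval g x" using assms by simp
  moreover have "degree (g mod q) < degree q" using degree_mod_less[OF assms(1), of g] dq by auto
  ultimately show "\<exists>c. rat_eval g x = (\<Sum>i<degree q. of_rat (c i) * x ^ i)"
    using rat_eval_sum_lessThan by metis
qed

text \<open>Take \<open>\<alpha>\<close> for which the powers span a space of maximal dimension. An element \<open>\<beta>\<close> outside of this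
  space would, by the preceding lemma, yield a \<open>\<gamma>\<close> with a larger one.\<close>
theorem primitive_element:
  obtains \<alpha> :: "'k::number_field" where "\<And>x. \<exists>g. x = rat_eval g \<alpha>"
proof -
  define Q where "Q = (\<lambda>(\<alpha>::'k, n). rat_indep n (\<lambda>i. \<alpha> ^ i) \<and>
     (\<forall>g. \<exists>c. rat_eval g \<alpha> = (\<Sum>i<n. of_rat (c i) * \<alpha> ^ i)))"
  have exQ: "\<exists>n. Q (\<alpha>, n)" for \<alpha>
  proof -
    obtain q where q: "q \<noteq> 0" "rat_eval q \<alpha> = 0" "\<And>r. r \<noteq> 0 \<Longrightarrow> rat_eval r \<alpha> = 0 \<Longrightarrow> degree q \<le> degree r"
      using minimal_rat_poly[OF number_field_algebraic_rat_poly] by blast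
    show ?thesis unfolding Q_def using minimal_rat_poly_power_basis[OF q] by blast
  qed
  obtain m0 where m0: "Q (0, m0)" using exQ by blast
  have bound: "\<forall>y. Q y \<longrightarrow> snd y < Suc (field_degree TYPE('k))"
    unfolding Q_def using rat_indep_le_degree by (auto simp: less_Suc_eq_le)
  obtain \<alpha> n where n: "Q (\<alpha>, n)" and max: "\<And>\<gamma> m. Q (\<gamma>, m) \<Longrightarrow> m \<le> n"
    using ex_has_greatest_nat[OF m0 bound] by auto
  have "\<exists>g. \<beta> = rat_eval g \<alpha>" for \<beta>
  proof (rule ccontr)
    assume not: "\<not> ?thesis"
    obtain \<gamma> g h where gh: "\<alpha> = rat_eval g \<gamma>" "\<beta> = rat_eval h \<gamma>" using generate_two_elements by blast
    obtain m where m: "Q (\<gamma>, m)" using exQ by blast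
    let ?A = "(\<lambda>i. \<alpha> ^ i) ` {..<n}" and ?C = "(\<lambda>i. \<gamma> ^ i) ` {..<m}"
    have A: "inj_on (\<lambda>i. \<alpha> ^ i) {..<n}" "rat_vs.independent ?A" using n by (auto simp: Q_def rat_indep_iff)
    have pow: "\<alpha> ^ i = rat_eval (monom 1 i) \<alpha>" for i
      by (induction i) (simp_all add: monom_0 monom_Suc)
    have spA: "\<exists>g. y = rat_eval g \<alpha>" if "y \<in> rat_vs.span ?A" for y
      using that
    proof (induction rule: rat_vs.span_induct_alt)
      case base show ?case by (rule exI[of _ 0]) simp
    next
      case (step c x y)
      then obtain i g where "x = \<alpha> ^ i" "y = rat_eval g \<alpha>" by auto
      hence "of_rat c * x + y = rat_eval (Polynomial.smult c (monom 1 i) + g) \<alpha>" using pow by simp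
      thus ?case by blast
    qed
    hence "\<beta> \<notin> rat_vs.span ?A" using not by blast
    hence ind: "rat_vs.independent (insert \<beta> ?A)" using rat_vs.independent_insertI[OF _ A(2)] by blast
    have spC: "rat_eval k \<gamma> \<in> rat_vs.span ?C" for k
    proof -
      obtain c where c: "rat_eval k \<gamma> = (\<Sum>i<m. of_rat (c i) * \<gamma> ^ i)" using m unfolding Q_def by blast
      show ?thesis unfolding c by (intro rat_vs.span_sum rat_vs.span_scale rat_vs.span_base) auto
    qed
    have "insert \<beta> ?A \<subseteq> rat_vs.span ?C"
    proof -
      have "\<alpha> ^ i \<in> rat_vs.span ?C" for i
        using spC[of "pcompose (monom 1 i) g"] unfolding rat_eval_pcompose gh(1)[symmetric] pow[symmetric] .
      thus ?thesis using spC[of h] gh(2) by auto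
    qed
    hence "card (insert \<beta> ?A) \<le> card ?C" using rat_vs.independent_span_bound[OF _ ind, of ?C] by simp
    also have "\<dots> \<le> m" using card_image_le[of "{..<m}"] by simp
    also have "m \<le> n" using max m by blast
    finally have "card (insert \<beta> ?A) \<le> n" .
    moreover have "\<beta> \<notin> ?A" using not pow by blast
    ultimately show False using A(1) by (simp add: card_image)
  qed
  thus ?thesis using that by blast
qed

text \<open>For a primitive element \<open>\<alpha>\<close> with minimal polynomial \<open>q\<close>, each complex root \<open>z\<close> of \<open>q\<close> gives an
  embedding \<open>g(\<alpha>) \<mapsto> g(z)\<close>. There are \<open>field_degree\<close> many roots because \<open>q\<close> is irreducible, hence
  minimal for each of its roots, and so shares none of them with its derivative.\<close>
theorem complex_embeddings_exist:
  obtains s :: "nat \<Rightarrow> 'k::number_field \<Rightarrow> complex"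
  where "\<And>i. i < field_degree TYPE('k) \<Longrightarrow> embedding (s i)" "inj_on s {..<field_degree TYPE('k)}"
proof -
  let ?d = "field_degree TYPE('k)"
  obtain \<alpha> :: 'k where \<alpha>: "\<And>x. \<exists>g. x = rat_eval g \<alpha>" using primitive_element by metis
  obtain q where q: "q \<noteq> 0" "rat_eval q \<alpha> = 0" "\<And>r. r \<noteq> 0 \<Longrightarrow> rat_eval r \<alpha> = 0 \<Longrightarrow> degree q \<le> degree r"
    using minimal_rat_poly[OF number_field_algebraic_rat_poly] by blast
  have "rat_spanning (degree q) (\<lambda>i. \<alpha> ^ i)"
    unfolding rat_spanning_def using minimal_rat_poly_power_basis(2)[OF q] \<alpha> by metis
  hence dq: "degree q = ?d"
    using rat_basis_card minimal_rat_poly_power_basis(1)[OF q] by blast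
  define f :: "complex poly" where "f = map_poly of_rat q"
  have f: "f \<noteq> 0" "degree f = ?d" "\<And>z. poly f z = rat_eval q z"
    using q(1) dq by (simp_all add: f_def map_poly_eq_0_iff degree_map_poly rat_eval_def)
  \<comment> \<open>any polynomial vanishing at a root of \<open>q\<close> has at least the degree of \<open>q\<close>\<close>
  have minz: "degree q \<le> degree r" if z: "rat_eval q z = 0" "r \<noteq> 0" "rat_eval r z = 0" for z :: complex and r
  proof -
    have "\<exists>p. p \<noteq> 0 \<and> rat_eval p z = 0" using q(1) z(1) by blast
    then obtain r0 where r0: "r0 \<noteq> 0" "rat_eval r0 z = 0" "\<And>r. r \<noteq> 0 \<Longrightarrow> rat_eval r z = 0 \<Longrightarrow> degree r0 \<le> degree r"
      using minimal_rat_poly by blast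
    have "r0 dvd q" by (rule minimal_rat_poly_dvd[OF r0 z(1)])
    then obtain t where t: "q = r0 * t" by (elim dvdE)
    have tn: "t \<noteq> 0" using q(1) t by auto
    have deg: "degree q = degree r0 + degree t" using r0(1) tn by (simp add: t degree_mult_eq)
    have "degree r0 > 0"
    proof (rule ccontr)
      assume "\<not> degree r0 > 0"
      then obtain a where "r0 = [:a:]" using degree_eq_zeroE[of r0] by auto
      thus False using r0(1,2) by auto
    qed
    moreover have "rat_eval r0 \<alpha> = 0 \<or> rat_eval t \<alpha> = 0" using q(2) by (simp add: t)
    ultimately have "degree q \<le> degree r0" using q(3)[OF r0(1)] q(3)[OF tn] deg by linarith
    thus ?thesis using r0(3)[OF z(2,3)] by linarith
  qed
  have "rsquarefree f"
    unfolding rsquarefree_roots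
  proof (intro allI notI, elim conjE)
    fix z assume z: "poly f z = 0" "poly (pderiv f) z = 0"
    have "pderiv f = map_poly of_rat (pderiv q)"
      by (simp add: f_def poly_eq_iff coeff_pderiv coeff_map_poly of_rat_mult of_rat_add)
    hence "rat_eval (pderiv q) z = 0" using z(2) by (simp add: rat_eval_def)
    moreover have "pderiv q \<noteq> 0" using dq field_degree_pos[where 'k='k] by (simp add: pderiv_eq_0_iff)
    ultimately have "degree q \<le> degree (pderiv q)" using minz z(1) f(3) by metis
    thus False using dq field_degree_pos[where 'k='k] by (simp add: degree_pderiv)
  qed
  hence card: "card {z. poly f z = 0} = ?d" using rsquarefree_card_degree[OF f(1)] f(2) by simp
  have fin: "finite {z. poly f z = 0}" using f(1) by (rule poly_roots_finite)
  obtain z where z: "bij_betw z {..<?d} {z. poly f z = 0}"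
    using ex_bij_betw_nat_finite[OF fin] card by (auto simp: atLeast0LessThan)
  define G where "G = (\<lambda>x. SOME g. x = rat_eval g \<alpha>)"
  have G: "rat_eval (G x) \<alpha> = x" for x
    unfolding G_def using someI_ex[OF \<alpha>[of x]] by simp
  define s where "s = (\<lambda>i x. rat_eval (G x) (z i))"
  have s: "s i (rat_eval g \<alpha>) = rat_eval g (z i)" if i: "i < ?d" for i g
  proof -
    have "rat_eval (G (rat_eval g \<alpha>) - g) \<alpha> = 0" by (simp add: G)
    from minimal_rat_poly_dvd[OF q(1,2) q(3) this] have "q dvd G (rat_eval g \<alpha>) - g" by simp
    then obtain t where t: "G (rat_eval g \<alpha>) - g = q * t" by (elim dvdE)
    have "rat_eval q (z i) = 0" using z i f(3) by (auto simp: bij_betw_def)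
    hence "rat_eval (G (rat_eval g \<alpha>) - g) (z i) = 0" unfolding t by simp
    thus ?thesis by (simp add: s_def)
  qed
  have "embedding (s i)" if i: "i < ?d" for i
    unfolding embedding_def
  proof (intro conjI allI)
    show "s i 1 = 1" using s[OF i, of 1] by simp
    fix x y
    have "s i (rat_eval (G x) \<alpha> + rat_eval (G y) \<alpha>) = rat_eval (G x) (z i) + rat_eval (G y) (z i)"
      using s[OF i, of "G x + G y"] by simp
    thus "s i (x + y) = s i x + s i y" unfolding G by (simp add: s_def)
    have "s i (rat_eval (G x) \<alpha> * rat_eval (G y) \<alpha>) = rat_eval (G x) (z i) * rat_eval (G y) (z i)"
      using s[OF i, of "G x * G y"] by simp
    thus "s i (x * y) = s i x * s i y" unfolding G by (simp add: s_def)
  qed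
  moreover have "inj_on s {..<?d}"
  proof (rule inj_onI)
    fix i j assume ij: "i \<in> {..<?d}" "j \<in> {..<?d}" "s i = s j"
    have "z i = z j" using s[of i "[:0, 1:]"] s[of j "[:0, 1:]"] ij by simp
    thus "i = j" using z ij by (auto simp: bij_betw_def inj_on_def)
  qed
  ultimately show ?thesis using that by blast
qed

lemma embedding_algebraic:
  fixes s :: "'k::number_field \<Rightarrow> 'l::field_char_0"
  assumes "embedding s"
  shows "algebraic (s x)"
proof -
  interpret field_hom s using assms by (rule embedding_field_hom)
  obtain p where p: "p \<noteq> 0" "rat_eval p x = 0" using number_field_algebraic_rat_poly by blast
  have "s (rat_eval g x) = rat_eval g (s x)" for g
    by (induction g) (simp_all add: hom_add hom_mult embedding_of_rat[OF assms])
  hence "rat_eval p (s x) = 0" using p(2) hom_zero by metis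
  thus ?thesis using p(1) rat_eval_algebraic by blast
qed

theorem algebraic_number_embeddings:
  fixes s :: "nat \<Rightarrow> 'k::number_field \<Rightarrow> complex"
  assumes "\<And>i. i < n \<Longrightarrow> embedding (s i)" "inj_on s {..<n}"
  obtains t where "\<And>i. i < n \<Longrightarrow> embedding (t i)" "inj_on t {..<n}"
    "\<And>i x. i < n \<Longrightarrow> Rep_algebraic_number (t i x) = s i x"
proof -
  define t where "t = (\<lambda>i x. Abs_algebraic_number (s i x))"
  have rep: "Rep_algebraic_number (t i x) = s i x" if "i < n" for i x
    using embedding_algebraic[OF assms(1)[OF that]] by (simp add: t_def Abs_algebraic_number_inverse)
  have "embedding (t i)" if "i < n" for i
    using assms(1)[OF that] rep[OF that]
    by (simp add: embedding_def Rep_algebraic_number_inject[symmetric] plus_algebraic_number.rep_eq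
        times_algebraic_number.rep_eq one_algebraic_number.rep_eq)
  moreover have "inj_on t {..<n}"
  proof (rule inj_onI)
    fix i j assume ij: "i \<in> {..<n}" "j \<in> {..<n}" "t i = t j"
    hence "s i = s j" using rep by (metis ext lessThan_iff)
    thus "i = j" using assms(2) ij by (auto simp: inj_on_def)
  qed
  ultimately show ?thesis using that rep by blast
qed


section \<open>Places over a fixed absolute value of the rationals\<close>

lemma absolute_valueD:
  assumes "absolute_value v"
  shows "v x \<ge> 0" "v x = 0 \<longleftrightarrow> x = 0" "v (x * y) = v x * v y" "v (x + y) \<le> v x + v y"
  using assms by (auto simp: absolute_value_def)

lemma absolute_value_simps:
  fixes v :: "'k::field \<Rightarrow> real"
  assumes v: "absolute_value v"
  shows "v 0 = 0" "v 1 = 1" "v (- x) = v x" "v (x ^ n) = v x ^ n" "v (inverse x) = inverse (v x)"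
    "v (x / y) = v x / v y" "v (x - y) \<le> v x + v y" "v (x - y) = v (y - x)"
    "v (sum f A) \<le> (\<Sum>a\<in>A. v (f a))" "v (prod f A) = (\<Prod>a\<in>A. v (f a))"
    "0 < v x \<longleftrightarrow> x \<noteq> 0"
proof -
  note D = absolute_valueD[OF v]
  show 0: "v 0 = 0" using D(2) by simp
  have "v 1 * v 1 = v 1" using D(3)[of 1 1] by simp
  moreover have "v 1 \<noteq> 0" using D(2)[of 1] by simp
  ultimately show 1: "v 1 = 1" by simp
  have "v (- 1) * v (- 1) = 1" using D(3)[of "-1" "-1"] 1 by simp
  hence "v (- 1) = 1" using D(1)[of "-1"] by (metis abs_of_nonneg abs_mult_self_eq mult_cancel_left1 power2_eq_1_iff power2_eq_square abs_minus_cancel abs_one)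
  hence m: "v (- x) = v x" for x using D(3)[of "-1" x] by simp
  thus "v (- x) = v x" .
  show "v (x ^ n) = v x ^ n" by (induction n) (simp_all add: 1 D(3))
  show inv: "v (inverse x) = inverse (v x)" for x
  proof (cases "x = 0")
    case False
    hence "v x * v (inverse x) = 1" using D(3)[of x "inverse x"] 1 by simp
    thus ?thesis by (metis inverse_unique)
  qed (simp add: 0)
  show "v (x / y) = v x / v y" by (simp add: divide_inverse D(3) inv)
  show "v (x - y) \<le> v x + v y" using D(4)[of x "-y"] m[of y] by simp
  show "v (x - y) = v (y - x)" using m[of "x - y"] by simp
  show "v (sum f A) \<le> (\<Sum>a\<in>A. v (f a))"
  proof (induction A rule: infinite_finite_induct)
    case (insert a A)
    thus ?case using D(4)[of "f a" "sum f A"] by simp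
  qed (simp_all add: 0)
  show "v (prod f A) = (\<Prod>a\<in>A. v (f a))"
    by (induction A rule: infinite_finite_induct) (simp_all add: 1 D(3))
  show "0 < v x \<longleftrightarrow> x \<noteq> 0" using D(1,2)[of x] by (auto simp: less_le)
qed

lemma ultrametric_sum_le:
  assumes v: "absolute_value v" and um: "\<And>x y. v (x + y) \<le> max (v x) (v y)"
    and le: "\<And>i. i \<in> I \<Longrightarrow> v (f i) \<le> b" and b: "b \<ge> 0"
  shows "v (sum f I) \<le> b"
  using le
proof (induction I rule: infinite_finite_induct)
  case (insert i I)
  have "v (sum f (insert i I)) \<le> max (v (f i)) (v (sum f I))" using insert.hyps um by simp
  thus ?case using insert by fastforce
qed (use b in \<open>simp_all add: absolute_value_simps[OF v]\<close>)

text \<open>Linear independence of \<open>S\<close> over the completion \<open>\<rat>\<^sub>v\<close>, inside the completion of \<open>K\<close>, expressed without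
  completions: in a space of finite dimension all norms are equivalent, so independence means that
  the coefficients are bounded by the value of the combination.\<close>
definition approx_indep :: "('k::field_char_0 \<Rightarrow> real) \<Rightarrow> 'k set \<Rightarrow> bool" where
  "approx_indep v S \<longleftrightarrow> finite S \<and>
     (\<exists>c>0. \<forall>q. \<forall>s\<in>S. c * v (of_rat (q s)) \<le> v (\<Sum>t\<in>S. of_rat (q t) * t))"

lemma approx_indep_card_le:
  fixes v :: "'k::number_field \<Rightarrow> real"
  assumes v: "absolute_value v" and S: "approx_indep v S"
  shows "card S \<le> field_degree TYPE('k)"
proof -
  obtain c where c: "c > 0" "\<And>q s. s \<in> S \<Longrightarrow> c * v (of_rat (q s)) \<le> v (\<Sum>t\<in>S. of_rat (q t) * t)"
    and fin: "finite S" using S unfolding approx_indep_def by blast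
  show ?thesis
  proof (rule rat_independent_family_le_degree[OF fin, where z = "\<lambda>t. t"], rule ballI)
    fix q s assume q: "(\<Sum>t\<in>S. of_rat (q t) * t) = 0" and s: "s \<in> S"
    have "c * v (of_rat (q s)) \<le> 0" using c(2)[OF s, of q] q absolute_value_simps(1)[OF v] by simp
    hence "\<not> v (of_rat (q s)) > 0" using c(1) by (simp add: mult_le_0_iff)
    thus "q s = 0" using absolute_value_simps(11)[OF v, of "of_rat (q s)"] by simp
  qed
qed

text \<open>By density of the rational span this describes a basis over \<open>\<rat>\<^sub>v\<close> of the completion of \<open>K\<close>, chosen
  inside \<open>K\<close>.\<close>
definition local_basis :: "('k::field_char_0 \<Rightarrow> real) \<Rightarrow> 'k set \<Rightarrow> bool" where
  "local_basis v S \<longleftrightarrow> approx_indep v S \<and> (\<forall>x. \<forall>e>0. \<exists>q. v (x - (\<Sum>t\<in>S. of_rat (q t) * t)) < e)"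

text \<open>If \<open>insert x S\<close> is dependent, then there are combinations of \<open>x\<close> and \<open>S\<close> that are small compared to
  their coefficients. The coefficient of \<open>x\<close> is not zero, as \<open>S\<close> is independent; dividing by it shows
  that \<open>x\<close> is close to the span of \<open>S\<close>.\<close>
lemma approx_indep_insert_or_dense:
  fixes v :: "'k::field_char_0 \<Rightarrow> real"
  assumes v: "absolute_value v" and S: "approx_indep v S" and x: "x \<notin> S"
    and nd: "\<not> approx_indep v (insert x S)" and e: "e > 0"
  shows "\<exists>q. v (x - (\<Sum>t\<in>S. of_rat (q t) * t)) < e"
proof -
  note D = absolute_valueD[OF v] absolute_value_simps[OF v]
  obtain c0 where c0: "c0 > 0" "\<And>q s. s \<in> S \<Longrightarrow> c0 * v (of_rat (q s)) \<le> v (\<Sum>t\<in>S. of_rat (q t) * t)"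
    and fin: "finite S" using S unfolding approx_indep_def by blast
  \<comment> \<open>the first bound forces \<open>q x \<noteq> 0\<close> and bounds the coefficients, the others give the error \<open>e\<close>\<close>
  define c where "c = min (c0 / 2) (min e (e * c0 / (2 * v x + 1)))"
  have "c > 0" using c0(1) e D(1)[of x] by (simp add: c_def)
  moreover have "c \<le> c0 / 2" "c \<le> e" "c \<le> e * c0 / (2 * v x + 1)"
    unfolding c_def by linarith+
  ultimately have c: "c > 0" "c \<le> c0 / 2" "c \<le> e" "c \<le> e * c0 / (2 * v x + 1)" by blast+
  obtain q s where s: "s \<in> insert x S"
    and q: "v (\<Sum>t\<in>insert x S. of_rat (q t) * t) < c * v (of_rat (q s))"
    using nd fin c(1) unfolding approx_indep_def by (force simp: not_le)
  have qx: "q x \<noteq> 0"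
  proof
    assume 0: "q x = 0"
    have "s \<in> S" using s q 0 D(1)[of "\<Sum>t\<in>insert x S. of_rat (q t) * t"] by (auto simp: D(5))
    hence "c0 * v (of_rat (q s)) \<le> v (\<Sum>t\<in>S. of_rat (q t) * t)" by (rule c0(2))
    also have "\<dots> < c * v (of_rat (q s))" using q fin x 0 by simp
    finally show False using c(2) c0(1) D(1)[of "of_rat (q s)"] by (auto simp: mult_less_cancel_right)
  qed
  define r where "r = (\<lambda>t. q t / q x)"
  have "(\<Sum>t\<in>insert x S. of_rat (q t) * t) = of_rat (q x) * (x + (\<Sum>t\<in>S. of_rat (r t) * t))"
  proof -
    have qr: "of_rat (q t) = of_rat (q x) * (of_rat (r t) :: 'k)" for t
      using qx by (simp add: r_def of_rat_divide)
    have "(\<Sum>t\<in>S. of_rat (q t) * t) = of_rat (q x) * (\<Sum>t\<in>S. of_rat (r t) * t)"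
      unfolding sum_distrib_left by (intro sum.cong refl) (metis qr mult.assoc)
    thus ?thesis using fin x by (simp add: distrib_left)
  qed
  hence "v (of_rat (q x)) * v (x + (\<Sum>t\<in>S. of_rat (r t) * t)) < c * v (of_rat (q s))"
    using q D(3) by metis
  moreover have "v (of_rat (q s)) = v (of_rat (q x)) * v (of_rat (r s))"
    using qx by (simp add: D(3)[symmetric] r_def of_rat_divide)
  moreover have "v (of_rat (q x)) > 0" using qx by (simp add: D)
  ultimately have main: "v (x + (\<Sum>t\<in>S. of_rat (r t) * t)) < c * v (of_rat (r s))"
    by (simp add: mult.left_commute)
  have "v (x + (\<Sum>t\<in>S. of_rat (r t) * t)) < e"
  proof (cases "s = x")
    case True
    thus ?thesis using main c(3) qx by (simp add: r_def D)
  next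
    case False
    hence "s \<in> S" using s by simp
    hence "c0 * v (of_rat (r s)) \<le> v (\<Sum>t\<in>S. of_rat (r t) * t)" by (rule c0(2))
    also have "\<dots> = v ((x + (\<Sum>t\<in>S. of_rat (r t) * t)) - x)" by simp
    also have "\<dots> \<le> v (x + (\<Sum>t\<in>S. of_rat (r t) * t)) + v x" by (rule D)
    also have "\<dots> \<le> c * v (of_rat (r s)) + v x" using main by simp
    also have "\<dots> \<le> c0 / 2 * v (of_rat (r s)) + v x"
      using mult_right_mono[OF c(2) D(1)[of "of_rat (r s)"]] by linarith
    finally have "v (of_rat (r s)) \<le> 2 * v x / c0" using c0(1) by (simp add: field_simps)
    hence "c * v (of_rat (r s)) \<le> c * (2 * v x / c0)" by (rule mult_left_mono) (use c(1) in simp)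
    also have "\<dots> \<le> e * c0 / (2 * v x + 1) * (2 * v x / c0)"
      using c(4) c0(1) D(1)[of x] by (intro mult_right_mono) auto
    also have "\<dots> = e * (2 * v x / (2 * v x + 1))" using c0(1) by (simp add: field_simps)
    also have "\<dots> \<le> e * 1" using e D(1)[of x] by (intro mult_left_mono) (auto simp: field_simps)
    finally show ?thesis using main by simp
  qed
  moreover have "x - (\<Sum>t\<in>S. of_rat (- r t) * t) = x + (\<Sum>t\<in>S. of_rat (r t) * t)"
    by (simp add: of_rat_minus sum_negf)
  ultimately show ?thesis by metis
qed

text \<open>An independent set of maximal size works; its size is bounded by the degree.\<close>
lemma local_basis_exists:
  fixes v :: "'k::number_field \<Rightarrow> real"
  assumes v: "absolute_value v"
  obtains S where "local_basis v S"
proof -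
  have "approx_indep v {}" unfolding approx_indep_def by (auto intro: exI[of _ 1])
  moreover have "\<forall>S. approx_indep v S \<longrightarrow> card S < Suc (field_degree TYPE('k))"
    using approx_indep_card_le[OF v] by (auto simp: less_Suc_eq_le)
  ultimately obtain S where S: "approx_indep v S" and max: "\<And>S'. approx_indep v S' \<Longrightarrow> card S' \<le> card S"
    using ex_has_greatest_nat[of "approx_indep v" "{}" card] by blast
  have fin: "finite S" using S by (simp add: approx_indep_def)
  have "\<exists>q. v (x - (\<Sum>t\<in>S. of_rat (q t) * t)) < e" if e: "e > 0" for x e
  proof (cases "x \<in> S")
    case True
    have "(\<Sum>t\<in>S. of_rat (if t = x then 1 else 0) * t) = x"
      using True fin by (simp add: if_distrib[of of_rat] if_distrib[of "\<lambda>t. t * _"] cong: if_cong)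
    thus ?thesis using e by (intro exI[of _ "\<lambda>t. if t = x then 1 else 0"]) (simp add: absolute_value_simps[OF v])
  next
    case False
    have "\<not> approx_indep v (insert x S)" using max[of "insert x S"] False fin by auto
    thus ?thesis using approx_indep_insert_or_dense[OF v S False _ e] by blast
  qed
  thus ?thesis using that S unfolding local_basis_def by blast
qed

lemma local_basis_nonempty:
  assumes v: "absolute_value v" and "local_basis v S"
  shows "card S \<ge> 1"
proof -
  have "S \<noteq> {}"
  proof
    assume "S = {}"
    have "\<forall>x. \<forall>e>0. \<exists>q. v (x - (\<Sum>t\<in>S. of_rat (q t) * t)) < e"
      using assms(2) by (simp add: local_basis_def)
    from this[rule_format, of 1 1] have "v 1 < 1" using \<open>S = {}\<close> by simp
    thus False using absolute_value_simps[OF v] by simp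
  qed
  thus ?thesis using assms(2) by (simp add: local_basis_def approx_indep_def Suc_le_eq card_gt_0_iff)
qed

definition places_over :: "(rat \<Rightarrow> real) \<Rightarrow> ('k::field_char_0 \<Rightarrow> real) set" where
  "places_over a = {v. absolute_value v \<and> (\<forall>q. v (of_rat q) = a q)}"

lemma ln_powi: "a > 0 \<Longrightarrow> ln (a powi j) = of_int j * ln (a::real)"
  using powr_real_of_int'[of a j] by (metis less_eq_real_def ln_powr less_numeral_extra(3))

text \<open>Two absolute values that agree on \<open>\<rat>\<close> and satisfy \<open>v y < v' y\<close> are separated by a suitable
  \<open>y ^ k / q ^ j\<close>.\<close>
lemma places_separate_aux:
  fixes v v' :: "'k::field_char_0 \<Rightarrow> real"
  assumes v: "v \<in> places_over a" and v': "v' \<in> places_over a" and lt: "v y < v' y" and q: "a q > 1"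
  shows "\<exists>x. v x < 1 \<and> v' x > 1"
proof -
  have av: "absolute_value v" "absolute_value v'" and aq: "v (of_rat q) = a q" "v' (of_rat q) = a q"
    using v v' by (auto simp: places_over_def)
  note D = absolute_valueD[OF av(1)] absolute_value_simps[OF av(1)]
  note D' = absolute_valueD[OF av(2)] absolute_value_simps[OF av(2)]
  show ?thesis
  proof (cases "y = 0")
    case True
    thus ?thesis using lt D' D by simp
  next
    case False
    hence pos: "v y > 0" "v' y > 0" by (simp_all add: D D')
    have "v' y / v y > 1" using pos lt by simp
    then obtain k where k: "(v' y / v y) ^ k > (a q) ^ 2" using real_arch_pow by blast
    \<comment> \<open>the gap between \<open>v y ^ k\<close> and \<open>v' y ^ k\<close> is so large that a power of \<open>a q\<close> lies inside\<close>
    define L where "L = ln (a q)"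
    have L: "L > 0" using q by (simp add: L_def)
    define j where "j = \<lfloor>ln (v y ^ k) / L\<rfloor> + 1"
    have j1: "v y ^ k < a q powi j"
    proof -
      have "ln (v y ^ k) / L < of_int j" unfolding j_def by linarith
      hence "ln (v y ^ k) < of_int j * L" using L by (simp add: field_simps)
      also have "\<dots> = ln (a q powi j)" using q by (simp add: L_def ln_powi)
      finally show ?thesis using pos q by (simp add: zero_less_power_int)
    qed
    have "a q powi j \<le> v y ^ k * a q"
    proof -
      have "of_int j \<le> ln (v y ^ k) / L + 1" unfolding j_def by linarith
      hence "of_int j * L \<le> ln (v y ^ k) + L" using L by (simp add: field_simps)
      hence "ln (a q powi j) \<le> ln (v y ^ k * a q)" using q pos by (simp add: L_def ln_powi ln_mult)
      thus ?thesis using pos q by (simp add: zero_less_power_int)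
    qed
    also have "\<dots> < v y ^ k * (a q) ^ 2" using q pos by (simp add: power2_eq_square)
    also have "\<dots> < v y ^ k * (v' y / v y) ^ k" using k pos by (intro mult_strict_left_mono) auto
    also have "\<dots> = v' y ^ k" using pos by (simp add: power_divide)
    finally have j2: "a q powi j < v' y ^ k" .
    have q0: "of_rat q \<noteq> (0::'k)" using aq q D by (metis not_one_less_zero)
    have powi: "v (of_rat q powi j) = a q powi j" "v' (of_rat q powi j) = a q powi j"
      using aq by (simp_all add: power_int_def D D')
    have pp: "a q powi j > 0" using q by (simp add: zero_less_power_int)
    show ?thesis
      using j1 j2 powi pp by (intro exI[of _ "y ^ k / of_rat q powi j"]) (simp add: D D')
  qed
qed

lemma places_separate:
  fixes v v' :: "'k::field_char_0 \<Rightarrow> real"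
  assumes v: "v \<in> places_over a" and v': "v' \<in> places_over a" and ne: "v \<noteq> v'" and q: "a q > 1"
  shows "\<exists>x. v x < 1 \<and> v' x > 1"
proof -
  have av: "absolute_value v" "absolute_value v'"
    using v v' by (auto simp: places_over_def)
  note D = absolute_valueD[OF av(1)] absolute_value_simps[OF av(1)]
  note D' = absolute_valueD[OF av(2)] absolute_value_simps[OF av(2)]
  obtain y where "v y \<noteq> v' y" using ne by blast
  then consider "v y < v' y" | "v y > v' y" by linarith
  thus ?thesis
  proof cases
    case 1 thus ?thesis using places_separate_aux[OF v v' _ q] by blast
  next
    case 2
    hence "y \<noteq> 0" by (auto simp: D D')
    hence "v (inverse y) < v' (inverse y)" using 2 by (simp add: D D')
    thus ?thesis using places_separate_aux[OF v v' _ q] by blast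
  qed
qed

text \<open>The sequence \<open>x ^ n / (1 + x ^ n)\<close> tends to \<open>0\<close> where \<open>x\<close> is small and to \<open>1\<close> where \<open>x\<close> is large.\<close>
lemma power_quotient_tendsto_0:
  fixes v :: "'k::field \<Rightarrow> real"
  assumes v: "absolute_value v" and x: "v x < 1"
  shows "(\<lambda>n. v (x ^ n / (1 + x ^ n) * y)) \<longlonglongrightarrow> 0"
proof -
  note D = absolute_valueD[OF v] absolute_value_simps[OF v]
  have lim0: "(\<lambda>n. v x ^ n) \<longlonglongrightarrow> 0" using x D(1)[of x] by (intro LIMSEQ_power_zero) auto
  have "(\<lambda>n. v x ^ n / (1 - v x ^ n) * v y) \<longlonglongrightarrow> 0 / (1 - 0) * v y"
    by (intro tendsto_intros lim0) auto
  hence lim: "(\<lambda>n. v x ^ n / (1 - v x ^ n) * v y) \<longlonglongrightarrow> 0" by simp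
  show ?thesis
  proof (rule tendsto_sandwich[OF _ _ tendsto_const lim])
    show "\<forall>\<^sub>F n in sequentially. 0 \<le> v (x ^ n / (1 + x ^ n) * y)" by (simp add: D)
    show "\<forall>\<^sub>F n in sequentially. v (x ^ n / (1 + x ^ n) * y) \<le> v x ^ n / (1 - v x ^ n) * v y"
    proof (rule eventually_sequentiallyI[of 1])
      fix n :: nat assume n: "n \<ge> 1"
      have lt: "v x ^ n < 1" using x n D(1)[of x] by (simp add: power_less_one_iff)
      have "1 = v ((1 + x ^ n) - x ^ n)" by (simp add: D)
      also have "\<dots> \<le> v (1 + x ^ n) + v (x ^ n)" by (rule D)
      finally have "1 - v x ^ n \<le> v (1 + x ^ n)" by (simp add: D)
      hence "v x ^ n / v (1 + x ^ n) \<le> v x ^ n / (1 - v x ^ n)"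
        using lt D(1)[of x] by (intro divide_left_mono mult_pos_pos) auto
      thus "v (x ^ n / (1 + x ^ n) * y) \<le> v x ^ n / (1 - v x ^ n) * v y"
        using D(1)[of y] by (simp add: D mult_right_mono del: times_divide_eq_left)
    qed
  qed
qed

lemma power_quotient_tendsto_id:
  fixes v :: "'k::field \<Rightarrow> real"
  assumes v: "absolute_value v" and x: "v x > 1"
  shows "(\<lambda>n. v (y - x ^ n / (1 + x ^ n) * y)) \<longlonglongrightarrow> 0"
proof -
  note D = absolute_valueD[OF v] absolute_value_simps[OF v]
  have lim0: "(\<lambda>n. inverse (v x ^ n)) \<longlonglongrightarrow> 0"
    using x LIMSEQ_inverse_realpow_zero by blast
  have "(\<lambda>n. v y * inverse (v x ^ n) / (1 - inverse (v x ^ n))) \<longlonglongrightarrow> v y * 0 / (1 - 0)"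
    by (intro tendsto_intros lim0) auto
  moreover have "v y * inverse (v x ^ n) / (1 - inverse (v x ^ n)) = v y / (v x ^ n - 1)" for n
    using x by (simp add: field_simps)
  ultimately have lim: "(\<lambda>n. v y / (v x ^ n - 1)) \<longlonglongrightarrow> 0" by simp
  show ?thesis
  proof (rule tendsto_sandwich[OF _ _ tendsto_const lim])
    show "\<forall>\<^sub>F n in sequentially. 0 \<le> v (y - x ^ n / (1 + x ^ n) * y)" by (simp add: D)
    show "\<forall>\<^sub>F n in sequentially. v (y - x ^ n / (1 + x ^ n) * y) \<le> v y / (v x ^ n - 1)"
    proof (rule eventually_sequentiallyI[of 1])
      fix n :: nat assume n: "n \<ge> 1"
      have gt: "v x ^ n > 1" using x n by (simp add: one_less_power)
      have "v x ^ n = v ((1 + x ^ n) - 1)" by (simp add: D)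
      also have "\<dots> \<le> v (1 + x ^ n) + v 1" by (rule D)
      finally have le: "v x ^ n - 1 \<le> v (1 + x ^ n)" by (simp add: D)
      have nz: "1 + x ^ n \<noteq> 0" using le gt by (auto simp: D)
      have "y - x ^ n / (1 + x ^ n) * y = y / (1 + x ^ n)" using nz by (simp add: field_simps)
      moreover have "v y / v (1 + x ^ n) \<le> v y / (v x ^ n - 1)"
        by (intro divide_left_mono mult_pos_pos) (use le gt D(1)[of y] in auto)
      ultimately show "v (y - x ^ n / (1 + x ^ n) * y) \<le> v y / (v x ^ n - 1)" by (simp add: D)
    qed
  qed
qed

text \<open>Induction on \<open>T\<close>: let \<open>x\<close> be large at \<open>v0\<close> and small on \<open>T\<close>, and let \<open>y\<close> separate \<open>v0\<close> from the new
  place \<open>v1\<close>. If \<open>v1 x \<le> 1\<close>, take \<open>x ^ n * y\<close>, otherwise \<open>x ^ n / (1 + x ^ n) * y\<close>, with \<open>n\<close> large.\<close>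
lemma places_dominate:
  fixes v0 :: "'k::field_char_0 \<Rightarrow> real"
  assumes "finite T" and q: "a q > 1" and v0: "v0 \<in> places_over a"
    and "T \<subseteq> places_over a" and "v0 \<notin> T"
  shows "\<exists>x. v0 x > 1 \<and> (\<forall>v\<in>T. v x < 1)"
  using assms(1,4,5)
proof (induction T rule: finite_induct)
  case empty
  have "v0 (of_rat q) > 1" using v0 q by (simp add: places_over_def)
  thus ?case by blast
next
  case (insert v1 T)
  then obtain x where x: "v0 x > 1" "\<forall>v\<in>T. v x < 1" by auto
  have v1: "v1 \<in> places_over a" "v1 \<noteq> v0" using insert by auto
  obtain y where y: "v1 y < 1" "v0 y > 1" using places_separate[OF v1(1) v0 v1(2) q] by blast
  have av: "absolute_value v" if "v = v0 \<or> v = v1 \<or> v \<in> T" for v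
    using that insert.prems v0 by (auto simp: places_over_def)
  show ?case
  proof (cases "v1 x \<le> 1")
    case True
    have "\<exists>N. \<forall>n\<ge>N. v x ^ n * v y < 1" if vT: "v \<in> T" for v
    proof -
      have "(\<lambda>n. v x ^ n * v y) \<longlonglongrightarrow> 0 * v y"
        using x(2) vT absolute_valueD(1)[OF av, of v x]
        by (intro tendsto_intros LIMSEQ_power_zero) auto
      hence "eventually (\<lambda>n. v x ^ n * v y < 1) sequentially" by (simp add: order_tendsto_iff)
      thus ?thesis by (simp add: eventually_sequentially)
    qed
    then obtain N where N: "\<And>v n. v \<in> T \<Longrightarrow> n \<ge> N v \<Longrightarrow> v x ^ n * v y < 1" by metis
    define n where "n = Max (insert 0 (N ` T))"
    have nN: "n \<ge> N v" if "v \<in> T" for v unfolding n_def using that insert.hyps by simp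
    define z where "z = x ^ n * y"
    have vz: "v z = v x ^ n * v y" if "v = v0 \<or> v = v1 \<or> v \<in> T" for v
      using absolute_valueD[OF av[OF that]] absolute_value_simps[OF av[OF that]] by (simp add: z_def)
    have "1 * v0 y \<le> v0 x ^ n * v0 y"
      using x(1) y(2) by (intro mult_right_mono one_le_power) auto
    hence "v0 z > 1" using y(2) vz by simp
    moreover have "v1 z < 1"
    proof -
      have "v1 x ^ n * v1 y \<le> 1 * v1 y"
        using True absolute_valueD(1)[OF av, of v1] by (intro mult_right_mono power_le_one) auto
      thus ?thesis using y(1) vz by simp
    qed
    moreover have "\<forall>v\<in>T. v z < 1"
    proof
      fix v assume v: "v \<in> T"
      show "v z < 1" using N[OF v nN[OF v]] vz[of v] v by simp
    qed
    ultimately show ?thesis by blast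
  next
    case False
    hence b1: "v1 x > 1" by simp
    define z where "z = (\<lambda>n. x ^ n / (1 + x ^ n) * y)"
    have lim_big: "(\<lambda>n. v (z n)) \<longlonglongrightarrow> v y" if v: "v = v0 \<or> v = v1" and big: "v x > 1" for v
    proof -
      have v': "absolute_value v" using v by (intro av) blast
      note D = absolute_valueD[OF v'] absolute_value_simps[OF v']
      have "(\<lambda>n. v (z n) - v y) \<longlonglongrightarrow> 0"
      proof (rule Lim_null_comparison[OF _ power_quotient_tendsto_id[OF v' big, of y]])
        have "norm (v (z n) - v y) \<le> v (y - z n)" for n
          using D(4)[of "y - z n" "z n"] D(4)[of "z n - y" y] D(12)[of y "z n"] by simp
        thus "\<forall>\<^sub>F n in sequentially. norm (v (z n) - v y) \<le> v (y - x ^ n / (1 + x ^ n) * y)"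
          by (simp add: z_def)
      qed
      thus ?thesis by (simp add: LIM_zero_iff)
    qed
    have lim_small: "(\<lambda>n. v (z n)) \<longlonglongrightarrow> 0" if v: "v \<in> T" for v
      unfolding z_def using power_quotient_tendsto_0[OF av] x(2) v by blast
    have "eventually (\<lambda>n. v0 (z n) > 1) sequentially"
      using lim_big[OF disjI1[OF refl] x(1)] y(2) by (simp add: order_tendsto_iff)
    moreover have "eventually (\<lambda>n. v1 (z n) < 1) sequentially"
      using lim_big[OF disjI2[OF refl] b1] y(1) by (simp add: order_tendsto_iff)
    moreover have "eventually (\<lambda>n. \<forall>v\<in>T. v (z n) < 1) sequentially"
      using insert.hyps(1) lim_small by (intro eventually_ball_finite ballI) (auto simp: order_tendsto_iff)
    ultimately have "eventually (\<lambda>n. v0 (z n) > 1 \<and> v1 (z n) < 1 \<and> (\<forall>v\<in>T. v (z n) < 1)) sequentially"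
      by eventually_elim auto
    then obtain n where "v0 (z n) > 1 \<and> v1 (z n) < 1 \<and> (\<forall>v\<in>T. v (z n) < 1)"
      by (auto simp: eventually_sequentially)
    thus ?thesis by blast
  qed
qed

text \<open>If \<open>x\<close> is large at \<open>v0\<close> and small at the other places, then \<open>x ^ n / (1 + x ^ n) * s\<close> with large \<open>n\<close>
  approximates \<open>s\<close> at \<open>v0\<close> and \<open>0\<close> elsewhere.\<close>
lemma weak_approximation:
  fixes v0 :: "'k::field_char_0 \<Rightarrow> real"
  assumes fin: "finite T" and q: "a q > 1" and T: "T \<subseteq> places_over a" and v0: "v0 \<in> T" and e: "e > 0"
  shows "\<exists>z. v0 (s - z) < e \<and> (\<forall>v\<in>T - {v0}. v z < e)"
proof -
  have v0p: "v0 \<in> places_over a" using T v0 by blast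
  obtain x where x: "v0 x > 1" "\<forall>v\<in>T - {v0}. v x < 1"
    using places_dominate[OF _ q v0p, of "T - {v0}"] fin T by auto
  define z where "z = (\<lambda>n. x ^ n / (1 + x ^ n) * s)"
  have av: "absolute_value v" if "v \<in> T" for v using that T by (auto simp: places_over_def)
  have lim_big: "(\<lambda>n. v0 (s - z n)) \<longlonglongrightarrow> 0"
    unfolding z_def by (rule power_quotient_tendsto_id[OF av[OF v0] x(1)])
  have lim_small: "(\<lambda>n. v (z n)) \<longlonglongrightarrow> 0" if v: "v \<in> T - {v0}" for v
    unfolding z_def using power_quotient_tendsto_0[OF av] x(2) v by blast
  have "eventually (\<lambda>n. v0 (s - z n) < e) sequentially"
    using lim_big e by (simp add: order_tendsto_iff)
  moreover have "eventually (\<lambda>n. \<forall>v\<in>T - {v0}. v (z n) < e) sequentially"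
    using fin lim_small e by (intro eventually_ball_finite ballI) (auto simp: order_tendsto_iff)
  ultimately have "eventually (\<lambda>n. v0 (s - z n) < e \<and> (\<forall>v\<in>T - {v0}. v (z n) < e)) sequentially"
    by eventually_elim auto
  thus ?thesis by (auto simp: eventually_sequentially)
qed


section \<open>Counting embeddings over a place\<close>

text \<open>By weak approximation each element \<open>s\<close> of the basis at \<open>v\<close> can be replaced by some \<open>z v s\<close> that is close
  to \<open>s\<close> at \<open>v\<close> and close to \<open>0\<close> at all other places of \<open>T\<close>. All these elements together are
  linearly independent over \<open>\<rat>\<close>: at the place of the largest coefficient of a relation, the relation
  nearly becomes one for the basis at this place.\<close>
lemma sum_local_dims_le_degree:
  fixes T :: "('k::number_field \<Rightarrow> real) set"
  assumes fin: "finite T" and q1: "a q1 > 1" and T: "T \<subseteq> places_over a"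
    and S: "\<And>v. v \<in> T \<Longrightarrow> approx_indep v (S v)"
  shows "(\<Sum>v\<in>T. card (S v)) \<le> field_degree TYPE('k)"
proof -
  have av: "absolute_value v" and va: "v (of_rat q) = a q" if "v \<in> T" for v q
    using that T by (auto simp: places_over_def)
  have finS: "finite (S v)" if "v \<in> T" for v using S[OF that] by (simp add: approx_indep_def)
  have "\<forall>v\<in>T. \<exists>c>0. \<forall>q. \<forall>s\<in>S v. c * v (of_rat (q s)) \<le> v (\<Sum>t\<in>S v. of_rat (q t) * t)"
    using S by (simp add: approx_indep_def)
  then obtain c where c: "\<And>v. v \<in> T \<Longrightarrow> c v > 0"
      "\<And>v q s. v \<in> T \<Longrightarrow> s \<in> S v \<Longrightarrow> c v * v (of_rat (q s)) \<le> v (\<Sum>t\<in>S v. of_rat (q t) * t)"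
    by metis
  define I where "I = (SIGMA v:T. S v)"
  have finI: "finite I" using fin finS by (auto simp: I_def)
  \<comment> \<open>\<open>M\<close> is a common independence constant; the total error \<open>card I * e\<close> stays below it\<close>
  define M where "M = Min (insert 1 (c ` T))"
  have M: "M > 0" "\<And>v. v \<in> T \<Longrightarrow> M \<le> c v"
    using fin c(1) by (auto simp: M_def)
  define e where "e = M / (real (card I) + 1)"
  have e: "e > 0" using M(1) by (simp add: e_def)
  have eM: "real (card I) * e < M" using M(1) by (simp add: e_def field_simps)
  have "\<exists>z. v (s - z) < e \<and> (\<forall>u\<in>T - {v}. u z < e)" if "v \<in> T" for v s
    using weak_approximation[where a=a and q=q1, OF fin q1 T that e] .
  then obtain z where z: "\<And>v s. v \<in> T \<Longrightarrow> v (s - z v s) < e"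
      "\<And>v s u. v \<in> T \<Longrightarrow> u \<in> T - {v} \<Longrightarrow> u (z v s) < e"
    by metis
  have indep: "\<forall>i\<in>I. q i = 0" if sum0: "(\<Sum>i\<in>I. of_rat (q i) * z (fst i) (snd i)) = 0" for q
  proof (rule ccontr)
    assume "\<not> ?thesis"
    then obtain i1 where i1: "i1 \<in> I" "q i1 \<noteq> 0" by blast
    have "(\<lambda>i. a (q i)) ` I \<noteq> {}" using i1 by blast
    hence "Max ((\<lambda>i. a (q i)) ` I) \<in> (\<lambda>i. a (q i)) ` I" using finI by (intro Max_in) auto
    then obtain i0 where i0': "i0 \<in> I" "Max ((\<lambda>i. a (q i)) ` I) = a (q i0)" by auto
    have i0: "i0 \<in> I" "\<And>i. i \<in> I \<Longrightarrow> a (q i) \<le> a (q i0)"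
      using i0'(1) finI by (auto simp: i0'(2)[symmetric])
    obtain v s where vs: "i0 = (v, s)" "v \<in> T" "s \<in> S v" using i0(1) by (auto simp: I_def)
    note D = absolute_valueD[OF av[OF vs(2)]] absolute_value_simps[OF av[OF vs(2)]]
    obtain v1 s1 where vs1: "i1 = (v1, s1)" "v1 \<in> T" using i1(1) by (auto simp: I_def)
    have pos: "a (q i0) > 0"
    proof -
      have "v1 (of_rat (q i1)) > 0" using i1(2) absolute_value_simps(11)[OF av[OF vs1(2)]] by simp
      thus ?thesis using i0(2)[OF i1(1)] va[OF vs1(2)] by simp
    qed
    \<comment> \<open>at \<open>v\<close> the relation differs from a combination of the basis at \<open>v\<close> by the errors \<open>g i\<close>\<close>
    define g where "g = (\<lambda>i. (if fst i = v then snd i else 0) - z (fst i) (snd i))"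
    have vg: "v (g i) \<le> e" if i: "i \<in> I" for i
    proof (cases "fst i = v")
      case True
      thus ?thesis using z(1)[OF vs(2), of "snd i"] by (simp add: g_def)
    next
      case False
      have "fst i \<in> T" using i by (auto simp: I_def)
      moreover have "v \<in> T - {fst i}" using vs(2) False by auto
      ultimately show ?thesis using z(2)[of "fst i" v "snd i"] False by (simp add: g_def D)
    qed
    have "(\<Sum>t\<in>S v. of_rat (q (v, t)) * t) = (\<Sum>i\<in>I. of_rat (q i) * (if fst i = v then snd i else 0))"
    proof -
      have "(\<Sum>i\<in>I. of_rat (q i) * (if fst i = v then snd i else 0)) = (\<Sum>i\<in>Pair v ` S v. of_rat (q i) * (if fst i = v then snd i else 0))"
        by (rule sum.mono_neutral_right[OF finI]) (use vs(2) in \<open>auto simp: I_def\<close>)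
      thus ?thesis by (simp add: sum.reindex inj_on_def)
    qed
    also have "\<dots> = (\<Sum>i\<in>I. of_rat (q i) * g i)"
      using sum0 by (simp add: g_def right_diff_distrib sum_subtractf)
    finally have eq: "(\<Sum>t\<in>S v. of_rat (q (v, t)) * t) = (\<Sum>i\<in>I. of_rat (q i) * g i)" .
    have "M * a (q i0) \<le> c v * v (of_rat (q (v, s)))"
      using M(2)[OF vs(2)] pos by (simp add: vs(1) va[OF vs(2)] mult_right_mono)
    also have "\<dots> \<le> v (\<Sum>t\<in>S v. of_rat (q (v, t)) * t)"
      by (rule c(2)[OF vs(2,3), of "\<lambda>t. q (v, t)"])
    also have "\<dots> \<le> (\<Sum>i\<in>I. v (of_rat (q i) * g i))" unfolding eq by (rule D)
    also have "\<dots> \<le> (\<Sum>i\<in>I. a (q i0) * e)"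
    proof (rule sum_mono)
      fix i assume i: "i \<in> I"
      show "v (of_rat (q i) * g i) \<le> a (q i0) * e"
        unfolding D(3) va[OF vs(2)] using i0(2)[OF i] vg[OF i] pos D(1)[of "g i"]
        by (intro mult_mono) auto
    qed
    also have "\<dots> = a (q i0) * (real (card I) * e)" by simp
    also have "\<dots> < a (q i0) * M" using eM pos by simp
    finally show False by (simp add: mult.commute)
  qed
  have "card I \<le> field_degree TYPE('k)"
    by (rule rat_independent_family_le_degree[OF finI indep])
  thus ?thesis using fin finS by (simp add: I_def)
qed

lemma underdetermined_system:
  fixes f :: "'i \<Rightarrow> 's \<Rightarrow> 'l::field"
  assumes fin: "finite I" "finite S" and card: "card S < card I"
  shows "\<exists>c. (\<exists>i\<in>I. c i \<noteq> 0) \<and> (\<forall>s\<in>S. (\<Sum>i\<in>I. c i * f i s) = 0)"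
proof -
  define n where "n = card I"
  obtain e where e: "bij_betw e {..<n} I"
    using ex_bij_betw_nat_finite[OF fin(1)] by (auto simp: atLeast0LessThan n_def)
  obtain h where h: "bij_betw h {..<card S} S"
    using ex_bij_betw_nat_finite[OF fin(2)] by (auto simp: atLeast0LessThan)
  \<comment> \<open>the system, filled up with zero rows\<close>
  define A where "A = mat n n (\<lambda>(r, k). if r < card S then f (e k) (h r) else 0)"
  have A: "A \<in> carrier_mat n n" by (simp add: A_def)
  have "Determinant.det A = 0"
  proof -
    have "A = mat\<^sub>r n n (\<lambda>i. if i = card S then 0\<^sub>v n else row A i)"
      by (rule eq_matI) (auto simp: A_def)
    also have "Determinant.det \<dots> = 0"
      by (rule det_row_0) (use card A in \<open>auto simp: n_def\<close>)
    finally show ?thesis .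
  qed
  then obtain v where v: "v \<in> carrier_vec n" "v \<noteq> 0\<^sub>v n" "A *\<^sub>v v = 0\<^sub>v n"
    using det_0_iff_vec_prod_zero_field[OF A] by blast
  define c where "c = (\<lambda>i. vec_index v (the_inv_into {..<n} e i))"
  have ce: "c (e k) = vec_index v k" if "k < n" for k
    using e that by (simp add: c_def bij_betw_def the_inv_into_f_f)
  obtain k where k: "k < n" "vec_index v k \<noteq> 0"
    using v(1,2) by (metis carrier_vecD eq_vecI index_zero_vec(1) index_zero_vec(2))
  have "e k \<in> I" using e k by (auto simp: bij_betw_def)
  moreover have "c (e k) \<noteq> 0" using ce k by simp
  moreover have "(\<Sum>i\<in>I. c i * f i s) = 0" if s: "s \<in> S" for s
  proof -
    obtain r where r: "r < card S" "s = h r" using h s by (auto simp: bij_betw_def)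
    have "(\<Sum>i\<in>I. c i * f i s) = (\<Sum>k<n. c (e k) * f (e k) s)"
      by (rule sum.reindex_bij_betw[OF e, symmetric])
    also have "\<dots> = (\<Sum>k<n. A $$ (r, k) * vec_index v k)"
      using r card by (intro sum.cong) (auto simp: ce A_def n_def mult.commute)
    also have "\<dots> = vec_index (A *\<^sub>v v) r"
      using r card A v(1) by (simp add: scalar_prod_def n_def atLeast0LessThan)
    also have "\<dots> = 0" using v(3) r card by (simp add: n_def)
    finally show ?thesis .
  qed
  ultimately show ?thesis by blast
qed

text \<open>If there were more embeddings than basis elements, then some nontrivial combination of the
  embeddings would vanish on the basis, hence on its rational span, and by continuity and density
  on all of \<open>K\<close>. This contradicts the independence of embeddings.\<close>
lemma embeddings_over_place_le:
  fixes s :: "'i \<Rightarrow> 'k::field_char_0 \<Rightarrow> 'l::field_char_0"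
  assumes w: "absolute_value w" and S: "local_basis v S" and fin: "finite I"
    and emb: "\<And>i. i \<in> I \<Longrightarrow> embedding (s i)" and inj: "inj_on s I"
    and wv: "\<And>i x. i \<in> I \<Longrightarrow> w (s i x) = v x"
  shows "card I \<le> card S"
proof (rule ccontr)
  assume "\<not> ?thesis"
  hence lt: "card S < card I" by simp
  have finS: "finite S" using S by (simp add: local_basis_def approx_indep_def)
  obtain c where c: "\<exists>i\<in>I. c i \<noteq> 0" "\<forall>t\<in>S. (\<Sum>i\<in>I. c i * s i t) = 0"
    using underdetermined_system[OF fin finS lt] by blast
  note D = absolute_valueD[OF w] absolute_value_simps[OF w]
  have vnn: "v x \<ge> 0" for x
    using c(1) wv D(1) by metis
  define C where "C = (\<Sum>i\<in>I. w (c i)) + 1"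
  have C: "C > 0" using D(1) by (simp add: C_def add_nonneg_pos sum_nonneg)
  have "(\<Sum>i\<in>I. c i * s i x) = 0" for x
  proof -
    have le: "w (\<Sum>i\<in>I. c i * s i x) \<le> e" if e: "e > 0" for e
    proof -
      have dense: "\<forall>x. \<forall>e>0. \<exists>q. v (x - (\<Sum>t\<in>S. of_rat (q t) * t)) < e"
        using S by (simp add: local_basis_def)
      obtain q where q: "v (x - (\<Sum>t\<in>S. of_rat (q t) * t)) < e / C"
        using dense[rule_format, of "e / C" x] e C by auto
      define y where "y = (\<Sum>t\<in>S. of_rat (q t) * t)"
      have sy: "s i y = (\<Sum>t\<in>S. of_rat (q t) * s i t)" if i: "i \<in> I" for i
      proof -
        interpret field_hom "s i" using emb[OF i] by (rule embedding_field_hom)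
        show ?thesis by (simp add: y_def hom_sum hom_mult embedding_of_rat[OF emb[OF i]])
      qed
      have "(\<Sum>i\<in>I. c i * s i y) = (\<Sum>i\<in>I. \<Sum>t\<in>S. of_rat (q t) * (c i * s i t))"
        by (rule sum.cong) (simp_all add: sy sum_distrib_left mult.left_commute)
      also have "\<dots> = (\<Sum>t\<in>S. of_rat (q t) * (\<Sum>i\<in>I. c i * s i t))"
        by (subst sum.swap) (simp add: sum_distrib_left)
      also have "\<dots> = 0" using c(2) by simp
      finally have y0: "(\<Sum>i\<in>I. c i * s i y) = 0" .
      have "(\<Sum>i\<in>I. c i * s i x) = (\<Sum>i\<in>I. c i * s i x) - (\<Sum>i\<in>I. c i * s i y)" by (simp add: y0)
      also have "\<dots> = (\<Sum>i\<in>I. c i * s i (x - y))"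
      proof -
        have "s i (x - y) = s i x - s i y" if i: "i \<in> I" for i
        proof -
          interpret field_hom "s i" using emb[OF i] by (rule embedding_field_hom)
          show ?thesis by (simp add: hom_minus)
        qed
        thus ?thesis by (simp add: sum_subtractf[symmetric] right_diff_distrib)
      qed
      also have "w \<dots> \<le> (\<Sum>i\<in>I. w (c i * s i (x - y)))" by (rule D)
      also have "\<dots> = (\<Sum>i\<in>I. w (c i)) * v (x - y)"
        by (simp add: D(3) wv sum_distrib_right)
      also have "\<dots> \<le> C * (e / C)"
        using q C D(1) vnn[of "x - y"] unfolding y_def[symmetric]
        by (intro mult_mono) (auto simp: C_def sum_nonneg)
      also have "\<dots> = e" using C by simp
      finally show ?thesis .
    qed
    have "w (\<Sum>i\<in>I. c i * s i x) \<le> 0" by (rule field_le_epsilon) (use le in simp)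
    thus ?thesis using D(1,2) by (metis order_antisym)
  qed
  hence "\<forall>i\<in>I. c i = 0" using embeddings_independent[OF fin emb inj] by blast
  thus False using c(1) by blast
qed

text \<open>Every place over \<open>a\<close> comes from an embedding, and its local degree counts the embeddings that
  induce it. Both follow from one count: over all induced places the number of embeddings sums up to the
  degree, each of these numbers is at most the size of the local basis, and the sizes of the local
  bases at any finite set of places sum up to at most the degree. Hence all of these inequalities
  are equalities and there are no further places. The assumption \<open>a q1 > 1\<close> says that \<open>a\<close> is not
  the trivial absolute value. The function \<open>ld\<close> stands for the local degree, which is related to local
  bases in the next section.\<close>
theorem places_over_embeddings:
  fixes s :: "nat \<Rightarrow> 'k::number_field \<Rightarrow> 'l::field_char_0" and w :: "'l \<Rightarrow> real"
  assumes w: "absolute_value w" and wa: "\<And>q. w (of_rat q) = a q" and q1: "a q1 > 1"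
    and emb: "\<And>i. i < field_degree TYPE('k) \<Longrightarrow> embedding (s i)"
    and inj: "inj_on s {..<field_degree TYPE('k)}"
    and ld: "\<And>v S. absolute_value v \<Longrightarrow> local_basis v S \<Longrightarrow> ld v = card S"
  shows "places_over a = (\<lambda>i. w \<circ> s i) ` {..<field_degree TYPE('k)}"
    and "v \<in> places_over a \<Longrightarrow> ld v = card {i\<in>{..<field_degree TYPE('k)}. w \<circ> s i = v}"
proof -
  let ?d = "field_degree TYPE('k)"
  define im where "im = (\<lambda>i. w \<circ> s i) ` {..<?d}"
  define m where "m = (\<lambda>v. card {i\<in>{..<?d}. w \<circ> s i = v})"
  have fin: "finite im" by (simp add: im_def)
  have im: "im \<subseteq> places_over a"
  proof
    fix v assume "v \<in> im"
    then obtain i where i: "i < ?d" "v = w \<circ> s i" by (auto simp: im_def)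
    interpret field_hom "s i" using emb[OF i(1)] by (rule embedding_field_hom)
    show "v \<in> places_over a"
      using absolute_valueD[OF w] unfolding places_over_def i(2)
      by (auto simp: absolute_value_def hom_add hom_mult embedding_of_rat[OF emb[OF i(1)]] wa)
  qed
  have "\<forall>v\<in>(places_over a :: ('k \<Rightarrow> real) set). \<exists>S. local_basis v S"
  proof
    fix v :: "'k \<Rightarrow> real" assume "v \<in> places_over a"
    hence "absolute_value v" by (simp add: places_over_def)
    thus "\<exists>S. local_basis v S" using local_basis_exists by metis
  qed
  then obtain S where "\<forall>v\<in>(places_over a :: ('k \<Rightarrow> real) set). local_basis v (S v)"
    using bchoice[of "places_over a" local_basis] by auto
  hence S: "local_basis v (S v)" if "v \<in> places_over a" for v using that by simp
  have av: "absolute_value v" if "v \<in> places_over a" for v :: "'k \<Rightarrow> real" using that by (simp add: places_over_def)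
  have ldS: "ld v = card (S v)" if "v \<in> places_over a" for v using ld[OF av[OF that] S[OF that]] .
  have m_le: "m v \<le> ld v" if v: "v \<in> places_over a" for v
    unfolding m_def ldS[OF v]
  proof (rule embeddings_over_place_le[OF w S[OF v]])
    show "inj_on s {i \<in> {..<?d}. w \<circ> s i = v}" using inj by (auto simp: inj_on_def)
    show "w (s i x) = v x" if "i \<in> {i \<in> {..<?d}. w \<circ> s i = v}" for i x
      using that by auto
  qed (use emb in auto)
  have sum_m: "(\<Sum>v\<in>im. m v) = ?d"
  proof -
    have "(\<Sum>v\<in>im. m v) = (\<Sum>v\<in>im. \<Sum>i\<in>{i\<in>{..<?d}. w \<circ> s i = v}. 1)" by (simp add: m_def)
    also have "\<dots> = (\<Sum>i<?d. 1)" by (rule sum.group) (auto simp: im_def)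
    finally show ?thesis by simp
  qed
  have le_d: "(\<Sum>v\<in>T. ld v) \<le> ?d" if T: "finite T" "T \<subseteq> places_over a" for T
  proof -
    have "(\<Sum>v\<in>T. ld v) = (\<Sum>v\<in>T. card (S v))" using ldS T(2) by (intro sum.cong) auto
    also have "\<dots> \<le> ?d"
      using S T(2) by (intro sum_local_dims_le_degree[where a=a and ?q1.0=q1, OF T(1) q1 T(2)]) (auto simp: local_basis_def)
    finally show ?thesis .
  qed
  have sum_ld: "(\<Sum>v\<in>im. ld v) = ?d"
    using le_d[OF fin im] sum_m sum_mono[of im m ld] m_le im by force
  have "places_over a \<subseteq> im"
  proof
    fix v :: "'k \<Rightarrow> real" assume v: "v \<in> places_over a"
    show "v \<in> im"
    proof (rule ccontr)
      assume "v \<notin> im"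
      hence "(\<Sum>u\<in>insert v im. ld u) = ld v + ?d" using fin sum_ld by simp
      moreover have "(\<Sum>u\<in>insert v im. ld u) \<le> ?d" using le_d[of "insert v im"] fin im v by simp
      moreover have "ld v \<ge> 1" using local_basis_nonempty[OF av[OF v] S[OF v]] ldS[OF v] by simp
      ultimately show False by simp
    qed
  qed
  thus eq: "places_over a = (\<lambda>i. w \<circ> s i) ` {..<?d}" using im unfolding im_def by blast
  show "ld v = card {i\<in>{..<?d}. w \<circ> s i = v}" if v: "v \<in> places_over a"
  proof -
    have vim: "v \<in> im" using v eq by (simp add: im_def)
    have "ld v = m v"
    proof (rule ccontr)
      assume "ld v \<noteq> m v"
      hence "m v < ld v" using m_le[OF v] by simp
      hence "(\<Sum>u\<in>im. m u) < (\<Sum>u\<in>im. ld u)"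
        using m_le im vim fin by (intro sum_strict_mono_ex1) auto
      thus False using sum_m sum_ld by simp
    qed
    thus ?thesis by (simp add: m_def)
  qed
qed


section \<open>The local degree is the size of a local basis\<close>

lemma cauchy_ring_sel:
  "carrier (cauchy_ring v) = {X. \<forall>e>0. \<exists>N. \<forall>m\<ge>N. \<forall>n\<ge>N. v (X m - X n) < e}"
  "monoid.mult (cauchy_ring v) X Y = (\<lambda>n. X n * Y n)" "one (cauchy_ring v) = (\<lambda>n. 1)"
  "zero (cauchy_ring v) = (\<lambda>n. 0)" "add (cauchy_ring v) X Y = (\<lambda>n. X n + Y n)"
  by (simp_all add: cauchy_ring_def)

context
  fixes v :: "'k::field_char_0 \<Rightarrow> real"
  assumes av: "absolute_value v"
begin

private abbreviation "C \<equiv> carrier (cauchy_ring v)"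
private abbreviation "N \<equiv> null_sequences v"

lemmas vD = absolute_valueD[OF av] absolute_value_simps[OF av]

lemma cauchyI: "(\<And>e. e > 0 \<Longrightarrow> \<exists>N. \<forall>m\<ge>N. \<forall>n\<ge>N. v (X m - X n) < e) \<Longrightarrow> X \<in> C"
  by (simp add: cauchy_ring_sel)

lemma cauchyD: "X \<in> C \<Longrightarrow> e > 0 \<Longrightarrow> \<exists>N. \<forall>m\<ge>N. \<forall>n\<ge>N. v (X m - X n) < e"
  by (simp add: cauchy_ring_sel)

lemma cauchy_const: "(\<lambda>_. c) \<in> C"
  by (rule cauchyI) (auto simp: vD)

lemma cauchy_bounded:
  assumes "X \<in> C"
  obtains B where "B > 0" "\<And>n. v (X n) \<le> B"
proof -
  obtain M where M: "\<And>m n. m \<ge> M \<Longrightarrow> n \<ge> M \<Longrightarrow> v (X m - X n) < 1"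
    using cauchyD[OF assms, of 1] by auto
  define B where "B = Max (insert 1 ((\<lambda>n. v (X n)) ` {..M})) + 1"
  have fin: "finite (insert 1 ((\<lambda>n. v (X n)) ` {..M}))" by simp
  have "1 \<le> Max (insert 1 ((\<lambda>n. v (X n)) ` {..M}))" using fin by (rule Max_ge) simp
  moreover have small: "v (X n) \<le> Max (insert 1 ((\<lambda>n. v (X n)) ` {..M}))" if "n \<le> M" for n
    using fin by (rule Max_ge) (use that in auto)
  moreover have "v (X n) \<le> B" for n
  proof (cases "n \<le> M")
    case True thus ?thesis using small by (simp add: B_def add_increasing2)
  next
    case False
    have "v (X n) = v ((X n - X M) + X M)" by simp
    also have "\<dots> \<le> v (X n - X M) + v (X M)" by (rule vD)
    also have "\<dots> \<le> 1 + Max (insert 1 ((\<lambda>n. v (X n)) ` {..M}))"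
      using M[of n M] small[of M] False by (intro add_mono) auto
    finally show ?thesis by (simp add: B_def)
  qed
  ultimately show ?thesis using that[of B] by (simp add: B_def)
qed

lemma cauchy_add: assumes "X \<in> C" "Y \<in> C" shows "(\<lambda>n. X n + Y n) \<in> C"
proof (rule cauchyI)
  fix e :: real assume e: "e > 0"
  obtain M1 where M1: "\<And>m n. m \<ge> M1 \<Longrightarrow> n \<ge> M1 \<Longrightarrow> v (X m - X n) < e / 2"
    using cauchyD[OF assms(1), of "e / 2"] e by auto
  obtain M2 where M2: "\<And>m n. m \<ge> M2 \<Longrightarrow> n \<ge> M2 \<Longrightarrow> v (Y m - Y n) < e / 2"
    using cauchyD[OF assms(2), of "e / 2"] e by auto
  have "v (X m + Y m - (X n + Y n)) < e" if "m \<ge> max M1 M2" "n \<ge> max M1 M2" for m n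
  proof -
    have "v (X m + Y m - (X n + Y n)) = v ((X m - X n) + (Y m - Y n))" by (simp add: algebra_simps)
    also have "\<dots> \<le> v (X m - X n) + v (Y m - Y n)" by (rule vD)
    also have "\<dots> < e / 2 + e / 2" using that by (intro add_strict_mono M1 M2) auto
    finally show ?thesis by simp
  qed
  thus "\<exists>N. \<forall>m\<ge>N. \<forall>n\<ge>N. v (X m + Y m - (X n + Y n)) < e" by blast
qed

lemma cauchy_uminus: assumes "X \<in> C" shows "(\<lambda>n. - X n) \<in> C"
proof (rule cauchyI)
  fix e :: real assume e: "e > 0"
  have "v (- X m - - X n) = v (X m - X n)" for m n
    using vD(12)[of "X n" "X m"] by simp
  thus "\<exists>N. \<forall>m\<ge>N. \<forall>n\<ge>N. v (- X m - - X n) < e" using cauchyD[OF assms e] by simp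
qed

lemma cauchy_mult: assumes "X \<in> C" "Y \<in> C" shows "(\<lambda>n. X n * Y n) \<in> C"
proof (rule cauchyI)
  fix e :: real assume e: "e > 0"
  obtain B1 where B1: "B1 > 0" "\<And>n. v (X n) \<le> B1" using cauchy_bounded[OF assms(1)] by metis
  obtain B2 where B2: "B2 > 0" "\<And>n. v (Y n) \<le> B2" using cauchy_bounded[OF assms(2)] by metis
  obtain M1 where M1: "\<And>m n. m \<ge> M1 \<Longrightarrow> n \<ge> M1 \<Longrightarrow> v (X m - X n) < e / (2 * B2)"
    using cauchyD[OF assms(1), of "e / (2 * B2)"] e B2 by auto
  obtain M2 where M2: "\<And>m n. m \<ge> M2 \<Longrightarrow> n \<ge> M2 \<Longrightarrow> v (Y m - Y n) < e / (2 * B1)"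
    using cauchyD[OF assms(2), of "e / (2 * B1)"] e B1 by auto
  have "v (X m * Y m - X n * Y n) < e" if "m \<ge> max M1 M2" "n \<ge> max M1 M2" for m n
  proof -
    have "v (X m * Y m - X n * Y n) = v (X m * (Y m - Y n) + (X m - X n) * Y n)" by (simp add: algebra_simps)
    also have "\<dots> \<le> v (X m * (Y m - Y n)) + v ((X m - X n) * Y n)" by (rule vD)
    also have "\<dots> = v (X m) * v (Y m - Y n) + v (X m - X n) * v (Y n)" by (simp only: vD(3))
    also have "\<dots> \<le> B1 * v (Y m - Y n) + v (X m - X n) * B2"
      using B1 B2 vD(1) by (intro add_mono mult_right_mono mult_left_mono) auto
    also have "\<dots> < B1 * (e / (2 * B1)) + e / (2 * B2) * B2"
      using that B1(1) B2(1) by (intro add_strict_mono mult_strict_left_mono mult_strict_right_mono M1 M2) auto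
    also have "\<dots> = e" using B1(1) B2(1) by simp
    finally show ?thesis .
  qed
  thus "\<exists>N. \<forall>m\<ge>N. \<forall>n\<ge>N. v (X m * Y m - X n * Y n) < e" by blast
qed

lemma nullD: "X \<in> N \<Longrightarrow> e > 0 \<Longrightarrow> \<exists>M. \<forall>n\<ge>M. v (X n) < e"
  unfolding null_sequences_def by (auto simp: order_tendsto_iff eventually_sequentially)

lemma null_subset: "X \<in> N \<Longrightarrow> X \<in> C"
proof (rule cauchyI)
  fix e :: real assume X: "X \<in> N" and e: "e > 0"
  obtain M where M: "\<And>n. n \<ge> M \<Longrightarrow> v (X n) < e / 2" using nullD[OF X, of "e / 2"] e by auto
  have "v (X m - X n) < e" if "m \<ge> M" "n \<ge> M" for m n
    using vD(11)[of "X m" "X n"] M[OF that(1)] M[OF that(2)] by simp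
  thus "\<exists>N. \<forall>m\<ge>N. \<forall>n\<ge>N. v (X m - X n) < e" by blast
qed

lemma null_add: assumes "X \<in> N" "Y \<in> N" shows "(\<lambda>n. X n + Y n) \<in> N"
proof -
  have lim: "(\<lambda>n. v (X n) + v (Y n)) \<longlonglongrightarrow> 0"
    using tendsto_add[of "\<lambda>n. v (X n)" 0 sequentially "\<lambda>n. v (Y n)" 0] assms by (simp add: null_sequences_def)
  have "(\<lambda>n. v (X n + Y n)) \<longlonglongrightarrow> 0"
    by (rule tendsto_sandwich[OF _ _ tendsto_const lim]) (auto simp: vD)
  thus ?thesis by (simp add: null_sequences_def)
qed

lemma null_uminus: "X \<in> N \<Longrightarrow> (\<lambda>n. - X n) \<in> N"
  by (simp add: null_sequences_def vD)

lemma null_mult: assumes "X \<in> N" "Y \<in> C" shows "(\<lambda>n. Y n * X n) \<in> N"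
proof -
  obtain B where B: "B > 0" "\<And>n. v (Y n) \<le> B" using cauchy_bounded[OF assms(2)] by metis
  have lim: "(\<lambda>n. B * v (X n)) \<longlonglongrightarrow> 0"
    using tendsto_mult[OF tendsto_const[of B], of "\<lambda>n. v (X n)" 0 sequentially] assms by (simp add: null_sequences_def)
  have "(\<lambda>n. v (Y n * X n)) \<longlonglongrightarrow> 0"
    by (rule tendsto_sandwich[OF _ _ tendsto_const lim]) (auto simp: vD(1,3) intro!: always_eventually mult_right_mono B)
  thus ?thesis by (simp add: null_sequences_def)
qed

lemma cauchy_ring_cring: "cring (cauchy_ring v)"
proof (rule cringI)
  show "abelian_group (cauchy_ring v)"
  proof (rule abelian_groupI)
    fix X assume "X \<in> C"
    thus "\<exists>Y\<in>C. Y \<oplus>\<^bsub>cauchy_ring v\<^esub> X = \<zero>\<^bsub>cauchy_ring v\<^esub>"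
      by (intro bexI[of _ "\<lambda>n. - X n"]) (simp_all add: cauchy_ring_sel(2-) cauchy_uminus)
  qed (auto simp: cauchy_ring_sel(2-) cauchy_add cauchy_const algebra_simps)
  show "Group.comm_monoid (cauchy_ring v)"
    by (rule comm_monoidI) (auto simp: cauchy_ring_sel(2-) cauchy_mult cauchy_const algebra_simps)
qed (auto simp: cauchy_ring_sel(2-) algebra_simps)

interpretation R: cring "cauchy_ring v" by (rule cauchy_ring_cring)

lemma cauchy_ring_minus: "X \<in> C \<Longrightarrow> Y \<in> C \<Longrightarrow> X \<ominus>\<^bsub>cauchy_ring v\<^esub> Y = (\<lambda>n. X n - Y n)"
proof -
  assume XY: "X \<in> C" "Y \<in> C"
  have "\<ominus>\<^bsub>cauchy_ring v\<^esub> Y = (\<lambda>n. - Y n)"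
    by (rule R.minus_equality) (use XY cauchy_uminus in \<open>auto simp: cauchy_ring_sel(2-)\<close>)
  thus ?thesis by (simp add: a_minus_def cauchy_ring_sel(2-))
qed

lemma null_ideal: "ideal N (cauchy_ring v)"
proof (rule idealI[OF R.ring_axioms])
  show "subgroup N (add_monoid (cauchy_ring v))"
  proof (rule R.add.subgroupI)
    show "N \<noteq> {}" by (auto simp: null_sequences_def vD intro!: exI[of _ "\<lambda>_. 0"])
    fix X assume X: "X \<in> N"
    have "\<ominus>\<^bsub>cauchy_ring v\<^esub> X = (\<lambda>n. - X n)"
      by (rule R.minus_equality) (use X null_subset cauchy_uminus in \<open>auto simp: cauchy_ring_sel(2-)\<close>)
    thus "\<ominus>\<^bsub>cauchy_ring v\<^esub> X \<in> N" using null_uminus[OF X] by simp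
  qed (auto simp: null_subset null_add cauchy_ring_sel(2-))
qed (use null_mult in \<open>auto simp: cauchy_ring_sel(2-) mult.commute\<close>)

interpretation I: ideal N "cauchy_ring v" by (rule null_ideal)
interpretation Q: cring "completion v" unfolding completion_def by (rule I.quotient_is_cring[OF cauchy_ring_cring])

private abbreviation (input) "cl X \<equiv> null_sequences v +>\<^bsub>cauchy_ring v\<^esub> X"

interpretation H: ring_hom_ring "cauchy_ring v" "completion v" "\<lambda>X. cl X"
  unfolding completion_def by (rule I.rcos_ring_hom_ring)

lemma cl_ops:
  assumes "X \<in> C" "Y \<in> C"
  shows "cl X \<oplus>\<^bsub>completion v\<^esub> cl Y = cl (\<lambda>n. X n + Y n)"
    and "cl X \<otimes>\<^bsub>completion v\<^esub> cl Y = cl (\<lambda>n. X n * Y n)"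
    and "cl X = cl Y \<longleftrightarrow> (\<lambda>n. X n - Y n) \<in> N"
  using H.hom_add[OF assms] H.hom_mult[OF assms] R.quotient_eq_iff_same_a_r_cos[OF null_ideal assms]
    cauchy_ring_minus[OF assms]
  by (simp_all add: cauchy_ring_sel(2-))

lemma cl_zero: "\<zero>\<^bsub>completion v\<^esub> = cl (\<lambda>n. 0)" and cl_one: "\<one>\<^bsub>completion v\<^esub> = cl (\<lambda>n. 1)"
  using H.hom_zero H.hom_one by (simp_all add: cauchy_ring_sel(2-))

lemma completion_carrier: "carrier (completion v) = (\<lambda>X. cl X) ` C"
  by (auto simp: completion_def FactRing_def A_RCOSETS_def RCOSETS_def a_r_coset_def)

lemma rat_completion_iff: "x \<in> rat_completion v \<longleftrightarrow> (\<exists>X\<in>C. range X \<subseteq> \<rat> \<and> x = cl X)"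
  by (auto simp: rat_completion_def)

lemma non_null_bounded_below:
  assumes X: "X \<in> C" and nn: "X \<notin> N"
  obtains c M where "c > 0" "\<And>n. n \<ge> M \<Longrightarrow> v (X n) \<ge> c"
proof -
  have "\<not> (\<lambda>n. v (X n)) \<longlonglongrightarrow> 0" using nn by (simp add: null_sequences_def)
  then obtain e where e: "e > 0" "\<And>M. \<exists>n\<ge>M. v (X n) \<ge> e"
    unfolding LIMSEQ_def using vD(1) by (auto simp: not_less)
  obtain M where M: "\<And>m n. m \<ge> M \<Longrightarrow> n \<ge> M \<Longrightarrow> v (X m - X n) < e / 2"
    using cauchyD[OF X, of "e / 2"] e by auto
  obtain n0 where n0: "n0 \<ge> M" "v (X n0) \<ge> e" using e(2) by blast
  have "v (X n) \<ge> e / 2" if "n \<ge> M" for n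
  proof -
    have "v (X n0) = v ((X n0 - X n) + X n)" by simp
    also have "\<dots> \<le> v (X n0 - X n) + v (X n)" by (rule vD)
    finally show ?thesis using M[OF n0(1) that] n0(2) by simp
  qed
  thus ?thesis using that[of "e / 2" M] e(1) by simp
qed

lemma cauchy_inverse:
  assumes X: "X \<in> C" and c: "c > 0" "\<And>n. n \<ge> M \<Longrightarrow> v (X n) \<ge> c"
  shows "(\<lambda>n. inverse (X n)) \<in> C"
proof (rule cauchyI)
  fix e :: real assume e: "e > 0"
  obtain M' where M': "\<And>m n. m \<ge> M' \<Longrightarrow> n \<ge> M' \<Longrightarrow> v (X m - X n) < e * c * c"
    using cauchyD[OF X, of "e * c * c"] e c(1) by auto
  have "v (inverse (X m) - inverse (X n)) < e" if "m \<ge> max M M'" "n \<ge> max M M'" for m n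
  proof -
    have ge: "v (X m) \<ge> c" "v (X n) \<ge> c" using c(2) that by auto
    hence nz: "X m \<noteq> 0" "X n \<noteq> 0" using c(1) by (auto simp: vD)
    have "inverse (X m) - inverse (X n) = (X n - X m) / (X m * X n)"
      using nz by (simp add: field_simps)
    hence "v (inverse (X m) - inverse (X n)) = v (X n - X m) / (v (X m) * v (X n))"
      by (simp add: vD(3,10))
    also have "\<dots> \<le> v (X n - X m) / (c * c)"
      using ge c(1) vD(1) by (intro divide_left_mono mult_mono mult_pos_pos) (auto intro: less_le_trans)
    also have "\<dots> < e" using M'[of n m] that c(1) by (simp add: field_simps)
    finally show ?thesis .
  qed
  thus "\<exists>N. \<forall>m\<ge>N. \<forall>n\<ge>N. v (inverse (X m) - inverse (X n)) < e" by blast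
qed

text \<open>A rational Cauchy sequence that is not null is eventually bounded away from \<open>0\<close>, so its termwise
  inverse (with inverse \<open>0\<close> at the finitely many zeros) is a rational Cauchy sequence again.\<close>
lemma rat_completion_subfield: "subfield (rat_completion v) (completion v)"
proof (rule Q.subfieldI)
  let ?K = "rat_completion v"
  have KC: "?K \<subseteq> carrier (completion v)" by (auto simp: rat_completion_iff completion_carrier)
  have one: "\<one>\<^bsub>completion v\<^esub> \<in> ?K"
    unfolding cl_one rat_completion_iff by (intro bexI[of _ "\<lambda>_. 1"]) (auto intro: cauchy_const)
  have mult: "h1 \<otimes>\<^bsub>completion v\<^esub> h2 \<in> ?K" if h: "h1 \<in> ?K" "h2 \<in> ?K" for h1 h2
  proof -
    obtain X Y where "X \<in> C" "range X \<subseteq> \<rat>" "h1 = cl X" "Y \<in> C" "range Y \<subseteq> \<rat>" "h2 = cl Y"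
      using h unfolding rat_completion_iff by blast
    thus ?thesis unfolding rat_completion_iff
      by (intro bexI[of _ "\<lambda>n. X n * Y n"]) (auto simp: cl_ops cauchy_mult image_subset_iff)
  qed
  have "subring ?K (completion v)"
  proof (rule Q.subringI[OF KC one])
    show "h1 \<otimes>\<^bsub>completion v\<^esub> h2 \<in> ?K" if h: "h1 \<in> ?K" "h2 \<in> ?K" for h1 h2
      using mult[OF h] .
    show "h1 \<oplus>\<^bsub>completion v\<^esub> h2 \<in> ?K" if h: "h1 \<in> ?K" "h2 \<in> ?K" for h1 h2
    proof -
      obtain X Y where "X \<in> C" "range X \<subseteq> \<rat>" "h1 = cl X" "Y \<in> C" "range Y \<subseteq> \<rat>" "h2 = cl Y"
        using h unfolding rat_completion_iff by blast
      thus ?thesis unfolding rat_completion_iff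
        by (intro bexI[of _ "\<lambda>n. X n + Y n"]) (auto simp: cl_ops cauchy_add image_subset_iff)
    qed
    show "\<ominus>\<^bsub>completion v\<^esub> h \<in> ?K" if h: "h \<in> ?K" for h
    proof -
      obtain X where X: "X \<in> C" "range X \<subseteq> \<rat>" "h = cl X"
        using h unfolding rat_completion_iff by blast
      have "\<ominus>\<^bsub>completion v\<^esub> h = cl (\<lambda>n. - X n)"
        unfolding X(3) by (rule Q.minus_equality)
          (use X in \<open>auto simp: cl_ops cl_zero cauchy_uminus completion_carrier\<close>)
      thus ?thesis using X unfolding rat_completion_iff
        by (intro bexI[of _ "\<lambda>n. - X n"]) (auto simp: cauchy_uminus)
    qed
  qed
  thus "subcring ?K (completion v)" by (rule Q.subcringI')
  have ne: "\<one>\<^bsub>completion v\<^esub> \<noteq> \<zero>\<^bsub>completion v\<^esub>"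
    unfolding cl_one cl_zero cl_ops(3)[OF cauchy_const cauchy_const] by (simp add: null_sequences_def vD tendsto_const_iff)
  show "Units (completion v\<lparr>carrier := ?K\<rparr>) = ?K - {\<zero>\<^bsub>completion v\<^esub>}"
  proof (intro equalityI subsetI)
    fix x assume "x \<in> Units (completion v\<lparr>carrier := ?K\<rparr>)"
    then obtain y where xy: "x \<in> ?K" "y \<in> ?K" "y \<otimes>\<^bsub>completion v\<^esub> x = \<one>\<^bsub>completion v\<^esub>" by (auto simp: Units_def)
    have "x \<noteq> \<zero>\<^bsub>completion v\<^esub>"
    proof
      assume "x = \<zero>\<^bsub>completion v\<^esub>"
      hence "\<one>\<^bsub>completion v\<^esub> = \<zero>\<^bsub>completion v\<^esub>" using xy KC by auto
      thus False using ne by simp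
    qed
    thus "x \<in> ?K - {\<zero>\<^bsub>completion v\<^esub>}" using xy by simp
  next
    fix x assume x: "x \<in> ?K - {\<zero>\<^bsub>completion v\<^esub>}"
    hence "x \<in> ?K" by simp
    then obtain X where X: "X \<in> C" "range X \<subseteq> \<rat>" "x = cl X" unfolding rat_completion_iff by blast
    have "X \<notin> N" using x X cl_ops(3)[OF X(1) cauchy_const[of 0]] by (auto simp: cl_zero)
    then obtain c M where c: "c > 0" "\<And>n. n \<ge> M \<Longrightarrow> v (X n) \<ge> c" using non_null_bounded_below[OF X(1)] by metis
    define Y where "Y = (\<lambda>n. inverse (X n))"
    have Y: "Y \<in> C" unfolding Y_def by (rule cauchy_inverse[OF X(1) c])
    have "range Y \<subseteq> \<rat>" using X(2) by (auto simp: Y_def)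
    hence YK: "cl Y \<in> ?K" using Y unfolding rat_completion_iff by blast
    have ev: "eventually (\<lambda>n. v (X n * Y n - 1) = 0) sequentially"
    proof (rule eventually_sequentiallyI[of M])
      fix n assume "n \<ge> M"
      hence "X n \<noteq> 0" using c(1) c(2)[of n] by (auto simp: vD)
      thus "v (X n * Y n - 1) = 0" by (simp add: Y_def vD)
    qed
    have "(\<lambda>n. X n * Y n - 1) \<in> N"
      unfolding null_sequences_def using tendsto_eventually[OF ev] by simp
    hence "cl X \<otimes>\<^bsub>completion v\<^esub> cl Y = \<one>\<^bsub>completion v\<^esub>"
      using X(1) Y by (simp add: cl_ops cl_one cauchy_mult cauchy_const)
    moreover have "cl Y \<otimes>\<^bsub>completion v\<^esub> cl X = cl X \<otimes>\<^bsub>completion v\<^esub> cl Y"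
      using X(1) Y by (simp add: cl_ops mult.commute)
    ultimately show "x \<in> Units (completion v\<lparr>carrier := ?K\<rparr>)"
      using YK x X(3) by (auto simp: Units_def)
  qed
qed

lemma combine_cl:
  assumes "set Ys \<subseteq> C" "set Us \<subseteq> C" "length Ys = length Us"
  shows "Q.combine (map (\<lambda>X. cl X) Ys) (map (\<lambda>X. cl X) Us) = cl (\<lambda>n. \<Sum>i<length Us. (Ys ! i) n * (Us ! i) n)"
    and "(\<lambda>n. \<Sum>i<length Us. (Ys ! i) n * (Us ! i) n) \<in> C"
proof -
  have "Q.combine (map (\<lambda>X. cl X) Ys) (map (\<lambda>X. cl X) Us) = cl (\<lambda>n. \<Sum>i<length Us. (Ys ! i) n * (Us ! i) n) \<and>
    (\<lambda>n. \<Sum>i<length Us. (Ys ! i) n * (Us ! i) n) \<in> C"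
    using assms(3,1,2)
  proof (induction Ys Us rule: list_induct2)
    case Nil
    thus ?case by (simp add: cl_zero cauchy_const)
  next
    case (Cons Y Ys U Us)
    have eq: "(\<lambda>n. \<Sum>i<length (U # Us). ((Y # Ys) ! i) n * ((U # Us) ! i) n) =
        (\<lambda>n. Y n * U n + (\<Sum>i<length Us. (Ys ! i) n * (Us ! i) n))"
      by (simp add: sum.lessThan_Suc_shift del: sum.lessThan_Suc)
    have YU: "(\<lambda>n. Y n * U n) \<in> C" using Cons.prems by (intro cauchy_mult) auto
    show ?case unfolding eq using Cons YU by (simp add: cl_ops cauchy_add)
  qed
  thus "Q.combine (map (\<lambda>X. cl X) Ys) (map (\<lambda>X. cl X) Us) = cl (\<lambda>n. \<Sum>i<length Us. (Ys ! i) n * (Us ! i) n)"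
    and "(\<lambda>n. \<Sum>i<length Us. (Ys ! i) n * (Us ! i) n) \<in> C" by blast+
qed

text \<open>The defining inequality of a local basis is used twice: a null combination of rational sequences
  has null coefficient sequences, which is linear independence; and if combinations approximate a Cauchy
  sequence, then their coefficients are Cauchy sequences, so that the limit lies in the span.\<close>
lemma completion_dimension:
  assumes S: "local_basis v S"
  shows "Q.dimension (card S) (rat_completion v) (carrier (completion v))"
proof -
  let ?K = "rat_completion v"
  obtain c where c: "c > 0" "\<And>q s. s \<in> S \<Longrightarrow> c * v (of_rat (q s)) \<le> v (\<Sum>t\<in>S. of_rat (q t) * t)"
    and fin: "finite S" using S unfolding local_basis_def approx_indep_def by blast
  have dense: "\<forall>x. \<forall>e>0. \<exists>q. v (x - (\<Sum>t\<in>S. of_rat (q t) * t)) < e"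
    using S by (simp add: local_basis_def)
  obtain sl where sl: "set sl = S" "distinct sl" using finite_distinct_list[OF fin] by blast
  have len: "length sl = card S" using distinct_card[OF sl(2)] sl(1) by simp
  have sum_sl: "(\<Sum>t\<in>S. f t) = (\<Sum>i<length sl. f (sl ! i))" for f :: "'k \<Rightarrow> 'k"
    using sum.reindex_bij_betw[OF bij_betw_nth[OF sl(2) refl sl(1)[symmetric]], of f] by simp
  define U where "U = map (\<lambda>s (n::nat). s) sl"
  have U: "set U \<subseteq> C" "length U = length sl" by (auto simp: U_def cauchy_const)
  define Us where "Us = map (\<lambda>X. cl X) U"
  have UsC: "set Us \<subseteq> carrier (completion v)" using U by (auto simp: Us_def completion_carrier)
  have comb: "Q.combine (map (\<lambda>X. cl X) Ys) Us = cl (\<lambda>n. \<Sum>i<length sl. (Ys ! i) n * sl ! i)"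
      "(\<lambda>n. \<Sum>i<length sl. (Ys ! i) n * sl ! i) \<in> C"
    if "set Ys \<subseteq> C" "length Ys = length sl" for Ys
    using combine_cl[OF that(1) U(1)] that(2) U(2) by (simp_all add: Us_def U_def cong: sum.cong_simp)
  have "Q.independent ?K Us"
  proof (rule Q.trivial_combine_imp_independent[OF rat_completion_subfield UsC])
    fix Ks0 assume Ks0: "set Ks0 \<subseteq> ?K" "Q.combine Ks0 Us = \<zero>\<^bsub>completion v\<^esub>"
    have KC: "?K \<subseteq> carrier (completion v)" by (auto simp: rat_completion_iff completion_carrier)
    obtain Ks where Ks: "set (take (length Us) Ks0) \<subseteq> set Ks"
        "set Ks \<subseteq> set (take (length Us) Ks0) \<union> {\<zero>\<^bsub>completion v\<^esub>}"
        "length Ks = length Us" "Q.combine Ks Us = \<zero>\<^bsub>completion v\<^esub>"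
      using Q.combine_normalize[OF _ UsC Ks0(2)] Ks0(1) KC by blast
    have zeroK: "\<zero>\<^bsub>completion v\<^esub> \<in> ?K"
      unfolding cl_zero rat_completion_iff by (intro bexI[of _ "\<lambda>_. 0"]) (auto intro: cauchy_const)
    have KsK: "set Ks \<subseteq> ?K" using Ks(2) Ks0(1) zeroK set_take_subset[of "length Us" Ks0] by blast
    have "\<forall>k\<in>set Ks. \<exists>X. X \<in> C \<and> range X \<subseteq> \<rat> \<and> k = cl X" using KsK rat_completion_iff by blast
    then obtain f where f: "\<forall>k\<in>set Ks. f k \<in> C \<and> range (f k) \<subseteq> \<rat> \<and> k = cl (f k)"
      using bchoice[of "set Ks" "\<lambda>k X. X \<in> C \<and> range X \<subseteq> \<rat> \<and> k = cl X"] by blast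
    define Ys where "Ys = map f Ks"
    have KsYs: "Ks = map (\<lambda>X. cl X) Ys" using f by (simp add: Ys_def map_idI)
    have Ys: "set Ys \<subseteq> C" "length Ys = length sl" using f Ks(3) by (auto simp: Ys_def Us_def U_def)
    have Yr: "\<exists>q. (Ys ! i) n = of_rat q" if "i < length sl" for i n
    proof -
      have "Ks ! i \<in> set Ks" using that Ks(3) by (simp add: Us_def U_def)
      hence "f (Ks ! i) n \<in> \<rat>" using f by blast
      thus ?thesis using that Ks(3) by (auto simp: Ys_def Us_def U_def Rats_def)
    qed
    have "cl (\<lambda>n. \<Sum>i<length sl. (Ys ! i) n * sl ! i) = cl (\<lambda>n. 0)"
      using Ks(4) comb(1)[OF Ys] by (simp add: KsYs cl_zero)
    hence null: "(\<lambda>n. \<Sum>i<length sl. (Ys ! i) n * sl ! i) \<in> N"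
      using cl_ops(3)[OF comb(2)[OF Ys] cauchy_const] by simp
    have nullY: "Ys ! i \<in> N" if i: "i < length sl" for i
    proof -
      have le: "v ((Ys ! i) n) \<le> v (\<Sum>i<length sl. (Ys ! i) n * sl ! i) / c" for n
      proof -
        define q where "q = (\<lambda>j. SOME r. (Ys ! j) n = of_rat r)"
        have q: "(Ys ! j) n = of_rat (q j)" if "j < length sl" for j
          unfolding q_def using someI_ex[OF Yr[OF that]] .
        define q' where "q' = (\<lambda>s. q (THE j. j < length sl \<and> sl ! j = s))"
        have q': "q' (sl ! j) = q j" if "j < length sl" for j
          unfolding q'_def using that sl(2)
          by (intro arg_cong[of _ _ q] the_equality) (auto simp: nth_eq_iff_index_eq)
        have "c * v (of_rat (q' (sl ! i))) \<le> v (\<Sum>t\<in>S. of_rat (q' t) * t)"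
          using i sl(1) by (intro c(2)) auto
        also have "(\<Sum>t\<in>S. of_rat (q' t) * t) = (\<Sum>i<length sl. (Ys ! i) n * sl ! i)"
          unfolding sum_sl by (intro sum.cong refl) (simp add: q q')
        finally show ?thesis using c(1) i by (simp add: q q' field_simps)
      qed
      have lim: "(\<lambda>n. v (\<Sum>i<length sl. (Ys ! i) n * sl ! i) / c) \<longlonglongrightarrow> 0"
        using tendsto_divide[of _ 0 sequentially "\<lambda>_. c" c] null c(1) by (simp add: null_sequences_def)
      have "(\<lambda>n. v ((Ys ! i) n)) \<longlonglongrightarrow> 0"
        by (rule tendsto_sandwich[OF _ _ tendsto_const lim]) (auto simp: le vD(1))
      thus ?thesis by (simp add: null_sequences_def)
    qed
    have "k = \<zero>\<^bsub>completion v\<^esub>" if "k \<in> set Ks" for k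
    proof -
      have "k \<in> (\<lambda>X. cl X) ` set Ys" using that unfolding KsYs by simp
      then obtain Y where Y: "Y \<in> set Ys" "k = cl Y" by (elim imageE)
      then obtain i where i: "i < length sl" "Y = Ys ! i" using Ys(2) by (auto simp: in_set_conv_nth)
      have "Y \<in> C" using Y(1) Ys(1) by blast
      thus ?thesis using Y(2) i nullY[OF i(1)] cl_ops(3)[of Y "\<lambda>_. 0"] by (simp add: cl_zero cauchy_const)
    qed
    thus "set (take (length Us) Ks0) \<subseteq> {\<zero>\<^bsub>completion v\<^esub>}" using Ks(1) by blast
  qed
  hence "Q.dimension (length Us) ?K (Q.Span ?K Us)" by (rule Q.dimension_independent)
  moreover have "Q.Span ?K Us = carrier (completion v)"
  proof
    show "Q.Span ?K Us \<subseteq> carrier (completion v)"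
      by (rule Q.Span_in_carrier[OF _ UsC]) (auto simp: rat_completion_iff completion_carrier)
    show "carrier (completion v) \<subseteq> Q.Span ?K Us"
    proof
      fix x assume "x \<in> carrier (completion v)"
      then obtain X where X: "X \<in> C" "x = cl X" unfolding completion_carrier by blast
      have "\<forall>n. \<exists>q. v (X n - (\<Sum>t\<in>S. of_rat (q t) * t)) < inverse (real (Suc n))"
        using dense by simp
      then obtain r where r: "\<And>n. v (X n - (\<Sum>t\<in>S. of_rat (r n t) * t)) < inverse (real (Suc n))" by metis
      define Z where "Z = (\<lambda>n. \<Sum>t\<in>S. of_rat (r n t) * t)"
      have XZ: "(\<lambda>n. X n - Z n) \<in> N"
      proof -
        have "(\<lambda>n. v (X n - Z n)) \<longlonglongrightarrow> 0"
          by (rule tendsto_sandwich[OF _ _ tendsto_const LIMSEQ_inverse_real_of_nat])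
             (use r in \<open>auto simp: Z_def vD(1) less_imp_le\<close>)
        thus ?thesis by (simp add: null_sequences_def)
      qed
      have ZC: "Z \<in> C"
        using cauchy_add[OF X(1) cauchy_uminus[OF null_subset[OF XZ]]] by simp
      \<comment> \<open>the coefficient sequences of the approximations \<open>Z\<close> of \<open>X\<close>\<close>
      define Y where "Y = (\<lambda>t n. of_rat (r n t) :: 'k)"
      have YC: "Y t \<in> C" if t: "t \<in> S" for t
      proof (rule cauchyI)
        fix e :: real assume e: "e > 0"
        obtain M where M: "\<And>m n. m \<ge> M \<Longrightarrow> n \<ge> M \<Longrightarrow> v (Z m - Z n) < c * e"
          using cauchyD[OF ZC, of "c * e"] e c(1) by auto
        have "v (Y t m - Y t n) < e" if mn: "m \<ge> M" "n \<ge> M" for m n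
        proof -
          have "c * v (of_rat (r m t - r n t)) \<le> v (\<Sum>t\<in>S. of_rat (r m t - r n t) * t)"
            using c(2)[OF t, of "\<lambda>t. r m t - r n t"] .
          also have "(\<Sum>t\<in>S. of_rat (r m t - r n t) * t) = Z m - Z n"
            by (simp add: Z_def of_rat_diff left_diff_distrib sum_subtractf)
          also have "v \<dots> < c * e" using M mn by blast
          finally show ?thesis using c(1) by (simp add: Y_def of_rat_diff)
        qed
        thus "\<exists>N. \<forall>m\<ge>N. \<forall>n\<ge>N. v (Y t m - Y t n) < e" by blast
      qed
      define Ys where "Ys = map Y sl"
      have Ys: "set Ys \<subseteq> C" "length Ys = length sl" using YC sl(1) by (auto simp: Ys_def)
      have "Q.combine (map (\<lambda>X. cl X) Ys) Us = cl (\<lambda>n. \<Sum>i<length sl. (Ys ! i) n * sl ! i)"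
        by (rule comb(1)[OF Ys])
      also have "(\<lambda>n. \<Sum>i<length sl. (Ys ! i) n * sl ! i) = Z"
        unfolding Z_def sum_sl by (intro ext sum.cong) (simp_all add: Ys_def Y_def)
      also have "cl Z = x" using cl_ops(3)[OF X(1) ZC] XZ X(2) by simp
      finally have "x = Q.combine (map (\<lambda>X. cl X) Ys) Us" by simp
      moreover have "set (map (\<lambda>X. cl X) Ys) \<subseteq> ?K"
      proof
        fix k assume "k \<in> set (map (\<lambda>X. cl X) Ys)"
        hence "k \<in> (\<lambda>t. cl (Y t)) ` S" by (simp add: Ys_def image_image sl(1))
        then obtain t where t: "t \<in> S" "k = cl (Y t)" by (elim imageE)
        have "range (Y t) \<subseteq> \<rat>" by (auto simp: Y_def)
        thus "k \<in> ?K" using YC[OF t(1)] t(2) unfolding rat_completion_iff by blast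
      qed
      moreover have "length (map (\<lambda>X. cl X) Ys) = length Us" using Ys(2) U(2) by (simp add: Us_def)
      ultimately show "x \<in> Q.Span ?K Us"
        unfolding Q.Span_eq_combine_set_length_version[OF rat_completion_subfield UsC] by blast
    qed
  qed
  ultimately show ?thesis using len U(2) by (simp add: Us_def)
qed

end

lemma local_degree_eq_card:
  fixes v :: "'k::number_field \<Rightarrow> real"
  assumes av: "absolute_value v" and S: "local_basis v S"
  shows "local_degree v = card S"
proof -
  interpret I: ideal "null_sequences v" "cauchy_ring v" by (rule null_ideal[OF av])
  interpret Q: cring "completion v" unfolding completion_def
    by (rule I.quotient_is_cring[OF cauchy_ring_cring[OF av]])
  show ?thesis
    using Q.dimI[OF rat_completion_subfield[OF av] completion_dimension[OF av S]]
    by (simp add: local_degree_def over_def)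
qed


section \<open>Extending a p-adic absolute value to all algebraic numbers\<close>

lemma padic_abs_of_int_div:
  assumes p: "prime p" and ab: "a \<noteq> 0" "b \<noteq> 0"
  shows "padic_abs p (of_int a / of_int b) = real p powi (int (multiplicity (int p) b) - int (multiplicity (int p) a))"
proof -
  obtain a' b' where q: "quotient_of (of_int a / of_int b) = (a', b')" by (cases "quotient_of (of_int a / of_int b :: rat)")
  have b': "b' > 0" using quotient_of_denom_pos[OF q] .
  have eq: "(of_int a / of_int b :: rat) = of_int a' / of_int b'" by (rule quotient_of_div[OF q])
  hence a': "a' \<noteq> 0" using ab by auto
  have "of_int (a * b') = (of_int (a' * b) :: rat)" using eq ab b' by (simp add: field_simps)
  hence "a * b' = a' * b" by (simp only: of_int_eq_iff)
  moreover have pr: "prime_elem (int p)" using p by simp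
  ultimately have "multiplicity (int p) a + multiplicity (int p) b' = multiplicity (int p) a' + multiplicity (int p) b"
    using ab a' b' prime_elem_multiplicity_mult_distrib[OF pr, of a b'] prime_elem_multiplicity_mult_distrib[OF pr, of a' b] by simp
  hence "int (multiplicity (int p) b') - int (multiplicity (int p) a') = int (multiplicity (int p) b) - int (multiplicity (int p) a)"
    by linarith
  thus ?thesis using ab by (simp add: padic_abs_def q)
qed

lemma rat_eq_int_div: obtains a b where "(q::rat) = of_int a / of_int b" "b > 0"
  using quotient_of_div quotient_of_denom_pos by (metis surj_pair)

lemma padic_abs_mult:
  assumes p: "prime p"
  shows "padic_abs p (x * y) = padic_abs p x * padic_abs p y"
proof (cases "x = 0 \<or> y = 0")
  case False
  obtain a b where x: "x = of_int a / of_int b" "b > 0" by (rule rat_eq_int_div)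
  obtain c d where y: "y = of_int c / of_int d" "d > 0" by (rule rat_eq_int_div)
  have nz: "a \<noteq> 0" "c \<noteq> 0" "b \<noteq> 0" "d \<noteq> 0" using False x y by auto
  have pr: "prime_elem (int p)" using p by simp
  have "x * y = of_int (a * c) / of_int (b * d)" by (simp add: x y)
  hence "padic_abs p (x * y) = real p powi (int (multiplicity (int p) (b * d)) - int (multiplicity (int p) (a * c)))"
    using nz by (simp only: padic_abs_of_int_div[OF p] mult_eq_0_iff simp_thms)
  also have "int (multiplicity (int p) (b * d)) - int (multiplicity (int p) (a * c)) =
     (int (multiplicity (int p) b) - int (multiplicity (int p) a)) + (int (multiplicity (int p) d) - int (multiplicity (int p) c))"
    using nz by (simp add: prime_elem_multiplicity_mult_distrib[OF pr])
  also have "real p powi \<dots> = padic_abs p x * padic_abs p y"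
    using nz p by (subst power_int_add) (auto simp: x y padic_abs_of_int_div prime_gt_0_nat)
  finally show ?thesis .
qed (auto simp: padic_abs_def)

lemma padic_abs_prime_power: "prime p \<Longrightarrow> padic_abs p (of_nat p powi m) = real p powi (- m)"
proof -
  assume p: "prime p"
  have p1: "padic_abs p (of_nat p) = inverse (real p)"
    using padic_abs_of_int_div[OF p, of "int p" 1] p prime_gt_0_nat[OF p] by simp
  have one: "padic_abs p 1 = 1" using padic_abs_of_int_div[OF p, of 1 1] by simp
  have pw: "padic_abs p (of_nat p ^ n) = inverse (real p) ^ n" for n
    by (induction n) (simp_all add: one padic_abs_mult[OF p] p1)
  show ?thesis
  proof (cases "m \<ge> 0")
    case True
    thus ?thesis using pw[of "nat m"] by (simp add: power_int_def power_inverse)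
  next
    case False
    have "padic_abs p (of_nat p ^ nat (- m)) * padic_abs p (inverse (of_nat p ^ nat (- m))) = 1"
      using prime_gt_0_nat[OF p] by (simp add: padic_abs_mult[OF p, symmetric] one)
    hence "padic_abs p (inverse (of_nat p ^ nat (- m))) = real p ^ nat (- m)"
      using prime_gt_0_nat[OF p] by (simp add: pw power_inverse field_simps)
    thus ?thesis using False by (simp add: power_int_def power_inverse)
  qed
qed

lemma rat_eq_prime_power_times:
  assumes p: "prime p" and q: "q \<noteq> 0"
  obtains m a b where "q = of_nat p powi m * (of_int a / of_int b)" "\<not> int p dvd a" "\<not> int p dvd b"
    "padic_abs p q = real p powi (- m)"
proof -
  obtain c d where x: "q = of_int c / of_int d" "d > 0" by (rule rat_eq_int_div)
  have nz: "c \<noteq> 0" "d \<noteq> 0" using q x by auto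
  have p0: "(of_nat p :: rat) \<noteq> 0" using prime_gt_0_nat[OF p] by simp
  have nu: "\<not> is_unit (int p)" using p by (metis not_prime_unit prime_nat_int_transfer)
  obtain a where a: "c = int p ^ multiplicity (int p) c * a" "\<not> int p dvd a"
    using multiplicity_decompose'[OF nz(1) nu] by metis
  obtain b where b: "d = int p ^ multiplicity (int p) d * b" "\<not> int p dvd b"
    using multiplicity_decompose'[OF nz(2) nu] by metis
  define m where "m = int (multiplicity (int p) c) - int (multiplicity (int p) d)"
  have "q = of_int (int p ^ multiplicity (int p) c * a) / of_int (int p ^ multiplicity (int p) d * b)"
    using x(1) a(1) b(1) by simp
  also have "\<dots> = of_nat p powi m * (of_int a / of_int b)"
    using p0 by (simp add: m_def power_int_diff)
  finally show ?thesis using that[of m a b] a(2) b(2) padic_abs_of_int_div[OF p nz]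
    by (simp add: m_def x(1))
qed

definition subring_set :: "'l::field set \<Rightarrow> bool" where
  "subring_set R \<longleftrightarrow> 1 \<in> R \<and> (\<forall>x\<in>R. - x \<in> R) \<and> (\<forall>x\<in>R. \<forall>y\<in>R. x + y \<in> R \<and> x * y \<in> R)"

lemma subring_setD:
  assumes "subring_set R"
  shows "1 \<in> R" "0 \<in> R" "x \<in> R \<Longrightarrow> - x \<in> R" "x \<in> R \<Longrightarrow> y \<in> R \<Longrightarrow> x + y \<in> R" "x \<in> R \<Longrightarrow> y \<in> R \<Longrightarrow> x - y \<in> R"
    "x \<in> R \<Longrightarrow> y \<in> R \<Longrightarrow> x * y \<in> R" "x \<in> R \<Longrightarrow> x ^ n \<in> R" "of_nat n \<in> R" "of_int z \<in> R"
    "(\<And>i. i \<in> A \<Longrightarrow> f i \<in> R) \<Longrightarrow> sum f A \<in> R"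
proof -
  have 1: "1 \<in> R" and m: "\<And>x. x \<in> R \<Longrightarrow> - x \<in> R" and a: "\<And>x y. x \<in> R \<Longrightarrow> y \<in> R \<Longrightarrow> x + y \<in> R"
    and t: "\<And>x y. x \<in> R \<Longrightarrow> y \<in> R \<Longrightarrow> x * y \<in> R"
    using assms by (auto simp: subring_set_def)
  have z: "0 \<in> R" using a[OF 1 m[OF 1]] by simp
  have n: "of_nat n \<in> R" for n by (induction n) (auto intro: 1 a z)
  show "1 \<in> R" "0 \<in> R" "x \<in> R \<Longrightarrow> - x \<in> R" "x \<in> R \<Longrightarrow> y \<in> R \<Longrightarrow> x + y \<in> R"
    "x \<in> R \<Longrightarrow> y \<in> R \<Longrightarrow> x * y \<in> R" "of_nat n \<in> R" by (fact 1 z n | erule m | erule (1) a | erule (1) t)+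
  show "x \<in> R \<Longrightarrow> y \<in> R \<Longrightarrow> x - y \<in> R" using a[OF _ m, of x y] by simp
  show "x \<in> R \<Longrightarrow> x ^ n \<in> R" by (induction n) (auto intro: 1 t)
  show "of_int z \<in> R" by (cases z rule: int_cases2) (auto intro: n m)
  show "(\<And>i. i \<in> A \<Longrightarrow> f i \<in> R) \<Longrightarrow> sum f A \<in> R"
    by (induction A rule: infinite_finite_induct) (auto intro: z a)
qed

text \<open>A subring that is maximal without containing \<open>1 / p\<close> turns out to be a valuation ring whose
  valuation extends the one of \<open>p\<close>.\<close>
definition maximal_subring :: "nat \<Rightarrow> 'l::field_char_0 set \<Rightarrow> bool" where
  "maximal_subring p R \<longleftrightarrow> subring_set R \<and> inverse (of_nat p) \<notin> R \<and>
     (\<forall>R'. subring_set R' \<longrightarrow> inverse (of_nat p) \<notin> R' \<longrightarrow> R \<subseteq> R' \<longrightarrow> R' = R)"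

text \<open>By Zorn's lemma, starting from \<open>\<int>\<close>, which does not contain \<open>1 / p\<close>.\<close>
lemma maximal_subring_exists:
  assumes p: "prime p"
  obtains R :: "'l::field_char_0 set" where "maximal_subring p R"
proof -
  define A where "A = {R :: 'l set. subring_set R \<and> inverse (of_nat p) \<notin> R}"
  have p1: "p > 1" using prime_gt_1_nat[OF p] .
  have "\<int> \<in> A"
  proof -
    have "inverse (of_nat p :: 'l) \<notin> \<int>"
    proof
      assume "inverse (of_nat p :: 'l) \<in> \<int>"
      then obtain z where z: "inverse (of_nat p :: 'l) = of_int z" by (auto elim: Ints_cases)
      have "of_int (int p * z) = (of_int 1 :: 'l)" using z[symmetric] p1 by simp
      hence "int p * z = 1" by (simp only: of_int_eq_iff)
      hence "int p dvd 1" by (rule dvdI[OF sym])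
        thus False using p1 by (simp add: zdvd_not_zless)
    qed
    thus ?thesis by (auto simp: A_def subring_set_def)
  qed
  hence "A \<noteq> {}" by blast
  moreover have "\<Union>Ch \<in> A" if ne: "Ch \<noteq> {}" and ch: "subset.chain A Ch" for Ch
  proof -
    have sub: "Ch \<subseteq> A" and tot: "\<And>X Y. X \<in> Ch \<Longrightarrow> Y \<in> Ch \<Longrightarrow> X \<subseteq> Y \<or> Y \<subseteq> X"
      using ch by (auto simp: subset.chain_def subset_chain_def)
    have sr: "subring_set X" "inverse (of_nat p) \<notin> X" if "X \<in> Ch" for X
      using sub that by (auto simp: A_def)
    have two: "\<exists>X\<in>Ch. x \<in> X \<and> y \<in> X" if xy: "x \<in> \<Union>Ch" "y \<in> \<Union>Ch" for x y
    proof -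
      obtain X Y where XY: "X \<in> Ch" "x \<in> X" "Y \<in> Ch" "y \<in> Y" using xy by auto
      show ?thesis using tot[OF XY(1,3)] XY by auto
    qed
    have "subring_set (\<Union>Ch)"
      unfolding subring_set_def
    proof (intro conjI ballI)
      obtain X where "X \<in> Ch" using ne by auto
      thus "1 \<in> \<Union>Ch" using subring_setD(1)[OF sr(1)] by auto
      fix x assume x: "x \<in> \<Union>Ch"
      then obtain X where X: "X \<in> Ch" "x \<in> X" by auto
      show "- x \<in> \<Union>Ch" using subring_setD(3)[OF sr(1)[OF X(1)] X(2)] X(1) by blast
      fix y assume "y \<in> \<Union>Ch"
      then obtain X where X: "X \<in> Ch" "x \<in> X" "y \<in> X" using two[OF x] by auto
      show "x + y \<in> \<Union>Ch" "x * y \<in> \<Union>Ch"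
        using subring_setD(4,6)[OF sr(1)[OF X(1)] X(2,3)] X(1) by (auto simp del: Union_iff intro: UnionI)
    qed
    thus ?thesis using sr(2) by (auto simp: A_def)
  qed
  ultimately have "\<exists>M\<in>A. \<forall>X\<in>A. M \<subseteq> X \<longrightarrow> X = M" by (rule subset_Zorn_nonempty)
  then obtain R where "R \<in> A" "\<forall>X\<in>A. R \<subseteq> X \<longrightarrow> X = R" by (elim bexE)
  hence "maximal_subring p R" unfolding maximal_subring_def A_def by simp
  thus ?thesis by (rule that)
qed

context
  fixes p :: nat and R :: "'l::field_char_0 set"
  assumes p: "prime p" and maxR: "maximal_subring p R"
begin

lemma max_sub: "subring_set R" and max_p: "inverse (of_nat p) \<notin> R"
  using maxR by (auto simp: maximal_subring_def)

lemmas Rs = subring_setD[OF max_sub]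

lemma p_nz: "(of_nat p :: 'l) \<noteq> 0" using prime_gt_0_nat[OF p] by simp

text \<open>By maximality, adjoining an element outside of \<open>R\<close> makes \<open>1 / p\<close> available.\<close>
lemma max_adjoin:
  assumes x: "x \<notin> R"
  shows "\<exists>f. (\<forall>i. coeff f i \<in> R) \<and> of_nat p * poly f x = 1"
proof -
  define R' where "R' = {poly f x |f. \<forall>i. coeff f i \<in> R}"
  have R'I: "y \<in> R'" if "y = poly f x" "\<And>i. coeff f i \<in> R" for y f
    using that by (auto simp: R'_def)
  have "subring_set R'"
    unfolding subring_set_def
  proof (intro conjI ballI)
    show "1 \<in> R'" by (rule R'I[of _ 1]) (auto simp: Rs coeff_pCons one_pCons split: nat.split)
    fix y assume "y \<in> R'"
    then obtain f where f: "y = poly f x" "\<And>i. coeff f i \<in> R" by (auto simp: R'_def)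
    show "- y \<in> R'" by (rule R'I[of _ "- f"]) (auto simp: f Rs)
    fix z assume "z \<in> R'"
    then obtain g where g: "z = poly g x" "\<And>i. coeff g i \<in> R" by (auto simp: R'_def)
    show "y + z \<in> R'" by (rule R'I[of _ "f + g"]) (auto simp: f g Rs)
    show "y * z \<in> R'" by (rule R'I[of _ "f * g"]) (auto simp: f g Rs coeff_mult)
  qed
  moreover have "R \<subseteq> R'"
    by (auto intro!: R'I[of _ "[:_:]"] simp: Rs coeff_pCons split: nat.split)
  moreover have "x \<in> R'"
    by (rule R'I[of _ "[:0, 1:]"]) (auto simp: Rs coeff_pCons split: nat.split)
  ultimately have "inverse (of_nat p) \<in> R'"
    using maxR x unfolding maximal_subring_def by metis
  then obtain f where f: "inverse (of_nat p) = poly f x" "\<And>i. coeff f i \<in> R" by (auto simp: R'_def)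
  have "of_nat p * poly f x = 1" using p_nz by (simp add: f(1)[symmetric])
  thus ?thesis using f(2) by blast
qed

lemma not_p_multiple: "r \<in> R \<Longrightarrow> of_nat p * r \<noteq> 1"
  using max_p inverse_unique[of "of_nat p" r] by auto

text \<open>The factor \<open>x ^ n\<close> turns a polynomial in \<open>1 / x\<close> into one in \<open>x\<close>.\<close>
lemma poly_inverse_reflect:
  assumes f: "\<And>i. coeff f i \<in> R" and n: "degree f \<le> n" and x: "x \<noteq> 0" "x \<in> R"
  shows "x ^ n * poly f (inverse x) \<in> R"
proof -
  have "x ^ n * poly f (inverse x) = (\<Sum>i\<le>degree f. coeff f i * x ^ (n - i))"
    unfolding poly_altdef sum_distrib_left
  proof (intro sum.cong refl)
    fix i assume "i \<in> {..degree f}"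
    hence "x ^ n = x ^ (n - i) * x ^ i" using n by (simp add: power_add[symmetric])
    thus "x ^ n * (coeff f i * inverse x ^ i) = coeff f i * x ^ (n - i)"
      using x(1) by (simp add: power_inverse)
  qed
  also have "\<dots> \<in> R" by (intro Rs(10) Rs(6) Rs(7) f x)
  finally show ?thesis .
qed

text \<open>If \<open>u = 1 - p a\<close> were not invertible in \<open>R\<close>, then \<open>1 / p\<close> would be a polynomial in \<open>1 / u\<close>, so \<open>p\<close> would
  divide a power of \<open>u\<close>. But all powers of \<open>u\<close> are \<open>1\<close> modulo \<open>p\<close>.\<close>
lemma one_minus_p_unit:
  assumes a: "a \<in> R"
  shows "inverse (1 - of_nat p * a) \<in> R"
proof (rule ccontr)
  define u where "u = 1 - of_nat p * a"
  assume "inverse (1 - of_nat p * a) \<notin> R"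
  hence iu: "inverse u \<notin> R" by (simp add: u_def)
  have uR: "u \<in> R" unfolding u_def by (intro Rs a)
  have u0: "u \<noteq> 0" using iu Rs(2) by auto
  obtain f where f: "\<And>i. coeff f i \<in> R" "of_nat p * poly f (inverse u) = 1" using max_adjoin[OF iu] by blast
  define k where "k = degree f"
  define r where "r = u ^ k * poly f (inverse u)"
  have r: "r \<in> R" unfolding r_def by (rule poly_inverse_reflect[OF f(1) _ u0 uR]) (simp add: k_def)
  have pr: "of_nat p * r = u ^ k" using f(2) by (simp add: r_def algebra_simps)
  have "\<exists>s\<in>R. u ^ k = 1 - of_nat p * s" for k
  proof (induction k)
    case 0 show ?case by (rule bexI[of _ 0]) (simp_all add: Rs)
  next
    case (Suc k)
    then obtain s where s: "s \<in> R" "u ^ k = 1 - of_nat p * s" by blast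
    have "u ^ Suc k = 1 - of_nat p * (s + a - of_nat p * a * s)"
      by (simp add: s(2)) (simp add: u_def algebra_simps)
    moreover have "s + a - of_nat p * a * s \<in> R" by (intro Rs s a)
    ultimately show ?case by blast
  qed
  then obtain s where s: "s \<in> R" "u ^ k = 1 - of_nat p * s" by blast
  have "of_nat p * (r + s) = 1" using pr s(2) by (simp add: algebra_simps)
  thus False using not_p_multiple[OF Rs(4)[OF r s(1)]] by simp
qed

text \<open>The relation for \<open>1 / x\<close> has the invertible constant term \<open>u\<close> when \<open>1\<close> is moved to the other side;
  multiplied by \<open>x ^ n\<close> it expresses \<open>x ^ n\<close> by lower powers, which lowers the degree of \<open>f\<close>.\<close>
lemma max_valuation_aux:
  assumes x: "x \<noteq> 0"
    and f: "\<And>i. coeff f i \<in> R" "of_nat p * poly f x = 1"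
    and g: "\<And>i. coeff g i \<in> R" "of_nat p * poly g (inverse x) = 1"
    and deg: "degree g \<le> degree f"
  shows "\<exists>f'. (\<forall>i. coeff f' i \<in> R) \<and> of_nat p * poly f' x = 1 \<and> degree f' < degree f"
proof -
  define n where "n = degree f"
  define m where "m = degree g"
  have n: "n > 0"
  proof (rule ccontr)
    assume "\<not> n > 0"
    then obtain c where c: "f = [:c:]" using degree_eq_zeroE[of f] by (auto simp: n_def)
    have "c \<in> R" using f(1)[of 0] by (simp add: c)
    thus False using not_p_multiple[of c] f(2) by (simp add: c)
  qed
  define u where "u = 1 - of_nat p * coeff g 0"
  have iu: "inverse u \<in> R" unfolding u_def by (rule one_minus_p_unit[OF g(1)])
  have u0: "u \<noteq> 0" using not_p_multiple[OF g(1)[of 0]] by (auto simp: u_def)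
  have sum_g: "(\<Sum>j\<le>m. coeff g j * inverse x ^ j) = coeff g 0 + (\<Sum>j\<in>{1..m}. coeff g j * inverse x ^ j)"
  proof -
    have "{..m} = insert 0 {1..m}" by auto
    thus ?thesis by simp
  qed
  have "u = of_nat p * (\<Sum>j\<in>{1..m}. coeff g j * inverse x ^ j)"
    using g(2) by (simp add: poly_altdef m_def[symmetric] sum_g u_def algebra_simps)
  hence "x ^ n * u = of_nat p * (\<Sum>j\<in>{1..m}. coeff g j * (x ^ n * inverse x ^ j))"
    by (simp add: sum_distrib_left algebra_simps)
  also have "(\<Sum>j\<in>{1..m}. coeff g j * (x ^ n * inverse x ^ j)) = (\<Sum>j\<in>{1..m}. coeff g j * x ^ (n - j))"
  proof (intro sum.cong refl)
    fix j assume "j \<in> {1..m}"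
    hence "x ^ n = x ^ (n - j) * x ^ j" using deg by (simp add: power_add[symmetric] n_def m_def)
    thus "coeff g j * (x ^ n * inverse x ^ j) = coeff g j * x ^ (n - j)"
      using x by (simp add: power_inverse)
  qed
  finally have xn: "x ^ n = inverse u * of_nat p * (\<Sum>j\<in>{1..m}. coeff g j * x ^ (n - j))"
    using u0 by (simp add: field_simps)
  define f' where "f' = (f - monom (coeff f n) n) + (\<Sum>j\<in>{1..m}. monom (coeff f n * inverse u * of_nat p * coeff g j) (n - j))"
  have "poly f' x = poly f x - coeff f n * x ^ n + coeff f n * (inverse u * of_nat p * (\<Sum>j\<in>{1..m}. coeff g j * x ^ (n - j)))"
    by (simp add: f'_def poly_monom poly_sum sum_distrib_left mult.assoc)
  also have "\<dots> = poly f x" unfolding xn[symmetric] by simp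
  finally have "of_nat p * poly f' x = 1" using f(2) by simp
  moreover have "coeff f' i \<in> R" for i
    unfolding f'_def coeff_add coeff_diff coeff_sum coeff_monom
    by (intro Rs(4) Rs(5) Rs(10) f(1)) (auto intro!: Rs f g iu)
  moreover have "degree f' < n"
  proof (rule degree_lessI)
    show "f' \<noteq> 0 \<or> 0 < n" using n by simp
    show "\<forall>k\<ge>n. coeff f' k = 0"
    proof (intro allI impI)
      fix k assume k: "k \<ge> n"
      have "coeff f k - (if n = k then coeff f n else 0) = 0"
        using k by (auto simp: n_def intro: coeff_eq_0)
      moreover have "(\<Sum>j\<in>{1..m}. coeff (monom (coeff f n * inverse u * of_nat p * coeff g j) (n - j)) k) = 0"
        using k n by (intro sum.neutral) auto
      ultimately show "coeff f' k = 0" by (simp add: f'_def coeff_sum)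
    qed
  qed
  ultimately show ?thesis unfolding n_def by blast
qed

text \<open>If neither \<open>x\<close> nor \<open>1 / x\<close> belongs to \<open>R\<close>, both satisfy a relation as in the previous lemma. Of two
  such relations of minimal degree, the longer one could be shortened.\<close>
lemma max_valuation:
  assumes x: "x \<notin> R"
  shows "inverse x \<in> R"
proof (rule ccontr)
  assume ix: "inverse x \<notin> R"
  have x0: "x \<noteq> 0" using x Rs(2) by auto
  define P where "P = (\<lambda>y f. (\<forall>i. coeff f i \<in> R) \<and> of_nat p * poly f y = 1)"
  obtain f0 where "P x f0" using max_adjoin[OF x] unfolding P_def by blast
  then obtain f where f: "P x f" "\<And>f'. P x f' \<Longrightarrow> degree f \<le> degree f'"
    using ex_has_least_nat[of "P x" f0 degree] by auto
  obtain g0 where "P (inverse x) g0" using max_adjoin[OF ix] unfolding P_def by blast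
  then obtain g where g: "P (inverse x) g" "\<And>g'. P (inverse x) g' \<Longrightarrow> degree g \<le> degree g'"
    using ex_has_least_nat[of "P (inverse x)" g0 degree] by auto
  show False
  proof (cases "degree g \<le> degree f")
    case True
    obtain f' where "P x f'" "degree f' < degree f"
      using max_valuation_aux[OF x0, of f g] f(1) g(1) True unfolding P_def by blast
    thus False using f(2)[of f'] by simp
  next
    case False
    obtain g' where "P (inverse x) g'" "degree g' < degree g"
      using max_valuation_aux[of "inverse x" g f] x0 f(1) g(1) False unfolding P_def by auto
    thus False using g(2)[of g'] by simp
  qed
qed

end


context
  fixes p :: nat and R :: "'l::field_char_0 set"
  assumes p: "prime p" and maxR: "maximal_subring p R"
begin

lemmas mR = subring_setD[OF max_sub[OF p maxR]]

definition ring_unit :: "'l \<Rightarrow> bool" where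
  "ring_unit x \<longleftrightarrow> x \<noteq> 0 \<and> x \<in> R \<and> inverse x \<in> R"

lemma ring_unit_mult: "ring_unit x \<Longrightarrow> ring_unit y \<Longrightarrow> ring_unit (x * y)"
  and ring_unit_inverse: "ring_unit x \<Longrightarrow> ring_unit (inverse x)"
  and ring_unit_power: "ring_unit x \<Longrightarrow> ring_unit (x ^ n)"
  and ring_unit_one: "ring_unit 1" and ring_unit_uminus: "ring_unit x \<Longrightarrow> ring_unit (- x)"
  by (auto simp: ring_unit_def power_inverse[symmetric] intro!: mR(1,3,6,7))

lemma nonunit_mult: "x \<in> R \<Longrightarrow> y \<in> R \<Longrightarrow> \<not> ring_unit y \<Longrightarrow> \<not> ring_unit (x * y)"
proof
  assume xy: "x \<in> R" "y \<in> R" "\<not> ring_unit y" "ring_unit (x * y)"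
  have "inverse y = x * inverse (x * y)" using xy(4) by (auto simp: ring_unit_def field_simps)
  also have "\<dots> \<in> R" using xy by (intro mR) (auto simp: ring_unit_def)
  finally show False using xy by (auto simp: ring_unit_def)
qed

text \<open>Of \<open>x / y\<close> and \<open>y / x\<close> one belongs to \<open>R\<close>, so the sum is a multiple of \<open>x\<close> or of \<open>y\<close>.\<close>
lemma nonunit_add:
  assumes xy: "x \<in> R" "y \<in> R" "\<not> ring_unit x" "\<not> ring_unit y"
  shows "\<not> ring_unit (x + y)"
proof
  assume u: "ring_unit (x + y)"
  show False
  proof (cases "x = 0 \<or> y = 0")
    case True thus ?thesis using xy u by auto
  next
    case False
    hence nz: "x \<noteq> 0" "y \<noteq> 0" by auto
    have "x / y \<in> R \<or> y / x \<in> R"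
      using max_valuation[OF p maxR, of "x / y"] by auto
    thus False
    proof
      assume "x / y \<in> R"
      hence "\<not> ring_unit ((1 + x / y) * y)" using xy by (intro nonunit_mult mR) auto
      moreover have "(1 + x / y) * y = x + y" using nz by (simp add: field_simps)
      ultimately show False using u by simp
    next
      assume "y / x \<in> R"
      hence "\<not> ring_unit ((1 + y / x) * x)" using xy by (intro nonunit_mult mR) auto
      moreover have "(1 + y / x) * x = x + y" using nz by (simp add: field_simps)
      ultimately show False using u by simp
    qed
  qed
qed

lemma nonunit_sum:
  assumes "\<And>i. i \<in> A \<Longrightarrow> f i \<in> R \<and> \<not> ring_unit (f i)"
  shows "sum f A \<in> R \<and> \<not> ring_unit (sum f A)"
  using assms
  by (induction A rule: infinite_finite_induct) (auto simp: mR nonunit_add, auto simp: ring_unit_def)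

lemma p_nonunit: "of_nat p \<in> R" "\<not> ring_unit (of_nat p)"
  using max_p[OF p maxR] by (auto simp: ring_unit_def mR)

text \<open>By a Bezout identity \<open>x b + y p = 1\<close>, since the nonunits form an ideal that contains \<open>p\<close>.\<close>
lemma int_unit: assumes "\<not> int p dvd b" shows "ring_unit (of_int b)"
proof (rule ccontr)
  assume nu: "\<not> ring_unit (of_int b)"
  have "coprime (int p) b" using p assms by (simp add: prime_imp_coprime)
  then obtain x y where xy: "x * b + y * int p = 1"
    by (metis add.commute bezout_int coprime_iff_gcd_eq_1 mult.commute)
  have "\<not> ring_unit (of_int x * of_int b + of_int y * of_nat p :: 'l)"
    by (intro nonunit_add nonunit_mult nu p_nonunit mR)
  moreover have "of_int x * of_int b + of_int y * of_nat p = (of_int (x * b + y * int p) :: 'l)" by simp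
  ultimately show False unfolding xy using ring_unit_one by simp
qed

lemma rat_decompose:
  assumes "q \<noteq> 0"
  obtains m u where "of_rat q = of_nat p powi m * u" "ring_unit u" "padic_abs p q = real p powi (- m)"
proof -
  obtain m a b where *: "q = of_nat p powi m * (of_int a / of_int b)" "\<not> int p dvd a" "\<not> int p dvd b"
    "padic_abs p q = real p powi (- m)"
    using rat_eq_prime_power_times[OF p assms] .
  have "of_rat (of_nat p powi m) = (of_nat p powi m :: 'l)"
    by (simp add: power_int_def of_rat_power of_rat_inverse)
  hence "of_rat q = of_nat p powi m * (of_int a * inverse (of_int b) :: 'l)"
    by (simp add: *(1) of_rat_mult of_rat_divide of_rat_inverse divide_inverse)
  moreover have "ring_unit (of_int a * inverse (of_int b))"
    by (intro ring_unit_mult ring_unit_inverse int_unit *)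
  ultimately show ?thesis using that *(4) by blast
qed

lemma p_power_unit: assumes "ring_unit (of_nat p powi a)" shows "a = 0"
proof (rule ccontr)
  assume a: "a \<noteq> 0"
  have *: "\<not> ring_unit (of_nat p ^ n)" if n: "n > 0" for n
  proof -
    have "\<not> ring_unit (of_nat p ^ (n - 1) * of_nat p)"
      by (intro nonunit_mult p_nonunit mR)
    thus ?thesis using n by (cases n) (auto simp: mult.commute)
  qed
  show False
  proof (cases "a > 0")
    case True thus False using *[of "nat a"] assms by (simp add: power_int_def)
  next
    case False
    hence "inverse (of_nat p powi a) = (of_nat p ^ nat (- a) :: 'l)"
      by (cases "a = 0") (simp_all add: power_int_def power_inverse)
    thus False using *[of "nat (- a)"] ring_unit_inverse[OF assms] False a by simp
  qed
qed

text \<open>Divisibility in a valuation ring is a total preorder, so finitely many elements have one that divides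
  all others.\<close>
lemma dominant_element:
  assumes "finite I" "I \<noteq> {}" "\<And>i. i \<in> I \<Longrightarrow> t i \<noteq> 0"
  shows "\<exists>i\<in>I. \<forall>j\<in>I. t j / t i \<in> R"
  using assms
proof (induction I rule: finite_ne_induct)
  case (singleton i) thus ?case by (simp add: mR)
next
  case (insert k I)
  then obtain i where i: "i \<in> I" "\<forall>j\<in>I. t j / t i \<in> R" by auto
  have nz: "t i \<noteq> 0" "t k \<noteq> 0" using insert.prems i by auto
  show ?case
  proof (cases "t k / t i \<in> R")
    case True thus ?thesis using i by auto
  next
    case False
    hence ik: "t i / t k \<in> R" using max_valuation[OF p maxR False] by simp
    have "t j / t k \<in> R" if "j \<in> I" for j
    proof -
      have "t j / t k = (t j / t i) * (t i / t k)" using nz by simp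
      also have "\<dots> \<in> R" using i(2) that ik by (intro mR) auto
      finally show ?thesis .
    qed
    moreover have "t k / t k \<in> R" using nz mR by simp
    ultimately show ?thesis by auto
  qed
qed

text \<open>In a vanishing sum of terms \<open>a\<^sub>i x\<^sup>i\<close> with rational \<open>a\<^sub>i\<close>, the largest value must be attained twice:
  otherwise the quotients of the other terms by the dominant one would be nonunits with sum \<open>-1\<close>.
  Comparing two dominant terms shows that a power of \<open>x\<close> is a power of \<open>p\<close> up to a unit.\<close>
lemma value_group_torsion:
  assumes alg: "\<exists>f. f \<noteq> 0 \<and> rat_eval f x = 0" and x: "x \<noteq> 0"
  shows "\<exists>k m. k > 0 \<and> ring_unit (x ^ k * of_nat p powi m)"
proof -
  obtain f where f: "f \<noteq> 0" "rat_eval f x = 0" using alg by blast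
  define I where "I = {i. coeff f i \<noteq> 0}"
  define t where "t = (\<lambda>i. of_rat (coeff f i) * x ^ i)"
  have Isub: "I \<subseteq> {..degree f}" by (auto simp: I_def intro: le_degree)
  have fin: "finite I" using Isub finite_subset by blast
  have "degree f \<in> I" using f(1) by (simp add: I_def)
  hence ne: "I \<noteq> {}" by blast
  have tnz: "t i \<noteq> 0" if "i \<in> I" for i using that x by (simp add: t_def I_def)
  obtain i where i: "i \<in> I" "\<And>j. j \<in> I \<Longrightarrow> t j / t i \<in> R"
    using dominant_element[OF fin ne, of t] tnz by auto
  have "(\<Sum>j\<in>I. t j) = (\<Sum>j<Suc (degree f). t j)"
    by (rule sum.mono_neutral_left) (use Isub in \<open>auto simp: t_def I_def\<close>)
  also have "\<dots> = 0" using f(2) rat_eval_sum_lessThan[of f "Suc (degree f)" x] by (simp add: t_def)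
  finally have "(\<Sum>j\<in>I. t j) / t i = 0" by simp
  hence "1 + (\<Sum>j\<in>I - {i}. t j / t i) = 0"
    using fin i(1) tnz[OF i(1)] by (simp add: sum.remove[OF fin i(1)] sum_divide_distrib add_divide_distrib)
  hence m1: "(\<Sum>j\<in>I - {i}. t j / t i) = - 1" by (simp add: add_eq_0_iff)
  have "\<exists>j\<in>I - {i}. ring_unit (t j / t i)"
  proof (rule ccontr)
    assume "\<not> ?thesis"
    hence "\<not> ring_unit (\<Sum>j\<in>I - {i}. t j / t i)" using nonunit_sum[of "I - {i}" "\<lambda>j. t j / t i"] i(2) by blast
    thus False unfolding m1 using ring_unit_uminus[OF ring_unit_one] by simp
  qed
  then obtain j where j: "j \<in> I" "j \<noteq> i" "ring_unit (t j / t i)" by auto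
  have cnz: "coeff f j / coeff f i \<noteq> 0" using i(1) j(1) by (simp add: I_def)
  obtain m u where mu: "of_rat (coeff f j / coeff f i) = of_nat p powi m * u" "ring_unit u"
    using rat_decompose[OF cnz] by blast
  have "t j / t i = of_rat (coeff f j / coeff f i) * (x ^ j / x ^ i)"
    by (simp add: t_def of_rat_divide)
  hence "ring_unit (of_nat p powi m * u * (x ^ j / x ^ i))" using j(3) mu(1) by simp
  hence "ring_unit (of_nat p powi m * u * (x ^ j / x ^ i) * inverse u)"
    using ring_unit_mult ring_unit_inverse mu(2) by blast
  moreover have "of_nat p powi m * u * (x ^ j / x ^ i) * inverse u = of_nat p powi m * (x ^ j / x ^ i)"
    using mu(2) by (simp add: ring_unit_def)
  ultimately have un: "ring_unit (of_nat p powi m * (x ^ j / x ^ i))" by (simp only:)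
  show ?thesis
  proof (cases "i < j")
    case True
    hence "x ^ j / x ^ i = x ^ (j - i)" using x by (simp add: power_diff)
    thus ?thesis using un True by (intro exI[of _ "j - i"] exI[of _ m]) (simp add: mult.commute)
  next
    case False
    hence ji: "j < i" using j(2) by simp
    have "x ^ j / x ^ i = inverse (x ^ (i - j))" using x ji by (simp add: power_diff field_simps)
    hence "inverse (of_nat p powi m * (x ^ j / x ^ i)) = x ^ (i - j) * of_nat p powi (- m)"
      by (simp add: power_int_minus)
    thus ?thesis using ring_unit_inverse[OF un] ji by (intro exI[of _ "i - j"] exI[of _ "- m"]) simp
  qed
qed

context
  assumes alg: "\<And>x::'l. \<exists>f. f \<noteq> 0 \<and> rat_eval f x = 0"
begin

definition ring_exponent :: "'l \<Rightarrow> nat \<times> int" where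
  "ring_exponent x = (SOME (k, m). k > 0 \<and> ring_unit (x ^ k * of_nat p powi m))"

text \<open>If \<open>x ^ k * p powi m\<close> is a unit, then an absolute value extending the \<open>p\<close>-adic one has to take
  the value \<open>p powr (m / k)\<close> at \<open>x\<close>.\<close>
definition ring_value :: "'l \<Rightarrow> real" where
  "ring_value x = (if x = 0 then 0 else real p powr (real_of_int (snd (ring_exponent x)) / real (fst (ring_exponent x))))"

lemma pl_nz: "(of_nat p :: 'l) \<noteq> 0" using prime_gt_0_nat[OF p] by simp

lemma ring_value_eq:
  assumes k: "k > 0" and u: "ring_unit (x ^ k * of_nat p powi m)"
  shows "ring_value x = real p powr (real_of_int m / real k)"
proof -
  have x: "x \<noteq> 0" using u k by (auto simp: ring_unit_def power_0_left)
  have "\<exists>km. case km of (k, m) \<Rightarrow> k > 0 \<and> ring_unit (x ^ k * of_nat p powi m)" using k u by auto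
  from someI_ex[OF this] obtain k' m' where e: "ring_exponent x = (k', m')" "k' > 0" "ring_unit (x ^ k' * of_nat p powi m')"
    unfolding ring_exponent_def by (auto split: prod.splits)
  have "ring_unit ((x ^ k * of_nat p powi m) ^ k' * inverse ((x ^ k' * of_nat p powi m') ^ k))"
    by (intro ring_unit_mult ring_unit_inverse ring_unit_power u e)
  also have "(x ^ k * of_nat p powi m) ^ k' * inverse ((x ^ k' * of_nat p powi m') ^ k)
      = of_nat p powi (m * int k' - m' * int k)"
    using x pl_nz by (simp add: power_mult_distrib power_mult[symmetric] mult.commute[of k' k] power_int_diff
        power_int_mult field_simps)
  finally have "m * int k' = m' * int k" using p_power_unit by fastforce
  hence "real_of_int m * real k' = real_of_int m' * real k" by (metis of_int_mult of_int_of_nat_eq)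
  hence "real_of_int m / real k = real_of_int m' / real k'" using k e(2) by (simp add: field_simps)
  thus ?thesis using x e(1) by (simp add: ring_value_def)
qed

lemma ring_value_torsion:
  assumes "x \<noteq> 0"
  obtains k m where "k > 0" "ring_unit (x ^ k * of_nat p powi m)" "ring_value x = real p powr (real_of_int m / real k)"
  using value_group_torsion[OF alg assms] ring_value_eq by metis

lemma p_real: "real p > 1" using prime_gt_1_nat[OF p] by simp

lemma ring_value_mult: "ring_value (x * y) = ring_value x * ring_value y"
proof (cases "x = 0 \<or> y = 0")
  case False
  hence nz: "x \<noteq> 0" "y \<noteq> 0" by auto
  obtain k m where k: "k > 0" "ring_unit (x ^ k * of_nat p powi m)" "ring_value x = real p powr (real_of_int m / real k)"
    using ring_value_torsion[OF nz(1)] .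
  obtain l n where l: "l > 0" "ring_unit (y ^ l * of_nat p powi n)" "ring_value y = real p powr (real_of_int n / real l)"
    using ring_value_torsion[OF nz(2)] .
  have "ring_unit ((x ^ k * of_nat p powi m) ^ l * (y ^ l * of_nat p powi n) ^ k)"
    by (intro ring_unit_mult ring_unit_power k l)
  also have "(x ^ k * of_nat p powi m) ^ l * (y ^ l * of_nat p powi n) ^ k =
      (x * y) ^ (k * l) * of_nat p powi (m * int l + n * int k)"
    using pl_nz by (simp add: power_mult_distrib power_mult[symmetric] mult.commute[of l k] power_int_add
        power_int_mult field_simps)
  finally have "ring_value (x * y) = real p powr (real_of_int (m * int l + n * int k) / real (k * l))"
    using k l by (intro ring_value_eq) auto
  also have "real_of_int (m * int l + n * int k) / real (k * l) = real_of_int m / real k + real_of_int n / real l"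
    using k(1) l(1) by (simp add: field_simps)
  finally show ?thesis by (simp add: powr_add k(3) l(3))
qed (auto simp: ring_value_def)

lemma ring_value_le_1: "ring_value x \<le> 1 \<longleftrightarrow> x \<in> R"
proof (cases "x = 0")
  case False
  obtain k m where k: "k > 0" "ring_unit (x ^ k * of_nat p powi m)" "ring_value x = real p powr (real_of_int m / real k)"
    using ring_value_torsion[OF False] .
  have "ring_value x \<le> 1 \<longleftrightarrow> m \<le> 0"
    using p_real k(1) powr_le_cancel_iff[of "real p" "real_of_int m / real k" 0]
    by (simp add: k(3) divide_le_0_iff)
  also have "m \<le> 0 \<longleftrightarrow> x \<in> R"
  proof
    assume m: "m \<le> 0"
    have "x ^ k = (x ^ k * of_nat p powi m) * of_nat p ^ nat (- m)"
      using pl_nz m by (cases "m = 0") (simp_all add: power_int_def power_inverse)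
    also have "\<dots> \<in> R"
    proof (rule mR(6)[OF _ mR(7)[OF p_nonunit(1)]])
      show "x ^ k * of_nat p powi m \<in> R" using k(2) by (simp only: ring_unit_def)
    qed
    finally have xk: "x ^ k \<in> R" .
    show "x \<in> R"
    proof (rule ccontr)
      assume "x \<notin> R"
      hence ix: "inverse x \<in> R" by (rule max_valuation[OF p maxR])
      have "x = x ^ k * inverse x ^ (k - 1)" using False k(1) by (cases k) (simp_all add: power_inverse)
      also have "\<dots> \<in> R" by (intro mR xk ix)
      finally show False using \<open>x \<notin> R\<close> by simp
    qed
  next
    assume x: "x \<in> R"
    show "m \<le> 0"
    proof (rule ccontr)
      assume "\<not> m \<le> 0"
      hence m: "m > 0" by simp
      have "\<not> ring_unit ((x ^ k * of_nat p ^ (nat m - 1)) * of_nat p)"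
        by (intro nonunit_mult p_nonunit mR x)
      moreover have "(of_nat p :: 'l) ^ nat m = of_nat p ^ (nat m - 1) * of_nat p"
        using m by (cases "nat m") (simp_all add: mult.commute)
      ultimately show False using k(2) m by (simp add: power_int_def mult.assoc)
    qed
  qed
  finally show ?thesis .
qed (simp add: ring_value_def mR)

lemma ring_value_of_rat: "ring_value (of_rat q) = padic_abs p q"
proof (cases "q = 0")
  case False
  obtain m u where mu: "of_rat q = of_nat p powi m * u" "ring_unit u" "padic_abs p q = real p powi (- m)"
    using rat_decompose[OF False] .
  have "of_rat q ^ 1 * of_nat p powi (- m) = u" using pl_nz by (simp add: mu(1) power_int_minus)
  hence "ring_value (of_rat q) = real p powr (real_of_int (- m) / real 1)"
    using mu(2) by (intro ring_value_eq) auto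
  thus ?thesis using p_real mu(3) powr_real_of_int'[of "real p" "- m"] by simp
qed (simp add: ring_value_def padic_abs_def)

lemma ring_value_pos: "x \<noteq> 0 \<Longrightarrow> ring_value x > 0"
  using p_real by (simp add: ring_value_def)

text \<open>If \<open>ring_value x \<le> ring_value y\<close>, then \<open>x / y\<close> and hence \<open>1 + x / y\<close> belong to \<open>R\<close>, and \<open>R\<close> is the set of
  elements of value at most \<open>1\<close>.\<close>
lemma ring_value_ultrametric: "ring_value (x + y) \<le> max (ring_value x) (ring_value y)"
proof -
  have *: "ring_value (x + y) \<le> ring_value y" if le: "ring_value x \<le> ring_value y" for x y
  proof (cases "y = 0")
    case True
    hence "ring_value y = 0" by (simp add: ring_value_def)
    hence "x = 0" using le ring_value_pos[of x] by force
    thus ?thesis using True by simp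
  next
    case False
    have "ring_value y * ring_value (x / y) = ring_value x" using False by (simp add: ring_value_mult[symmetric])
    hence "ring_value (x / y) \<le> 1" using le ring_value_pos[OF False]
      by (metis mult.right_neutral mult_le_cancel_left_pos)
    hence "1 + x / y \<in> R" using ring_value_le_1 mR by simp
    hence "ring_value (1 + x / y) \<le> 1" using ring_value_le_1 by simp
    hence "ring_value y * ring_value (1 + x / y) \<le> ring_value y" using ring_value_pos[OF False] by simp
    moreover have "y * (1 + x / y) = x + y" using False by (simp add: field_simps)
    ultimately show ?thesis by (simp add: ring_value_mult[symmetric])
  qed
  show ?thesis
  proof (cases "ring_value x \<le> ring_value y")
    case True thus ?thesis using *[OF True] by simp
  next
    case False thus ?thesis using *[of y x] by (simp add: add.commute)
  qed
qed

lemma ring_value_absolute_value: "absolute_value ring_value"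
  unfolding absolute_value_def
proof (intro conjI allI)
  have nn: "ring_value x \<ge> 0" for x by (simp add: ring_value_def)
  fix x y
  show "ring_value x \<ge> 0" by (rule nn)
  show "ring_value x = 0 \<longleftrightarrow> x = 0" using ring_value_pos[of x] by (auto simp: ring_value_def)
  show "ring_value (x * y) = ring_value x * ring_value y" by (rule ring_value_mult)
  show "ring_value (x + y) \<le> ring_value x + ring_value y"
    using ring_value_ultrametric[of x y] nn[of x] nn[of y] by linarith
qed

end

end

lemma rat_eval_algebraic_number: "\<exists>f. f \<noteq> 0 \<and> rat_eval f (x :: algebraic_number) = 0"
proof -
  have emb: "embedding Rep_algebraic_number"
    by (simp add: embedding_def plus_algebraic_number.rep_eq times_algebraic_number.rep_eq one_algebraic_number.rep_eq)
  obtain g where g: "\<forall>i. coeff g i \<in> \<int>" "g \<noteq> 0" "poly g (Rep_algebraic_number x) = 0"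
    using Rep_algebraic_number[of x] algebraicE by blast
  have "\<forall>i. \<exists>k::int. coeff g i = of_int k" using g(1) by (auto simp: Ints_def)
  then obtain c :: "nat \<Rightarrow> int" where c: "\<And>i. coeff g i = of_int (c i)" by metis
  define f where "f = (\<Sum>i\<le>degree g. monom (of_int (c i) :: rat) i)"
  have cf: "coeff f i = of_int (c i)" for i
  proof (cases "i \<le> degree g")
    case False
    hence "c i = 0" using c[of i] coeff_eq_0[of g i] by simp
    thus ?thesis using False by (simp add: f_def coeff_sum)
  qed (simp add: f_def coeff_sum)
  have fg: "map_poly of_rat f = g" by (simp add: poly_eq_iff coeff_map_poly cf c)
  interpret field_hom Rep_algebraic_number using emb by (rule embedding_field_hom)
  have "Rep_algebraic_number (rat_eval h x) = rat_eval h (Rep_algebraic_number x)" for h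
    by (induction h) (simp_all add: hom_add hom_mult embedding_of_rat[OF emb])
  hence "Rep_algebraic_number (rat_eval f x) = 0" using g(3) fg by (simp add: rat_eval_def)
  hence "rat_eval f x = 0" by simp
  moreover have "f \<noteq> 0" using g(2) fg by auto
  ultimately show ?thesis by blast
qed

theorem padic_extension_exists:
  assumes p: "prime p"
  obtains w :: "algebraic_number \<Rightarrow> real"
  where "absolute_value w" "\<And>x y. w (x + y) \<le> max (w x) (w y)" "\<And>q. w (of_rat q) = padic_abs p q"
proof -
  obtain R :: "algebraic_number set" where R: "maximal_subring p R" using maximal_subring_exists[OF p] .
  note * = p R rat_eval_algebraic_number
  show ?thesis
    using that ring_value_absolute_value[OF *] ring_value_ultrametric[OF *] ring_value_of_rat[OF *] by blast
qed


section \<open>Norms, traces and the discriminant\<close>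

definition conj_matrix :: "(nat \<Rightarrow> 'k \<Rightarrow> 'l) \<Rightarrow> nat \<Rightarrow> (nat \<Rightarrow> 'k) \<Rightarrow> 'l mat" where
  "conj_matrix s n b = mat n n (\<lambda>(i, j). s i (b j))"

lemma conj_matrix_carrier [simp]: "conj_matrix s n b \<in> carrier_mat n n"
  by (simp add: conj_matrix_def)

lemma mat_mult_entry:
  assumes "A \<in> carrier_mat n n" "B \<in> carrier_mat n n" "i < n" "j < n"
  shows "(A * B) $$ (i, j) = (\<Sum>k<n. A $$ (i, k) * B $$ (k, j))"
  using assms by (simp add: scalar_prod_def atLeast0LessThan)

lemma embedding_rat_combination:
  fixes s :: "'k::field_char_0 \<Rightarrow> 'l::field_char_0"
  assumes "embedding s"
  shows "s (\<Sum>i\<in>I. of_rat (c i) * b i) = (\<Sum>i\<in>I. of_rat (c i) * s (b i))"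
proof -
  interpret field_hom s using assms by (rule embedding_field_hom)
  show ?thesis by (simp add: hom_sum hom_mult embedding_of_rat[OF assms])
qed

text \<open>A linear relation between the rows is a relation between the embeddings on a spanning set, hence
  on all of \<open>K\<close>.\<close>
lemma conj_matrix_det_nonzero:
  fixes s :: "nat \<Rightarrow> 'k::field_char_0 \<Rightarrow> 'l::field_char_0"
  assumes emb: "\<And>i. i < n \<Longrightarrow> embedding (s i)" and inj: "inj_on s {..<n}" and b: "rat_spanning n b"
  shows "Determinant.det (conj_matrix s n b) \<noteq> 0"
proof
  assume "Determinant.det (conj_matrix s n b) = 0"
  hence "Determinant.det (transpose_mat (conj_matrix s n b)) = 0" by (simp add: det_transpose[of _ n])
  then obtain v where v: "v \<in> carrier_vec n" "v \<noteq> 0\<^sub>v n" "transpose_mat (conj_matrix s n b) *\<^sub>v v = 0\<^sub>v n"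
    using det_0_iff_vec_prod_zero_field[of "transpose_mat (conj_matrix s n b)" n] by auto
  have col: "(\<Sum>i<n. vec_index v i * s i (b j)) = 0" if j: "j < n" for j
  proof -
    have "(\<Sum>i<n. vec_index v i * s i (b j)) = vec_index (transpose_mat (conj_matrix s n b) *\<^sub>v v) j"
      using j v(1) by (simp add: conj_matrix_def scalar_prod_def atLeast0LessThan mult.commute)
    thus ?thesis using v(3) j by simp
  qed
  have "(\<Sum>i<n. vec_index v i * s i x) = 0" for x
  proof -
    obtain c where c: "x = (\<Sum>j<n. of_rat (c j) * b j)" using b unfolding rat_spanning_def by blast
    have "(\<Sum>i<n. vec_index v i * s i x) = (\<Sum>i<n. \<Sum>j<n. of_rat (c j) * (vec_index v i * s i (b j)))"
      unfolding c by (intro sum.cong refl) (simp add: embedding_rat_combination[OF emb] sum_distrib_left mult.left_commute)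
    also have "\<dots> = (\<Sum>j<n. of_rat (c j) * (\<Sum>i<n. vec_index v i * s i (b j)))"
      by (subst sum.swap) (simp add: sum_distrib_left)
    also have "\<dots> = 0" using col by simp
    finally show ?thesis .
  qed
  hence "\<forall>i\<in>{..<n}. vec_index v i = 0"
    using embeddings_independent[of "{..<n}" s "\<lambda>i. vec_index v i"] emb inj by auto
  hence "v = 0\<^sub>v n" using v(1) by (intro eq_vecI) auto
  thus False using v(2) by simp
qed

text \<open>The matrix \<open>S\<close> of conjugates of a basis diagonalizes multiplication by \<open>x\<close>, with the conjugates
  of \<open>x\<close> on the diagonal. Comparing determinants and traces gives the two formulas.\<close>
lemma multiplication_matrix_similar:
  fixes s :: "nat \<Rightarrow> 'k::field_char_0 \<Rightarrow> 'l::field_char_0"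
  assumes emb: "\<And>i. i < n \<Longrightarrow> embedding (s i)" and inj: "inj_on s {..<n}" and b: "rat_spanning n b"
    and c: "\<And>j. j < n \<Longrightarrow> x * b j = (\<Sum>k<n. of_rat (c k j) * b k)"
  shows "(\<Prod>i<n. s i x) = of_rat (Determinant.det (mat n n (\<lambda>(k, j). c k j)))"
    and "(\<Sum>i<n. s i x) = of_rat (\<Sum>j<n. c j j)"
proof -
  define S where "S = conj_matrix s n b"
  define D where "D = mat n n (\<lambda>(i, j). if i = j then s i x else 0)"
  define M where "M = mat n n (\<lambda>(k, j). c k j)"
  define M' where "M' = map_mat (of_rat :: rat \<Rightarrow> 'l) M"
  have [simp]: "S \<in> carrier_mat n n" "D \<in> carrier_mat n n" "M \<in> carrier_mat n n" "M' \<in> carrier_mat n n"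
    by (simp_all add: S_def D_def M_def M'_def)
  have detS: "Determinant.det S \<noteq> 0" unfolding S_def by (rule conj_matrix_det_nonzero[OF emb inj b])
  have SM: "S * M' = D * S"
  proof (rule eq_matI)
    fix i j assume "i < dim_row (D * S)" "j < dim_col (D * S)"
    hence ij: "i < n" "j < n" by (simp_all add: D_def S_def conj_matrix_def)
    have "(S * M') $$ (i, j) = (\<Sum>k<n. s i (b k) * of_rat (c k j))"
      using ij by (simp add: S_def M'_def M_def conj_matrix_def scalar_prod_def atLeast0LessThan)
    also have "\<dots> = s i (x * b j)"
      unfolding c[OF ij(2)] embedding_rat_combination[OF emb[OF ij(1)]] by (simp add: mult.commute)
    also have "\<dots> = s i x * s i (b j)" using emb[OF ij(1)] by (simp add: embedding_def)
    also have "\<dots> = (\<Sum>k<n. (if i = k then s i x else 0) * s k (b j))"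
      using ij by (simp add: if_distrib[of "\<lambda>t. t * _"] cong: if_cong)
    also have "\<dots> = (D * S) $$ (i, j)"
      using ij by (simp add: S_def D_def conj_matrix_def scalar_prod_def atLeast0LessThan)
    finally show "(S * M') $$ (i, j) = (D * S) $$ (i, j)" .
  qed (simp_all add: S_def D_def M'_def M_def conj_matrix_def)
  have "Determinant.det S * Determinant.det M' = Determinant.det D * Determinant.det S"
    using arg_cong[OF SM, of Determinant.det] by (simp add: det_mult[of _ n])
  hence "Determinant.det M' = Determinant.det D" using detS by simp
  moreover have "Determinant.det D = (\<Prod>i<n. s i x)"
  proof -
    have "Determinant.det D = prod_list (diag_mat D)"
      by (rule det_upper_triangular[of _ n]) (auto simp: D_def upper_triangular_def)
    also have "\<dots> = (\<Prod>i<n. s i x)"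
      unfolding prod_list_diag_prod by (simp add: D_def atLeast0LessThan)
    finally show ?thesis .
  qed
  moreover have "Determinant.det M' = of_rat (Determinant.det M)" unfolding M'_def by (rule of_rat_hom.hom_det)
  ultimately show "(\<Prod>i<n. s i x) = of_rat (Determinant.det (mat n n (\<lambda>(k, j). c k j)))"
    by (simp add: M_def)
  obtain T where T: "T \<in> carrier_mat n n" "T * S = 1\<^sub>m n" "S * T = 1\<^sub>m n"
    using det_non_zero_imp_unit[of S n "()"] detS by (auto simp: Units_def ring_mat_simps)
  have M'T: "M' = T * (D * S)"
  proof -
    have "T * (D * S) = T * (S * M')" by (simp only: SM)
    also have "\<dots> = (T * S) * M'" by (rule assoc_mult_mat[symmetric, of _ n n _ n _ n]) (use T(1) in auto)
    finally show ?thesis using left_mult_one_mat[of M' n n] by (simp add: T(2))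
  qed
  have "of_rat (c j j) = (\<Sum>i<n. T $$ (j, i) * (s i x * S $$ (i, j)))" if j: "j < n" for j
  proof -
    have "of_rat (c j j) = M' $$ (j, j)" using j by (simp add: M'_def M_def)
    also have "\<dots> = (\<Sum>i<n. T $$ (j, i) * (D * S) $$ (i, j))"
      unfolding M'T by (rule mat_mult_entry[OF T(1) _ j j]) (rule mult_carrier_mat[of _ n n], simp_all)
    also have "\<dots> = (\<Sum>i<n. T $$ (j, i) * (s i x * S $$ (i, j)))"
    proof (intro sum.cong refl)
      fix i assume i: "i \<in> {..<n}"
      have "(D * S) $$ (i, j) = (\<Sum>k<n. (if i = k then s i x else 0) * S $$ (k, j))"
        using i j by (simp add: S_def D_def conj_matrix_def scalar_prod_def atLeast0LessThan)
      thus "T $$ (j, i) * (D * S) $$ (i, j) = T $$ (j, i) * (s i x * S $$ (i, j))"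
        using i by (simp add: if_distrib[of "\<lambda>t. t * _"] cong: if_cong)
    qed
    finally show ?thesis .
  qed
  hence "of_rat (\<Sum>j<n. c j j) = (\<Sum>j<n. \<Sum>i<n. T $$ (j, i) * (s i x * S $$ (i, j)))"
    by (simp add: of_rat_sum)
  also have "\<dots> = (\<Sum>i<n. s i x * (\<Sum>j<n. S $$ (i, j) * T $$ (j, i)))"
    by (subst sum.swap) (simp add: sum_distrib_left algebra_simps)
  also have "\<dots> = (\<Sum>i<n. s i x)"
  proof (intro sum.cong refl)
    fix i assume i: "i \<in> {..<n}"
    have "(\<Sum>j<n. S $$ (i, j) * T $$ (j, i)) = (S * T) $$ (i, i)"
      using i T(1) by (simp add: S_def conj_matrix_def scalar_prod_def atLeast0LessThan)
    thus "s i x * (\<Sum>j<n. S $$ (i, j) * T $$ (j, i)) = s i x" using i T(3) by simp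
  qed
  finally show "(\<Sum>i<n. s i x) = of_rat (\<Sum>j<n. c j j)" by simp
qed

lemma conjugate_product_rational:
  fixes s :: "nat \<Rightarrow> 'k::number_field \<Rightarrow> 'l::field_char_0"
  assumes emb: "\<And>i. i < field_degree TYPE('k) \<Longrightarrow> embedding (s i)" and inj: "inj_on s {..<field_degree TYPE('k)}"
  obtains q where "(\<Prod>i<field_degree TYPE('k). s i x) = of_rat q"
proof -
  obtain b :: "nat \<Rightarrow> 'k" where b: "rat_indep (field_degree TYPE('k)) b" "rat_spanning (field_degree TYPE('k)) b"
    using rat_basis_exists .
  have "\<forall>j. \<exists>c. x * b j = (\<Sum>k<field_degree TYPE('k). of_rat (c k) * b k)"
    using b(2) by (simp add: rat_spanning_def)
  then obtain c where "\<And>j. x * b j = (\<Sum>k<field_degree TYPE('k). of_rat (c j k) * b k)" by metis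
  thus ?thesis using that multiplication_matrix_similar(1)[OF emb inj b(2), of x "\<lambda>k j. c j k"] by blast
qed

lemma field_trace_conjugates:
  fixes s :: "nat \<Rightarrow> 'k::number_field \<Rightarrow> 'l::field_char_0"
  assumes emb: "\<And>i. i < field_degree TYPE('k) \<Longrightarrow> embedding (s i)" and inj: "inj_on s {..<field_degree TYPE('k)}"
  shows "of_rat (field_trace x) = (\<Sum>i<field_degree TYPE('k). s i x)"
proof -
  let ?d = "field_degree TYPE('k)"
  define B where "B = (SOME B::'k set. rat_vs.independent B \<and> rat_vs.span B = UNIV)"
  have "\<exists>B::'k set. rat_vs.independent B \<and> rat_vs.span B = UNIV" using finite_rat_basis_exists by metis
  from someI_ex[OF this] have B: "rat_vs.independent B" "rat_vs.span B = UNIV" unfolding B_def by auto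
  obtain B0 :: "'k set" where B0: "finite B0" "rat_vs.span B0 = UNIV" using finite_rat_basis_exists by metis
  have finB: "finite B" using rat_vs.independent_span_bound[OF B0(1) B(1)] B0(2) by simp
  have cardB: "card B = ?d" unfolding field_degree_def using rat_vs.dim_eq_card[of B UNIV] B by simp
  obtain b where b: "bij_betw b {..<?d} B"
    using ex_bij_betw_nat_finite[OF finB] cardB by (auto simp: atLeast0LessThan)
  have sp: "rat_spanning ?d b" using b B by (simp add: rat_spanning_iff bij_betw_def)
  define c where "c = (\<lambda>k j. rat_vs.representation B (x * b j) (b k))"
  have "x * b j = (\<Sum>k<?d. of_rat (c k j) * b k)" for j
  proof -
    have "(\<Sum>k<?d. of_rat (c k j) * b k) = (\<Sum>y\<in>B. of_rat (rat_vs.representation B (x * b j) y) * y)"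
      unfolding c_def by (rule sum.reindex_bij_betw[OF b])
    also have "\<dots> = x * b j" by (rule rat_vs.sum_representation_eq) (use B finB in auto)
    finally show ?thesis by simp
  qed
  hence "(\<Sum>i<?d. s i x) = of_rat (\<Sum>j<?d. c j j)"
    by (intro multiplication_matrix_similar(2)[OF emb inj sp])
  also have "(\<Sum>j<?d. c j j) = (\<Sum>y\<in>B. rat_vs.representation B (x * y) y)"
    unfolding c_def by (rule sum.reindex_bij_betw[OF b])
  also have "\<dots> = field_trace x" by (simp add: field_trace_def B_def Let_def)
  finally show ?thesis by simp
qed

lemma embedding_algebraic_int:
  fixes s :: "'k::field_char_0 \<Rightarrow> 'l::field_char_0"
  assumes "embedding s" "algebraic_int x"
  shows "algebraic_int (s x)"
proof -
  interpret field_hom s using assms(1) by (rule embedding_field_hom)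
  obtain p where p: "poly (map_poly of_int p) x = 0" "lead_coeff p = 1"
    using assms by (auto simp: algebraic_int_altdef_ipoly)
  have "s (poly (map_poly of_int p) x) = poly (map_poly of_int p) (s x)" for p :: "int poly"
    by (induction p) (simp_all add: map_poly_pCons_zero hom_add hom_mult hom_of_int)
  hence "poly (map_poly of_int p) (s x) = 0" using p(1) hom_zero by metis
  thus ?thesis using p(2) by (auto simp: algebraic_int_altdef_ipoly)
qed

text \<open>The trace is a sum of algebraic integers and rational.\<close>
lemma field_trace_integral:
  fixes x :: "'k::number_field"
  assumes x: "algebraic_int x"
  shows "field_trace x \<in> \<int>"
proof -
  obtain s :: "nat \<Rightarrow> 'k \<Rightarrow> complex"
    where s: "\<And>i. i < field_degree TYPE('k) \<Longrightarrow> embedding (s i)" "inj_on s {..<field_degree TYPE('k)}"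
    using complex_embeddings_exist by blast
  have "algebraic_int (of_rat (field_trace x) :: complex)"
  proof (subst field_trace_conjugates[where s = s], fact s, fact s, rule algebraic_int_sum)
    fix i assume "i \<in> {..<field_degree TYPE('k)}"
    hence "i < field_degree TYPE('k)" by simp
    thus "algebraic_int (s i x)" by (rule embedding_algebraic_int[OF s(1) x])
  qed
  hence "(of_rat (field_trace x) :: complex) \<in> \<int>" by (intro rational_algebraic_int_is_int) auto
  then obtain z where "of_rat (field_trace x) = (of_int z :: complex)" by (auto elim: Ints_cases)
  hence "(of_rat (field_trace x) :: complex) = of_rat (of_int z)" by simp
  hence "field_trace x = of_int z" by (simp only: of_rat_eq_iff)
  thus ?thesis by simp
qed

definition gram_det :: "nat \<Rightarrow> (nat \<Rightarrow> 'k::number_field) \<Rightarrow> rat" where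
  "gram_det n b = Determinant.det (mat n n (\<lambda>(i, j). field_trace (b i * b j)))"

text \<open>The trace form has the Gram matrix \<open>S\<^sup>T S\<close>, where \<open>S\<close> is the matrix of conjugates.\<close>
lemma gram_det_conj:
  fixes s :: "nat \<Rightarrow> 'k::number_field \<Rightarrow> 'l::field_char_0"
  defines "n \<equiv> field_degree TYPE('k)"
  assumes emb: "\<And>i. i < n \<Longrightarrow> embedding (s i)" and inj: "inj_on s {..<n}"
  shows "of_rat (gram_det n b) = (Determinant.det (conj_matrix s n b))\<^sup>2"
proof -
  define S where "S = conj_matrix s n b"
  define G where "G = mat n n (\<lambda>(i, j). field_trace (b i * b j))"
  have [simp]: "S \<in> carrier_mat n n" by (simp add: S_def)
  have "map_mat of_rat G = transpose_mat S * S"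
  proof (rule eq_matI)
    fix i j assume "i < dim_row (transpose_mat S * S)" "j < dim_col (transpose_mat S * S)"
    hence ij: "i < n" "j < n" by (simp_all add: S_def conj_matrix_def)
    have "of_rat (field_trace (b i * b j)) = (\<Sum>k<n. s k (b i * b j))"
      unfolding n_def by (rule field_trace_conjugates) (use emb inj in \<open>simp_all add: n_def\<close>)
    also have "\<dots> = (\<Sum>k<n. s k (b i) * s k (b j))"
      using emb by (intro sum.cong) (auto simp: embedding_def)
    finally show "map_mat of_rat G $$ (i, j) = (transpose_mat S * S) $$ (i, j)"
      using ij by (simp add: G_def S_def conj_matrix_def scalar_prod_def atLeast0LessThan)
  qed (simp_all add: G_def S_def conj_matrix_def)
  hence "Determinant.det (map_mat of_rat G) = Determinant.det (transpose_mat S) * Determinant.det S"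
    by (simp add: det_mult[of _ n])
  thus ?thesis
    by (simp add: det_transpose[of _ n] power2_eq_square gram_det_def G_def S_def of_rat_hom.hom_det)
qed

lemma det_integral:
  fixes A :: "rat mat"
  assumes A: "A \<in> carrier_mat n n" and ints: "\<And>i j. i < n \<Longrightarrow> j < n \<Longrightarrow> A $$ (i, j) \<in> \<int>"
  shows "Determinant.det A \<in> \<int>"
  unfolding det_def'[OF A]
proof (intro Ints_sum Ints_mult Ints_prod)
  fix p i assume p: "p \<in> {p. p permutes {0..<n}}"
  show "of_int (sign p) \<in> (\<int> :: rat set)" by simp
  assume i: "i \<in> {0..<n}"
  show "A $$ (i, p i) \<in> \<int>" using ints[of i "p i"] p i permutes_in_image[of p "{0..<n}" i] by auto
qed

lemma gram_det_nonzero_int: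
  fixes b :: "nat \<Rightarrow> 'k::number_field"
  defines "n \<equiv> field_degree TYPE('k)"
  assumes b: "rat_indep n b" and int: "\<And>i. i < n \<Longrightarrow> algebraic_int (b i)"
  shows "gram_det n b \<in> \<int>" "gram_det n b \<noteq> 0"
proof -
  show "gram_det n b \<in> \<int>"
    unfolding gram_det_def
    by (rule det_integral[of _ n]) (auto intro!: field_trace_integral algebraic_int_add_mult int)
  obtain s :: "nat \<Rightarrow> 'k \<Rightarrow> complex"
    where s: "\<And>i. i < n \<Longrightarrow> embedding (s i)" "inj_on s {..<n}"
    using complex_embeddings_exist[where 'k='k] unfolding n_def by blast
  have "rat_spanning n b" using b rat_indep_degree_spanning unfolding n_def by blast
  hence "Determinant.det (conj_matrix s n b) \<noteq> 0" by (intro conj_matrix_det_nonzero s)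
  hence "of_rat (gram_det n b) \<noteq> (0::complex)"
    using gram_det_conj[where 'k='k, of s b] s by (simp add: n_def)
  thus "gram_det n b \<noteq> 0" by simp
qed

lemma det_identity_column:
  fixes q :: "nat \<Rightarrow> 'a::comm_ring_1"
  assumes i: "i < n"
  shows "Determinant.det (mat n n (\<lambda>(k, j). if j = i then q k else if k = j then 1 else 0)) = q i"
proof -
  define E where "E = mat n n (\<lambda>(k, j). if j = i then q k else if k = j then 1 else 0)"
  have E: "E \<in> carrier_mat n n" by (simp add: E_def)
  have "Determinant.det E = (\<Sum>j<n. E $$ (i, j) * cofactor E i j)"
    by (rule laplace_expansion_row[OF E i])
  also have "\<dots> = (\<Sum>j<n. if j = i then q i * cofactor E i i else 0)"
    using i by (intro sum.cong) (auto simp: E_def)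
  also have "\<dots> = q i * cofactor E i i" using i by simp
  also have "cofactor E i i = Determinant.det (mat_delete E i i)"
    by (simp add: cofactor_def)
  also have "mat_delete E i i = 1\<^sub>m (n - 1)"
    using i by (intro eq_matI) (auto simp: mat_delete_def E_def)
  finally show ?thesis by (simp add: E_def)
qed

text \<open>The exchange of \<open>b i\<close> for \<open>y\<close> multiplies the matrix of conjugates by an identity matrix whose column \<open>i\<close>
  has been replaced by the coordinates of \<open>y\<close>.\<close>
lemma gram_det_update:
  fixes b :: "nat \<Rightarrow> 'k::number_field"
  defines "n \<equiv> field_degree TYPE('k)"
  assumes y: "y = (\<Sum>k<n. of_rat (q k) * b k)" and i: "i < n"
  shows "gram_det n (b(i := y)) = (q i)\<^sup>2 * gram_det n b"
proof -
  obtain s :: "nat \<Rightarrow> 'k \<Rightarrow> complex"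
    where s: "\<And>i. i < n \<Longrightarrow> embedding (s i)" "inj_on s {..<n}"
    using complex_embeddings_exist[where 'k='k] unfolding n_def by blast
  define E where "E = mat n n (\<lambda>(k, j). if j = i then of_rat (q k) else if k = j then 1 else (0::complex))"
  have "conj_matrix s n (b(i := y)) = conj_matrix s n b * E"
  proof (rule eq_matI)
    fix r j assume "r < dim_row (conj_matrix s n b * E)" "j < dim_col (conj_matrix s n b * E)"
    hence rj: "r < n" "j < n" by (simp_all add: E_def conj_matrix_def)
    have "(conj_matrix s n b * E) $$ (r, j) = (\<Sum>k<n. s r (b k) * (if j = i then of_rat (q k) else if k = j then 1 else 0))"
      using rj by (simp add: E_def conj_matrix_def scalar_prod_def atLeast0LessThan)
    also have "\<dots> = s r ((b(i := y)) j)"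
    proof (cases "j = i")
      case True
      have "s r y = (\<Sum>k<n. of_rat (q k) * s r (b k))"
        unfolding y by (rule embedding_rat_combination[OF s(1)[OF rj(1)]])
      thus ?thesis using True by (simp add: mult.commute)
    next
      case False
      thus ?thesis using rj by (simp add: if_distrib[of "\<lambda>t. _ * t"] cong: if_cong)
    qed
    finally show "conj_matrix s n (b(i := y)) $$ (r, j) = (conj_matrix s n b * E) $$ (r, j)"
      using rj by (simp add: conj_matrix_def)
  qed (simp_all add: E_def conj_matrix_def)
  hence "Determinant.det (conj_matrix s n (b(i := y))) = Determinant.det (conj_matrix s n b) * of_rat (q i)"
    using det_identity_column[OF i, of "\<lambda>k. of_rat (q k) :: complex"]
    by (simp add: det_mult[of _ n] E_def)
  hence "(of_rat (gram_det n (b(i := y))) :: complex) = of_rat ((q i)\<^sup>2 * gram_det n b)"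
    using gram_det_conj[where 'k='k, of s] s
    by (simp add: n_def of_rat_mult of_rat_power power_mult_distrib)
  thus ?thesis by (simp only: of_rat_eq_iff)
qed

lemma integral_rat_basis_exists:
  obtains b :: "nat \<Rightarrow> 'k::number_field"
  where "rat_indep (field_degree TYPE('k)) b" "\<And>i. algebraic_int (b i)"
proof -
  obtain b :: "nat \<Rightarrow> 'k" where b: "rat_indep (field_degree TYPE('k)) b"
    using rat_basis_exists by blast
  have "\<exists>N::int. N > 0 \<and> algebraic_int (of_int N * b i)" for i
  proof -
    have "algebraic (b i)" using number_field_algebraic_rat_poly[of "b i"] rat_eval_algebraic by blast
    thus ?thesis using algebraic_imp_scaled_algebraic_int by metis
  qed
  then obtain N :: "nat \<Rightarrow> int" where N: "\<And>i. N i > 0" "\<And>i. algebraic_int (of_int (N i) * b i)" by metis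
  have "rat_indep (field_degree TYPE('k)) (\<lambda>i. of_int (N i) * b i)"
    unfolding rat_indep_def
  proof (intro allI impI)
    fix c :: "nat \<Rightarrow> rat" and i
    assume c: "(\<Sum>i<field_degree TYPE('k). of_rat (c i) * (of_int (N i) * b i)) = 0" and i: "i < field_degree TYPE('k)"
    have "(\<Sum>i<field_degree TYPE('k). of_rat (c i * of_int (N i)) * b i) = 0"
      using c by (simp add: of_rat_mult mult.assoc)
    hence "c i * of_int (N i) = 0"
      using b[unfolded rat_indep_def, rule_format, of "\<lambda>i. c i * of_int (N i)"] i by blast
    thus "c i = 0" using N(1)[of i] by simp
  qed
  thus ?thesis using that N(2) by blast
qed

text \<open>Among the bases of \<open>K\<close> over \<open>\<rat>\<close> that consist of algebraic integers, take one with the smallest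
  discriminant in absolute value. If some algebraic integer had a coordinate \<open>q i\<close> that is not an
  integer, then subtracting \<open>\<lfloor>q i\<rfloor> * b i\<close> and replacing \<open>b i\<close> by the result would multiply the
  discriminant by the square of the fractional part of \<open>q i\<close>.\<close>
theorem integral_basis_exists: "\<exists>\<omega> :: 'k::number_field list. integral_basis \<omega>"
proof -
  let ?d = "field_degree TYPE('k)"
  define P where "P = (\<lambda>b :: nat \<Rightarrow> 'k. rat_indep ?d b \<and> (\<forall>i<?d. algebraic_int (b i)))"
  define m where "m = (\<lambda>b :: nat \<Rightarrow> 'k. nat \<lfloor>\<bar>gram_det ?d b\<bar>\<rfloor>)"
  obtain b0 :: "nat \<Rightarrow> 'k" where "rat_indep ?d b0" "\<And>i. algebraic_int (b0 i)"
    using integral_rat_basis_exists[where 'k = 'k] by blast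
  hence "P b0" by (simp add: P_def)
  then obtain b where b: "P b" and min: "\<And>b'. P b' \<Longrightarrow> m b \<le> m b'"
    using ex_has_least_nat[of P b0 m] by blast
  have ind: "rat_indep ?d b" and int: "\<And>i. i < ?d \<Longrightarrow> algebraic_int (b i)" using b by (auto simp: P_def)
  have sp: "rat_spanning ?d b" using ind by (rule rat_indep_degree_spanning)
  have mval: "of_nat (m b') = \<bar>gram_det ?d b'\<bar>" if "P b'" for b'
  proof -
    have "gram_det ?d b' \<in> \<int>" using that gram_det_nonzero_int(1) unfolding P_def by blast
    then obtain z where "gram_det ?d b' = of_int z" by (auto elim: Ints_cases)
    thus ?thesis by (simp add: m_def)
  qed
  \<comment> \<open>otherwise replacing \<open>b i\<close> would give a basis of integers with \<open>m\<close> smaller by the factor \<open>t\<^sup>2 < 1\<close>\<close>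
  have coords: "q i \<in> \<int>" if x: "algebraic_int (\<Sum>k<?d. of_rat (q k) * b k)" and i: "i < ?d" for q i
  proof (rule ccontr)
    assume qi: "q i \<notin> \<int>"
    define t where "t = q i - of_int \<lfloor>q i\<rfloor>"
    have t: "0 < t" "t < 1"
      using qi frac_gt_0_iff[of "q i"] frac_lt_1[of "q i"] by (simp_all add: t_def frac_def)
    define q' where "q' = q(i := t)"
    define y where "y = (\<Sum>k<?d. of_rat (q k) * b k) - of_int \<lfloor>q i\<rfloor> * b i"
    have y: "y = (\<Sum>k<?d. of_rat (q' k) * b k)"
    proof -
      have "(\<Sum>k<?d. of_rat (q' k) * b k) = (\<Sum>k<?d. of_rat (q k) * b k - (if k = i then of_int \<lfloor>q i\<rfloor> * b i else 0))"
        by (intro sum.cong) (auto simp: q'_def t_def of_rat_diff algebra_simps)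
      thus ?thesis using i by (simp add: sum_subtractf y_def)
    qed
    have yeq: "y = (\<Sum>k<?d. of_rat (q k) * b k) + of_int (- \<lfloor>q i\<rfloor>) * b i" by (simp add: y_def)
    have yint: "algebraic_int y"
      unfolding yeq
      by (rule algebraic_int_add_mult(1)[OF x algebraic_int_add_mult(2)[OF int_imp_algebraic_int int[OF i]]]) simp
    have gd: "gram_det ?d (b(i := y)) = t\<^sup>2 * gram_det ?d b"
      using gram_det_update[OF y i] by (simp add: q'_def)
    have gnz: "gram_det ?d b \<noteq> 0" using gram_det_nonzero_int(2)[OF ind int] .
    have "rat_indep ?d (b(i := y))"
      unfolding rat_indep_def
    proof (intro allI impI)
      fix c :: "nat \<Rightarrow> rat" and j
      assume c: "(\<Sum>k<?d. of_rat (c k) * (b(i := y)) k) = 0" and j: "j < ?d"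
      have "(\<Sum>k<?d. of_rat (c k) * (b(i := y)) k) = of_rat (c i) * y + (\<Sum>k\<in>{..<?d} - {i}. of_rat (c k) * b k)"
        using i by (subst sum.remove[of _ i]) auto
      also have "(\<Sum>k\<in>{..<?d} - {i}. of_rat (c k) * b k) = (\<Sum>k<?d. of_rat (if k = i then 0 else c k) * b k)"
        using i by (subst (2) sum.remove[of _ i]) auto
      also have "of_rat (c i) * y + \<dots> = (\<Sum>k<?d. of_rat (c i * q' k + (if k = i then 0 else c k)) * b k)"
        by (simp add: y of_rat_add of_rat_mult sum_distrib_left sum.distrib algebra_simps)
      finally have all0: "\<forall>k<?d. c i * q' k + (if k = i then 0 else c k) = 0"
        using ind[unfolded rat_indep_def, rule_format, of "\<lambda>k. c i * q' k + (if k = i then 0 else c k)"] c by simp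
      have ci: "c i = 0" using all0[rule_format, OF i] t by (simp add: q'_def)
      show "c j = 0" using all0[rule_format, OF j] ci by (cases "j = i") auto
    qed
    hence P': "P (b(i := y))" using int yint by (simp add: P_def)
    have "(of_nat (m (b(i := y))) :: rat) = t\<^sup>2 * of_nat (m b)"
      by (simp add: mval[OF P'] mval[OF b] gd abs_mult)
    moreover have "t\<^sup>2 < 1" using t by (simp add: power_less_one_iff abs_square_less_1)
    moreover have "(of_nat (m b) :: rat) > 0" using mval[OF b] gnz by simp
    ultimately have "(of_nat (m (b(i := y))) :: rat) < of_nat (m b)" by simp
    hence "m (b(i := y)) < m b" by (simp only: of_nat_less_iff)
    thus False using min[OF P'] by simp
  qed
  define \<omega> where "\<omega> = map b [0..<?d]"
  have "integral_basis \<omega>"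
    unfolding integral_basis_def
  proof (intro conjI equalityI subsetI allI impI)
    fix x assume "x \<in> {\<Sum>i<length \<omega>. of_int (c i) * \<omega> ! i |c. True}"
    then obtain c where c: "x = (\<Sum>i<?d. of_int (c i) * b i)" by (auto simp: \<omega>_def)
    have "algebraic_int x"
      unfolding c
      by (intro algebraic_int_sum algebraic_int_add_mult(2)[OF int_imp_algebraic_int int]) auto
    thus "x \<in> ring_of_integers" by (simp add: ring_of_integers_def)
  next
    fix x :: 'k assume "x \<in> ring_of_integers"
    hence x: "algebraic_int x" by (simp add: ring_of_integers_def)
    obtain q where q: "x = (\<Sum>k<?d. of_rat (q k) * b k)" using sp unfolding rat_spanning_def by blast
    have "\<forall>i\<in>{..<?d}. \<exists>z::int. q i = of_int z"
      using coords[OF x[unfolded q]] by (auto elim: Ints_cases)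
    then obtain z :: "nat \<Rightarrow> int" where z: "\<forall>i\<in>{..<?d}. q i = of_int (z i)" by metis
    have "x = (\<Sum>k<length \<omega>. of_int (z k) * \<omega> ! k)" using z by (simp add: q \<omega>_def)
    thus "x \<in> {\<Sum>i<length \<omega>. of_int (c i) * \<omega> ! i |c. True}" by blast
  next
    fix c :: "nat \<Rightarrow> int" and i
    assume c: "(\<Sum>i<length \<omega>. of_int (c i) * \<omega> ! i) = 0" and i: "i < length \<omega>"
    have "(\<Sum>i<?d. of_rat (of_int (c i)) * b i) = 0" using c by (simp add: \<omega>_def)
    hence "(of_int (c i) :: rat) = 0"
      using ind[unfolded rat_indep_def, rule_format, of "\<lambda>i. of_int (c i)"] i by (simp add: \<omega>_def)
    thus "c i = 0" by simp
  qed
  thus ?thesis by blast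
qed

text \<open>Relations over \<open>\<rat>\<close> become relations over \<open>\<int>\<close> after clearing denominators, and every element of \<open>K\<close>
  has an integer multiple that is an algebraic integer.\<close>
lemma integral_basis_rat_basis:
  fixes \<omega> :: "'k::number_field list"
  assumes \<omega>: "integral_basis \<omega>"
  shows "rat_indep (length \<omega>) (\<lambda>i. \<omega> ! i)" "length \<omega> = field_degree TYPE('k)"
proof -
  let ?n = "length \<omega>"
  show ind: "rat_indep ?n (\<lambda>i. \<omega> ! i)"
    unfolding rat_indep_def
  proof (intro allI impI)
    fix c :: "nat \<Rightarrow> rat" and i
    assume c: "(\<Sum>i<?n. of_rat (c i) * \<omega> ! i) = 0" and i: "i < ?n"
    have "\<exists>a b::int. c i = of_int a / of_int b \<and> b > 0" for i by (metis rat_eq_int_div)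
    then obtain a b :: "nat \<Rightarrow> int" where ab: "\<And>i. c i = of_int (a i) / of_int (b i)" "\<And>i. b i > 0" by metis
    define N where "N = (\<Prod>i<?n. b i)"
    define e where "e = (\<lambda>i. a i * (\<Prod>j\<in>{..<?n} - {i}. b j))"
    have N: "N > 0" unfolding N_def using ab(2) by (intro prod_pos) auto
    have e: "of_int N * of_rat (c i) = (of_int (e i) :: 'k)" if "i < ?n" for i
    proof -
      have "N = b i * (\<Prod>j\<in>{..<?n} - {i}. b j)" unfolding N_def using that by (subst prod.remove[of _ i]) auto
      hence "of_int N * c i = of_int (e i)" using ab(2)[of i] by (simp add: ab(1) e_def)
      hence "(of_rat (of_int N * c i) :: 'k) = of_rat (of_int (e i))" by simp
      thus ?thesis by (simp add: of_rat_mult)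
    qed
    have "(\<Sum>i<?n. of_int (e i) * \<omega> ! i) = of_int N * (\<Sum>i<?n. of_rat (c i) * \<omega> ! i)"
      unfolding sum_distrib_left by (intro sum.cong refl) (simp add: e[symmetric] mult.assoc)
    hence "(\<Sum>i<?n. of_int (e i) * \<omega> ! i) = 0" using c by simp
    hence "e i = 0" using \<omega> i unfolding integral_basis_def by blast
    hence "of_int N * of_rat (c i) = (0::'k)" using e[OF i] by simp
    thus "c i = 0" using N by simp
  qed
  have "rat_spanning ?n (\<lambda>i. \<omega> ! i)"
    unfolding rat_spanning_def
  proof
    fix x :: 'k
    have "algebraic x" using number_field_algebraic_rat_poly[of x] rat_eval_algebraic by blast
    then obtain N :: int where N: "N > 0" "algebraic_int (of_int N * x)"
      using algebraic_imp_scaled_algebraic_int by metis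
    hence "of_int N * x \<in> {\<Sum>i<?n. of_int (c i) * \<omega> ! i |c. True}"
      using \<omega> unfolding integral_basis_def ring_of_integers_def by simp
    then obtain c where c: "of_int N * x = (\<Sum>i<?n. of_int (c i) * \<omega> ! i)" by auto
    have "x = (\<Sum>i<?n. of_rat (of_int (c i) / of_int N) * \<omega> ! i)"
    proof -
      have "x = inverse (of_int N) * (of_int N * x)" using N(1) by simp
      also have "\<dots> = (\<Sum>i<?n. of_rat (of_int (c i) / of_int N) * \<omega> ! i)"
        unfolding c sum_distrib_left by (intro sum.cong refl) (simp add: of_rat_divide field_simps)
      finally show ?thesis .
    qed
    thus "\<exists>c. x = (\<Sum>i<?n. of_rat (c i) * \<omega> ! i)"
      by (rule exI[of _ "\<lambda>i. of_int (c i) / of_int N"])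
  qed
  thus "?n = field_degree TYPE('k)" by (rule rat_basis_card[OF ind])
qed

text \<open>The discriminant is the determinant of a matrix of integers and the square of a nonzero
  determinant.\<close>
theorem field_discriminant_ge_1: "\<bar>field_discriminant TYPE('k::number_field)\<bar> \<ge> 1"
proof -
  define \<omega> :: "'k list" where "\<omega> = (SOME \<omega>. integral_basis \<omega>)"
  have \<omega>: "integral_basis \<omega>" unfolding \<omega>_def using integral_basis_exists by (rule someI_ex)
  note len = integral_basis_rat_basis(2)[OF \<omega>]
  have ind: "rat_indep (field_degree TYPE('k)) (\<lambda>i. \<omega> ! i)" using integral_basis_rat_basis(1)[OF \<omega>] len by simp
  have "algebraic_int (\<omega> ! i)" if i: "i < length \<omega>" for i
  proof -
    have "(\<Sum>j<length \<omega>. of_int (if j = i then 1 else 0) * \<omega> ! j) = \<omega> ! i"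
      using i by (simp add: if_distrib[of of_int] if_distrib[of "\<lambda>t. t * _"] cong: if_cong)
    hence "\<omega> ! i \<in> {\<Sum>i<length \<omega>. of_int (c i) * \<omega> ! i |c. True}" by (intro CollectI exI conjI TrueI) (rule sym)
    hence "\<omega> ! i \<in> ring_of_integers"
      by (simp only: conjunct1[OF \<omega>[unfolded integral_basis_def]])
    thus ?thesis by (simp add: ring_of_integers_def)
  qed
  hence "gram_det (field_degree TYPE('k)) (\<lambda>i. \<omega> ! i) \<in> \<int>" "gram_det (field_degree TYPE('k)) (\<lambda>i. \<omega> ! i) \<noteq> 0"
    using gram_det_nonzero_int[OF ind] len by auto
  moreover have "field_discriminant TYPE('k) = gram_det (field_degree TYPE('k)) (\<lambda>i. \<omega> ! i)"
    by (simp add: field_discriminant_def gram_det_def Let_def \<omega>_def[symmetric] len)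
  ultimately show ?thesis by (metis Ints_nonzero_abs_ge1)
qed


section \<open>The product formula\<close>

definition arch_abs :: "rat \<Rightarrow> real" where "arch_abs q = real_of_rat \<bar>q\<bar>"

lemma places_eq:
  "(places :: ('k::number_field \<Rightarrow> real) set) = places_over arch_abs \<union> (\<Union>p\<in>{p. prime p}. places_over (padic_abs p))"
  by (auto simp: places_def places_over_def arch_abs_def)

text \<open>Products over the places above \<open>a\<close>, weighted by local degrees, are products over all embeddings,
  because a place is induced by as many embeddings as its local degree says.\<close>
lemma prod_over_places:
  fixes s :: "nat \<Rightarrow> 'k::number_field \<Rightarrow> 'l::field_char_0" and f :: "('k \<Rightarrow> real) \<Rightarrow> 'b::comm_monoid_mult"
  assumes w: "absolute_value w" and wa: "\<And>q. w (of_rat q) = a q" and q1: "a q1 > 1"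
    and emb: "\<And>i. i < field_degree TYPE('k) \<Longrightarrow> embedding (s i)"
    and inj: "inj_on s {..<field_degree TYPE('k)}"
  shows "(\<Prod>v\<in>places_over a. f v ^ local_degree v) = (\<Prod>i<field_degree TYPE('k). f (w \<circ> s i))"
proof -
  let ?d = "field_degree TYPE('k)"
  have im: "places_over a = (\<lambda>i. w \<circ> s i) ` {..<?d}"
    by (rule places_over_embeddings(1)[where ld = local_degree]) (fact w wa q1 emb inj local_degree_eq_card)+
  have ld: "local_degree v = card {i\<in>{..<?d}. w \<circ> s i = v}" if "v \<in> places_over a" for v
    by (rule places_over_embeddings(2)[where ld = local_degree and w = w and a = a])
       (fact w wa q1 emb inj local_degree_eq_card that)+
  have "(\<Prod>i<?d. f (w \<circ> s i)) = (\<Prod>v\<in>places_over a. \<Prod>i\<in>{i\<in>{..<?d}. w \<circ> s i = v}. f (w \<circ> s i))"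
    by (rule prod.group[symmetric]) (auto simp: im)
  also have "\<dots> = (\<Prod>v\<in>places_over a. f v ^ local_degree v)"
    by (intro prod.cong refl) (simp add: ld)
  finally show ?thesis by simp
qed

lemma places_over_image:
  fixes s :: "nat \<Rightarrow> 'k::number_field \<Rightarrow> 'l::field_char_0"
  assumes w: "absolute_value w" and wa: "\<And>q. w (of_rat q) = a q" and q1: "a q1 > 1"
    and emb: "\<And>i. i < field_degree TYPE('k) \<Longrightarrow> embedding (s i)"
    and inj: "inj_on s {..<field_degree TYPE('k)}"
  shows "places_over a = (\<lambda>i. w \<circ> s i) ` {..<field_degree TYPE('k)}"
  by (rule places_over_embeddings(1)[where ld = local_degree]) (fact w wa q1 emb inj local_degree_eq_card)+

lemma cmod_absolute_value: "absolute_value cmod"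
  by (auto simp: absolute_value_def norm_mult norm_triangle_ineq)

lemma cmod_of_rat: "cmod (of_rat q) = arch_abs q"
proof -
  have "(of_rat q :: complex) = of_real (of_rat q)"
  proof -
    obtain a b where "q = of_int a / of_int b" "b > 0" by (rule rat_eq_int_div)
    thus ?thesis by (simp add: of_rat_divide)
  qed
  thus ?thesis by (simp add: arch_abs_def abs_of_rat)
qed

lemma arch_abs_gt_1: "arch_abs 2 > 1" by (simp add: arch_abs_def)

lemma padic_abs_gt_1: assumes "prime p" shows "padic_abs p (of_nat p powi (-1)) > 1"
  using padic_abs_prime_power[OF assms, of "-1"] prime_gt_1_nat[OF assms] by simp

lemma sum_arch_local_degrees:
  "finite (places_over arch_abs :: ('k::number_field \<Rightarrow> real) set)"
  "(\<Sum>v\<in>(places_over arch_abs :: ('k \<Rightarrow> real) set). local_degree v) = field_degree TYPE('k)"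
proof -
  obtain s :: "nat \<Rightarrow> 'k \<Rightarrow> complex"
    where s: "\<And>i. i < field_degree TYPE('k) \<Longrightarrow> embedding (s i)" "inj_on s {..<field_degree TYPE('k)}"
    using complex_embeddings_exist by blast
  have im: "(places_over arch_abs :: ('k \<Rightarrow> real) set) = (\<lambda>i. cmod \<circ> s i) ` {..<field_degree TYPE('k)}"
    by (rule places_over_image[where ?q1.0 = 2]) (fact cmod_absolute_value cmod_of_rat arch_abs_gt_1 s)+
  thus "finite (places_over arch_abs :: ('k \<Rightarrow> real) set)" by simp
  \<comment> \<open>a sum of local degrees is read off from a product of powers of \<open>2\<close>\<close>
  have "(\<Prod>v\<in>(places_over arch_abs :: ('k \<Rightarrow> real) set). 2 ^ local_degree v) = (\<Prod>i<field_degree TYPE('k). (2::nat))"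
    by (rule prod_over_places[where w = cmod and ?q1.0 = 2 and s = s]) (fact cmod_absolute_value cmod_of_rat arch_abs_gt_1 s)+
  hence "(2::nat) ^ (\<Sum>v\<in>(places_over arch_abs :: ('k \<Rightarrow> real) set). local_degree v) = 2 ^ field_degree TYPE('k)"
    by (simp add: power_sum)
  thus "(\<Sum>v\<in>(places_over arch_abs :: ('k \<Rightarrow> real) set). local_degree v) = field_degree TYPE('k)"
    by simp
qed

lemma arch_place_embedding:
  fixes v :: "'k::number_field \<Rightarrow> real"
  assumes "v \<in> places_over arch_abs"
  obtains s :: "'k \<Rightarrow> complex" where "embedding s" "v = cmod \<circ> s"
proof -
  obtain s :: "nat \<Rightarrow> 'k \<Rightarrow> complex"
    where s: "\<And>i. i < field_degree TYPE('k) \<Longrightarrow> embedding (s i)" "inj_on s {..<field_degree TYPE('k)}"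
    using complex_embeddings_exist by blast
  have im: "(places_over arch_abs :: ('k \<Rightarrow> real) set) = (\<lambda>i. cmod \<circ> s i) ` {..<field_degree TYPE('k)}"
    by (rule places_over_image[where ?q1.0 = 2]) (fact cmod_absolute_value cmod_of_rat arch_abs_gt_1 s)+
  then obtain i where "i < field_degree TYPE('k)" "v = cmod \<circ> s i" using assms by auto
  thus ?thesis using that s(1) by blast
qed

lemma algebraic_number_embeddings_exist:
  obtains s :: "nat \<Rightarrow> 'k::number_field \<Rightarrow> complex" and t :: "nat \<Rightarrow> 'k \<Rightarrow> algebraic_number"
  where "\<And>i. i < field_degree TYPE('k) \<Longrightarrow> embedding (s i)" "inj_on s {..<field_degree TYPE('k)}"
    "\<And>i. i < field_degree TYPE('k) \<Longrightarrow> embedding (t i)" "inj_on t {..<field_degree TYPE('k)}"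
    "\<And>i x. i < field_degree TYPE('k) \<Longrightarrow> Rep_algebraic_number (t i x) = s i x"
proof -
  obtain s :: "nat \<Rightarrow> 'k \<Rightarrow> complex"
    where s: "\<And>i. i < field_degree TYPE('k) \<Longrightarrow> embedding (s i)" "inj_on s {..<field_degree TYPE('k)}"
    using complex_embeddings_exist by blast
  obtain t where t: "\<And>i. i < field_degree TYPE('k) \<Longrightarrow> embedding (t i)" "inj_on t {..<field_degree TYPE('k)}"
    "\<And>i x. i < field_degree TYPE('k) \<Longrightarrow> Rep_algebraic_number (t i x) = s i x"
    using algebraic_number_embeddings[of "field_degree TYPE('k)" s] s by blast
  show ?thesis using that[of s t] s t by blast
qed

text \<open>The ultrametric inequality is not part of the definition of a place. It is inherited from the
  extension \<open>w\<close>, as every place over \<open>p\<close> is \<open>w \<circ> t i\<close> for some embedding \<open>t i\<close>.\<close>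
lemma padic_places:
  fixes p :: nat
  assumes p: "prime p"
  shows "finite (places_over (padic_abs p) :: ('k::number_field \<Rightarrow> real) set)"
    and "v \<in> (places_over (padic_abs p) :: ('k \<Rightarrow> real) set) \<Longrightarrow> v (x + y) \<le> max (v x) (v y)"
proof -
  obtain w :: "algebraic_number \<Rightarrow> real"
    where w: "absolute_value w" "\<And>x y. w (x + y) \<le> max (w x) (w y)" "\<And>q. w (of_rat q) = padic_abs p q"
    using padic_extension_exists[OF p] by blast
  obtain s :: "nat \<Rightarrow> 'k \<Rightarrow> complex" and t where t: "\<And>i. i < field_degree TYPE('k) \<Longrightarrow> embedding (t i)" "inj_on t {..<field_degree TYPE('k)}"
    "\<And>i x. i < field_degree TYPE('k) \<Longrightarrow> Rep_algebraic_number (t i x) = s i x"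
    using algebraic_number_embeddings_exist[where 'k = 'k] by metis
  have im: "(places_over (padic_abs p) :: ('k \<Rightarrow> real) set) = (\<lambda>i. w \<circ> t i) ` {..<field_degree TYPE('k)}"
    by (rule places_over_image[where ?q1.0 = "of_nat p powi (-1)"]) (fact w t padic_abs_gt_1[OF p])+
  thus "finite (places_over (padic_abs p) :: ('k \<Rightarrow> real) set)" by simp
  assume "v \<in> (places_over (padic_abs p) :: ('k \<Rightarrow> real) set)"
  then obtain i where i: "i < field_degree TYPE('k)" "v = w \<circ> t i" using im by auto
  have "t i (x + y) = t i x + t i y" using t(1)[OF i(1)] by (simp add: embedding_def)
  thus "v (x + y) \<le> max (v x) (v y)" using w(2) i(2) by simp
qed

text \<open>The rational number \<open>q\<close> is the norm of \<open>x\<close>, that is, the product of its conjugates.\<close>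
lemma norm_local_factors:
  fixes x :: "'k::number_field"
  assumes x: "x \<noteq> 0"
  obtains q where "q \<noteq> 0" "(\<Prod>v\<in>places_over arch_abs. v x ^ local_degree v) = arch_abs q"
    "\<And>p. prime p \<Longrightarrow> (\<Prod>v\<in>places_over (padic_abs p). v x ^ local_degree v) = padic_abs p q"
proof -
  let ?d = "field_degree TYPE('k)"
  obtain s :: "nat \<Rightarrow> 'k \<Rightarrow> complex" and t where st:
    "\<And>i. i < ?d \<Longrightarrow> embedding (s i)" "inj_on s {..<?d}"
    "\<And>i. i < ?d \<Longrightarrow> embedding (t i)" "inj_on t {..<?d}"
    "\<And>i x. i < ?d \<Longrightarrow> Rep_algebraic_number (t i x) = s i x"
    using algebraic_number_embeddings_exist[where 'k = 'k] by metis
  have "\<exists>q. (\<Prod>i<?d. t i x) = of_rat q"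
    using conjugate_product_rational[of t x] st(3,4) by blast
  then obtain q where q: "(\<Prod>i<?d. t i x) = of_rat q" by blast
  have embR: "embedding Rep_algebraic_number"
    by (simp add: embedding_def plus_algebraic_number.rep_eq times_algebraic_number.rep_eq one_algebraic_number.rep_eq)
  interpret R: field_hom Rep_algebraic_number using embR by (rule embedding_field_hom)
  have "(\<Prod>i<?d. s i x) = Rep_algebraic_number (\<Prod>i<?d. t i x)"
    by (simp add: R.hom_prod st(5))
  hence qs: "(\<Prod>i<?d. s i x) = of_rat q" by (simp add: q embedding_of_rat[OF embR])
  have tnz: "t i x \<noteq> 0" if "i < ?d" for i
  proof -
    interpret field_hom "t i" using st(3)[OF that] by (rule embedding_field_hom)
    show ?thesis using x by simp
  qed
  have "of_rat q \<noteq> (0 :: algebraic_number)" unfolding q[symmetric] using tnz by simp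
  hence q0: "q \<noteq> 0" by auto
  have arch: "(\<Prod>v\<in>places_over arch_abs. v x ^ local_degree v) = arch_abs q"
  proof -
    have "(\<Prod>v\<in>places_over arch_abs. v x ^ local_degree v) = (\<Prod>i<?d. (cmod \<circ> s i) x)"
      by (rule prod_over_places[where w = cmod and ?q1.0 = 2 and s = s]) (fact cmod_absolute_value cmod_of_rat arch_abs_gt_1 st)+
    also have "\<dots> = cmod (\<Prod>i<?d. s i x)" by (simp add: prod_norm)
    finally show ?thesis by (simp add: qs cmod_of_rat)
  qed
  have "(\<Prod>v\<in>places_over (padic_abs p). v x ^ local_degree v) = padic_abs p q" if p: "prime p" for p
  proof -
    obtain w :: "algebraic_number \<Rightarrow> real"
      where w: "absolute_value w" "\<And>q. w (of_rat q) = padic_abs p q"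
      using padic_extension_exists[OF p] by metis
    have "(\<Prod>v\<in>places_over (padic_abs p). v x ^ local_degree v) = (\<Prod>i<?d. (w \<circ> t i) x)"
      by (rule prod_over_places[where w = w and ?q1.0 = "of_nat p powi (-1)" and s = t]) (fact w st padic_abs_gt_1[OF p])+
    also have "\<dots> = w (\<Prod>i<?d. t i x)" by (simp add: absolute_value_simps(10)[OF w(1)])
    finally show ?thesis by (simp add: q w(2))
  qed
  thus ?thesis using that q0 arch by blast
qed

text \<open>By unique factorization of the numerator and the denominator; the primes that \<open>P\<close> lacks divide both
  equally often.\<close>
lemma rational_product_formula:
  assumes q: "q \<noteq> 0" and fin: "finite P" and P: "\<And>p. p \<in> P \<Longrightarrow> prime p"
    and sup: "\<And>p. prime p \<Longrightarrow> p \<notin> P \<Longrightarrow> padic_abs p q = 1"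
  shows "arch_abs q * (\<Prod>p\<in>P. padic_abs p q) = 1"
proof -
  obtain a b where ab: "q = of_int a / of_int b" "b > 0" by (rule rat_eq_int_div)
  have nz: "a \<noteq> 0" "b \<noteq> 0" using ab q by auto
  define m where "m = (\<lambda>p z. multiplicity (int p) z)"
  define P' where "P' = P \<union> prime_factors (nat \<bar>a\<bar>) \<union> prime_factors (nat \<bar>b\<bar>)"
  have finP': "finite P'" using fin by (simp add: P'_def)
  have P': "prime p" if "p \<in> P'" for p using that P by (auto simp: P'_def)
  have int_prod: "real_of_int \<bar>z\<bar> = (\<Prod>p\<in>P'. real p ^ m p z)" if z: "z \<noteq> 0" "prime_factors (nat \<bar>z\<bar>) \<subseteq> P'" for z
  proof -
    have mm: "m p z = multiplicity p (nat \<bar>z\<bar>)" for p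
    proof -
      have "int p ^ n dvd z \<longleftrightarrow> p ^ n dvd nat \<bar>z\<bar>" for n
      proof -
        have "int p ^ n dvd z \<longleftrightarrow> int (p ^ n) dvd int (nat \<bar>z\<bar>)" by simp
        thus ?thesis by (simp only: of_nat_dvd_iff)
      qed
      thus ?thesis by (simp add: m_def multiplicity_def)
    qed
    have "nat \<bar>z\<bar> = (\<Prod>p\<in>prime_factors (nat \<bar>z\<bar>). p ^ multiplicity p (nat \<bar>z\<bar>))"
      using prime_factorization_nat[of "nat \<bar>z\<bar>"] z(1) by simp
    also have "\<dots> = (\<Prod>p\<in>P'. p ^ multiplicity p (nat \<bar>z\<bar>))"
      by (rule prod.mono_neutral_left[OF finP' z(2)])
         (auto simp: prime_factors_multiplicity dest: P')
    finally have "real (nat \<bar>z\<bar>) = (\<Prod>p\<in>P'. real p ^ m p z)"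
      by (metis (mono_tags, lifting) mm of_nat_prod of_nat_power prod.cong)
    thus ?thesis by simp
  qed
  have pa: "padic_abs p q = real p ^ m p b / real p ^ m p a" if "p \<in> P'" for p
    using padic_abs_of_int_div[OF P'[OF that] nz] prime_gt_0_nat[OF P'[OF that]]
    by (simp add: ab(1) m_def power_int_diff)
  have "(\<Prod>p\<in>P. padic_abs p q) = (\<Prod>p\<in>P'. padic_abs p q)"
    by (rule prod.mono_neutral_left[OF finP']) (auto simp: P'_def intro: sup)
  also have "\<dots> = (\<Prod>p\<in>P'. real p ^ m p b) / (\<Prod>p\<in>P'. real p ^ m p a)"
    by (simp add: pa prod_dividef)
  also have "\<dots> = real_of_int \<bar>b\<bar> / real_of_int \<bar>a\<bar>"
    by (subst (1 2) int_prod) (use nz in \<open>auto simp: P'_def\<close>)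
  finally have "(\<Prod>p\<in>P. padic_abs p q) = real_of_int \<bar>b\<bar> / real_of_int \<bar>a\<bar>" .
  moreover have "arch_abs q = real_of_int \<bar>a\<bar> / real_of_int \<bar>b\<bar>"
    using ab(2) by (simp add: arch_abs_def ab(1) abs_divide of_rat_divide flip: abs_of_rat)
  ultimately show ?thesis using nz by simp
qed

text \<open>Some integer multiple \<open>N x\<close> is an algebraic integer, so \<open>v x \<le> 1\<close> holds whenever \<open>p\<close> does not
  divide \<open>N\<close>.\<close>
lemma almost_all_places_le_1:
  fixes x :: "'k::number_field"
  obtains P where "finite P" "\<And>p v. prime p \<Longrightarrow> p \<notin> P \<Longrightarrow> v \<in> places_over (padic_abs p) \<Longrightarrow> v x \<le> 1"
proof -
  have "algebraic x" using number_field_algebraic_rat_poly[of x] rat_eval_algebraic by blast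
  then obtain N :: int where N: "N > 0" "algebraic_int (of_int N * x)"
    using algebraic_imp_scaled_algebraic_int by metis
  define P where "P = {p. prime p \<and> int p dvd N}"
  have "P \<subseteq> {..nat N}" using N(1) by (auto simp: P_def dest: zdvd_imp_le)
  hence fin: "finite P" using finite_subset by blast
  have "v x \<le> 1" if p: "prime p" "p \<notin> P" and v: "v \<in> places_over (padic_abs p)" for p and v :: "'k \<Rightarrow> real"
  proof -
    have av: "absolute_value v" and vq: "\<And>q. v (of_rat q) = padic_abs p q" using v by (auto simp: places_over_def)
    note D = absolute_valueD[OF av] absolute_value_simps[OF av]
    note ultra = padic_places(2)[OF p(1) v]
    have vint: "v (of_int z) \<le> 1" for z
    proof (cases "z = 0")
      case False
      have "v (of_int z) = padic_abs p (of_int z / of_int 1)" using vq[of "of_int z"] by simp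
      also have "\<dots> = real p powi (- int (multiplicity (int p) z))"
        using padic_abs_of_int_div[OF p(1) False, of 1] by simp
      also have "\<dots> \<le> 1" using prime_gt_1_nat[OF p(1)]
        by (simp add: power_int_minus field_simps)
      finally show ?thesis .
    qed (simp add: D)
    have yle: "v y \<le> 1" if y: "algebraic_int y" for y
    proof (rule ccontr)
      assume "\<not> v y \<le> 1"
      hence gt: "v y > 1" by simp
      obtain n c where n: "n > 0" "y ^ n = (\<Sum>i<n. of_int (c i) * y ^ i)"
        using algebraic_int_stableE[OF y] .
      have "v (y ^ n) \<le> v y ^ (n - 1)"
        unfolding n(2)
      proof (rule ultrametric_sum_le[OF av ultra])
        fix i assume i: "i \<in> {..<n}"
        have "v (of_int (c i) * y ^ i) \<le> 1 * v y ^ (n - 1)"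
          unfolding D using vint gt i by (intro mult_mono power_increasing) (auto simp: D(1))
        thus "v (of_int (c i) * y ^ i) \<le> v y ^ (n - 1)" by simp
      qed (use gt in simp)
      moreover have "v (y ^ n) = v y ^ (n - 1) * v y" using n(1) by (cases n) (simp_all add: D)
      moreover have "v y ^ (n - 1) > 0" using gt by simp
      ultimately show False using gt by simp
    qed
    have "v (of_int N) = 1"
    proof -
      have nd: "\<not> int p dvd N" using p by (simp add: P_def)
      have "v (of_int N) = padic_abs p (of_int N / of_int 1)" using vq[of "of_int N"] by simp
      also have "\<dots> = 1"
        using padic_abs_of_int_div[OF p(1), of N 1] N(1) nd by (simp add: not_dvd_imp_multiplicity_0)
      finally show ?thesis .
    qed
    hence "v (of_int N * x) = v x" by (simp add: D(3))
    thus ?thesis using yle[OF N(2)] by simp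
  qed
  thus ?thesis using that fin by blast
qed

text \<open>Heights are products over all places with a factor different from \<open>1\<close>. To compare the heights of different
  vectors, all of them are written as products over the same finite set: the archimedean places
  and those over a sufficiently large finite set \<open>P\<close> of primes.\<close>
definition places_upto :: "nat set \<Rightarrow> ('k::number_field \<Rightarrow> real) set" where
  "places_upto P = places_over arch_abs \<union> (\<Union>p\<in>P. places_over (padic_abs p))"

lemma places_over_disjoint: "a \<noteq> a' \<Longrightarrow> places_over a \<inter> places_over a' = {}"
  by (auto simp: places_over_def)

lemma padic_abs_inj: "prime p \<Longrightarrow> prime q \<Longrightarrow> padic_abs p = padic_abs q \<Longrightarrow> p = q"
proof (rule ccontr)
  assume pq: "prime p" "prime q" "padic_abs p = padic_abs q" "p \<noteq> q"
  have "\<not> int q dvd int p" using pq primes_dvd_imp_eq[OF pq(2,1)] by auto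
  hence "padic_abs q (of_nat p) = 1"
    using padic_abs_of_int_div[OF pq(2), of "int p" 1] prime_gt_0_nat[OF pq(1)]
    by (simp add: not_dvd_imp_multiplicity_0)
  moreover have "padic_abs p (of_nat p) = inverse (real p)"
    using padic_abs_prime_power[OF pq(1), of 1] by (simp add: power_int_minus)
  ultimately show False using pq(3) prime_gt_1_nat[OF pq(1)] by (simp add: inverse_eq_divide field_simps)
qed

lemma padic_abs_ne_arch: "prime p \<Longrightarrow> padic_abs p \<noteq> arch_abs"
proof
  assume p: "prime p" "padic_abs p = arch_abs"
  have "padic_abs p (of_nat p) = inverse (real p)"
    using padic_abs_prime_power[OF p(1), of 1] by (simp add: power_int_minus)
  moreover have "arch_abs (of_nat p) = real p" by (simp add: arch_abs_def)
  moreover have "inverse (real p) < real p"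
    using prime_gt_1_nat[OF p(1)] by (simp add: inverse_eq_divide field_simps) (simp add: less_1_mult)
  ultimately show False using p(2) by simp
qed

lemma prod_places_upto:
  fixes f :: "('k::number_field \<Rightarrow> real) \<Rightarrow> real"
  assumes fin: "finite P" and P: "\<And>p. p \<in> P \<Longrightarrow> prime p"
  shows "(\<Prod>v\<in>places_upto P. f v) = (\<Prod>v\<in>places_over arch_abs. f v) * (\<Prod>p\<in>P. \<Prod>v\<in>places_over (padic_abs p). f v)"
    and "finite (places_upto P :: ('k \<Rightarrow> real) set)"
proof -
  have finp: "finite (places_over (padic_abs p) :: ('k \<Rightarrow> real) set)" if "p \<in> P" for p
    using padic_places(1)[OF P[OF that]] .
  have fina: "finite (places_over arch_abs :: ('k \<Rightarrow> real) set)" by (rule sum_arch_local_degrees(1))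
  show "finite (places_upto P :: ('k \<Rightarrow> real) set)"
    using fin finp fina by (simp add: places_upto_def)
  have "places_over arch_abs \<inter> (\<Union>p\<in>P. places_over (padic_abs p)) = ({} :: ('k \<Rightarrow> real) set)"
  proof -
    have "places_over arch_abs \<inter> places_over (padic_abs p) = ({} :: ('k \<Rightarrow> real) set)" if "p \<in> P" for p
      using places_over_disjoint padic_abs_ne_arch[OF P[OF that]] by metis
    thus ?thesis by blast
  qed
  hence "(\<Prod>v\<in>places_upto P. f v) = (\<Prod>v\<in>places_over arch_abs. f v) * (\<Prod>v\<in>(\<Union>p\<in>P. places_over (padic_abs p)). f v)"
    unfolding places_upto_def using fin finp fina by (intro prod.union_disjoint) auto
  also have "(\<Prod>v\<in>(\<Union>p\<in>P. places_over (padic_abs p)). f v) = (\<Prod>p\<in>P. \<Prod>v\<in>places_over (padic_abs p). f v)"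
  proof (rule prod.UNION_disjoint[OF fin])
    show "\<forall>p\<in>P. finite (places_over (padic_abs p) :: ('k \<Rightarrow> real) set)" using finp by blast
    show "\<forall>p\<in>P. \<forall>q\<in>P. p \<noteq> q \<longrightarrow> places_over (padic_abs p) \<inter> places_over (padic_abs q) = ({} :: ('k \<Rightarrow> real) set)"
      using places_over_disjoint padic_abs_inj P by metis
  qed
  finally show "(\<Prod>v\<in>places_upto P. f v) = (\<Prod>v\<in>places_over arch_abs. f v) * (\<Prod>p\<in>P. \<Prod>v\<in>places_over (padic_abs p). f v)" .
qed

definition good_primes :: "nat set \<Rightarrow> 'k::number_field \<Rightarrow> bool" where
  "good_primes P x \<longleftrightarrow> (\<forall>p v. prime p \<longrightarrow> p \<notin> P \<longrightarrow> v \<in> places_over (padic_abs p) \<longrightarrow> v x = 1)"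

text \<open>Both \<open>x\<close> and its inverse have value at most \<open>1\<close> at almost all places.\<close>
lemma good_primes_exist:
  fixes x :: "'k::number_field"
  assumes x: "x \<noteq> 0"
  obtains P where "finite P" "good_primes P x"
proof -
  obtain P1 where P1: "finite P1" "\<And>p v. prime p \<Longrightarrow> p \<notin> P1 \<Longrightarrow> v \<in> places_over (padic_abs p) \<Longrightarrow> v x \<le> 1"
    using almost_all_places_le_1[of x] by blast
  obtain P2 where P2: "finite P2" "\<And>p v. prime p \<Longrightarrow> p \<notin> P2 \<Longrightarrow> v \<in> places_over (padic_abs p) \<Longrightarrow> v (inverse x) \<le> 1"
    using almost_all_places_le_1[of "inverse x"] by blast
  have "good_primes (P1 \<union> P2) x"
    unfolding good_primes_def
  proof (intro allI impI)
    fix p and v :: "'k \<Rightarrow> real"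
    assume p: "prime p" "p \<notin> P1 \<union> P2" and v: "v \<in> places_over (padic_abs p)"
    have av: "absolute_value v" using v by (simp add: places_over_def)
    have "v x \<le> 1" using P1(2)[OF p(1) _ v] p(2) by simp
    moreover have "inverse (v x) \<le> 1" using P2(2)[OF p(1) _ v] p(2) absolute_value_simps(5)[OF av] by simp
    moreover have "v x > 0" using x absolute_value_simps(11)[OF av] by simp
    ultimately show "v x = 1" by (simp add: inverse_eq_divide divide_le_eq)
  qed
  thus ?thesis using that[of "P1 \<union> P2"] P1(1) P2(1) by blast
qed

theorem product_formula:
  fixes x :: "'k::number_field"
  assumes x: "x \<noteq> 0" and fin: "finite P" and P: "\<And>p. p \<in> P \<Longrightarrow> prime p" and good: "good_primes P x"
  shows "(\<Prod>v\<in>places_upto P. v x ^ local_degree v) = 1"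
proof -
  obtain q where q: "q \<noteq> 0" "(\<Prod>v\<in>places_over arch_abs. v x ^ local_degree v) = arch_abs q"
    "\<And>p. prime p \<Longrightarrow> (\<Prod>v\<in>places_over (padic_abs p). v x ^ local_degree v) = padic_abs p q"
    using norm_local_factors[OF x] by blast
  have "(\<Prod>v\<in>places_upto P. v x ^ local_degree v) = arch_abs q * (\<Prod>p\<in>P. padic_abs p q)"
    by (simp add: prod_places_upto[OF fin P] q P)
  also have "\<dots> = 1"
  proof (rule rational_product_formula[OF q(1) fin P])
    fix p assume p: "prime p" "p \<notin> P"
    have "(\<Prod>v\<in>(places_over (padic_abs p) :: ('k \<Rightarrow> real) set). v x ^ local_degree v) = 1"
    proof (intro prod.neutral ballI)
      fix v :: "'k \<Rightarrow> real" assume v: "v \<in> places_over (padic_abs p)"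
      have "v x = 1" using good[unfolded good_primes_def, rule_format, OF p v] .
      thus "v x ^ local_degree v = 1" by simp
    qed
    thus "padic_abs p q = 1" using q(3)[OF p(1)] by simp
  qed
  finally show ?thesis .
qed


section \<open>Bounds for determinants and cofactors\<close>

(* In the remaining part, matrices are those of type ('k ^ 'n) ^ 'n. *)
hide_const (open) Determinant.det Matrix.mat Matrix.row List.transpose
no_notation vec_index (infixl \<open>$\<close> 100)
no_notation fps_nth (infixl \<open>$\<close> 75)

definition herm :: "complex ^ 'n \<Rightarrow> complex ^ 'n \<Rightarrow> complex" where
  "herm x y = (\<Sum>k\<in>UNIV. x $ k * cnj (y $ k))"

lemma herm_add_left: "herm (x + y) z = herm x z + herm y z"
  and herm_diff_left: "herm (x - y) z = herm x z - herm y z"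
  and herm_add_right: "herm x (y + z) = herm x y + herm x z"
  and herm_scale_left: "herm (c *s x) z = c * herm x z"
  and herm_cnj: "herm x y = cnj (herm y x)"
  by (simp_all add: herm_def algebra_simps sum.distrib sum_subtractf sum_distrib_left)

lemma herm_sum_left: "herm (\<Sum>i\<in>I. f i) z = (\<Sum>i\<in>I. herm (f i) z)"
  by (simp add: herm_def sum_distrib_right) (rule sum.swap)

lemma herm_self: "herm x x = of_real (\<Sum>k\<in>UNIV. (cmod (x $ k))\<^sup>2)"
  unfolding herm_def of_real_sum by (intro sum.cong refl) (rule complex_norm_square[symmetric])

lemma herm_self_eq_0: "herm x x = 0 \<Longrightarrow> x = 0"
  unfolding herm_self of_real_eq_0_iff
  by (simp add: sum_nonneg_eq_0_iff Finite_Cartesian_Product.vec_eq_iff)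

text \<open>A Gram-Schmidt step subtracts from row \<open>i\<close> its projection \<open>p\<close> to the rows in \<open>J\<close>. This changes neither
  the determinant nor the orthogonality of the other rows, and it does not increase the norm of row \<open>i\<close>.\<close>
lemma orthogonalize_rows:
  fixes A :: "complex ^ 'n ^ 'n"
  assumes "finite J"
  shows "\<exists>A'::complex^'n^'n. det A' = det A \<and>
    (\<forall>i. Re (herm (A' $ i) (A' $ i)) \<le> Re (herm (A $ i) (A $ i))) \<and>
    (\<forall>i\<in>J. \<forall>j\<in>J. i \<noteq> j \<longrightarrow> herm (A' $ i) (A' $ j) = 0)"
  using assms
proof (induction J rule: finite_induct)
  case (insert i J)
  then obtain A' :: "complex ^ 'n ^ 'n" where A': "det A' = det A"
    "\<And>i. Re (herm (A' $ i) (A' $ i)) \<le> Re (herm (A $ i) (A $ i))"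
    "\<And>i j. i \<in> J \<Longrightarrow> j \<in> J \<Longrightarrow> i \<noteq> j \<Longrightarrow> herm (A' $ i) (A' $ j) = 0"
    by blast
  define c where "c = (\<lambda>j. herm (A' $ i) (A' $ j) / herm (A' $ j) (A' $ j))"
  define p where "p = (\<Sum>j\<in>J. c j *s A' $ j)"
  define r where "r = A' $ i - p"
  define A'' :: "complex ^ 'n ^ 'n" where "A'' = (\<chi> k. if k = i then r else A' $ k)"
  have A''i: "A'' $ i = r" and A''k: "\<And>k. k \<noteq> i \<Longrightarrow> A'' $ k = A' $ k"
    by (simp_all add: A''_def)
  have orth: "herm r (A' $ j) = 0" if j: "j \<in> J" for j
  proof -
    have "herm p (A' $ j) = (\<Sum>l\<in>J. c l * herm (A' $ l) (A' $ j))"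
      by (simp add: p_def herm_sum_left herm_scale_left)
    also have "\<dots> = (\<Sum>l\<in>J. if l = j then c j * herm (A' $ j) (A' $ j) else 0)"
      using A'(3) j by (intro sum.cong) auto
    also have "\<dots> = c j * herm (A' $ j) (A' $ j)" using j insert.hyps by simp
    also have "\<dots> = herm (A' $ i) (A' $ j)"
    proof (cases "herm (A' $ j) (A' $ j) = 0")
      case True
      hence "A' $ j = 0" by (rule herm_self_eq_0)
      thus ?thesis by (simp add: herm_def)
    qed (simp add: c_def)
    finally show ?thesis by (simp add: r_def herm_diff_left)
  qed
  have orth': "herm (A' $ j) r = 0" if j: "j \<in> J" for j
    using orth[OF j] herm_cnj[of "A' $ j" r] by simp
  have "herm p r = 0" by (simp add: p_def herm_sum_left herm_scale_left orth')
  hence pr: "herm p r = 0" "herm r p = 0" using herm_cnj[of r p] by simp_all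
  have "det A'' = det A'"
  proof -
    have "- p \<in> vec.span {row j A' |j. j \<noteq> i}"
      unfolding p_def
    proof (intro vec.span_neg vec.span_sum vec.span_scale vec.span_base)
      fix j assume "j \<in> J"
      hence "j \<noteq> i" using insert.hyps by auto
      thus "A' $ j \<in> {row j A' |j. j \<noteq> i}"
        by (auto simp: Finite_Cartesian_Product.row_def Finite_Cartesian_Product.vec_eq_iff intro!: exI[of _ j])
    qed
    hence "det (\<chi> k. if k = i then row i A' + - p else row k A') = det A'"
      by (rule det_row_span)
    moreover have "(\<chi> k. if k = i then row i A' + - p else row k A') = A''"
      by (simp add: A''_def r_def Finite_Cartesian_Product.row_def Finite_Cartesian_Product.vec_eq_iff)
    ultimately show ?thesis by simp
  qed
  moreover have "Re (herm (A'' $ k) (A'' $ k)) \<le> Re (herm (A $ k) (A $ k))" for k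
  proof (cases "k = i")
    case True
    have "A' $ i = r + p" by (simp add: r_def)
    hence "herm (A' $ i) (A' $ i) = herm r r + herm p p"
      by (simp add: herm_add_left herm_add_right pr)
    moreover have "Re (herm p p) \<ge> 0" by (simp add: herm_self sum_nonneg)
    ultimately have "Re (herm r r) \<le> Re (herm (A' $ i) (A' $ i))" by simp
    thus ?thesis using A'(2)[of i] True A''i by simp
  next
    case False
    thus ?thesis using A'(2)[of k] by (simp add: A''k)
  qed
  moreover have "herm (A'' $ k) (A'' $ l) = 0" if kl: "k \<in> insert i J" "l \<in> insert i J" "k \<noteq> l" for k l
  proof -
    consider "k = i" "l \<in> J" "l \<noteq> i" | "l = i" "k \<in> J" "k \<noteq> i" | "k \<in> J" "l \<in> J" "k \<noteq> i" "l \<noteq> i"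
      using kl by auto
    thus ?thesis
    proof cases
      case 1 thus ?thesis using orth by (simp add: A''i A''k)
    next
      case 2 thus ?thesis using orth' by (simp add: A''i A''k)
    next
      case 3 thus ?thesis using A'(3) kl(3) by (simp add: A''k)
    qed
  qed
  ultimately show ?case using A'(1) by (intro exI[of _ A'']) auto
qed (intro exI[of _ A], simp)

text \<open>For orthogonal rows, \<open>B\<close> times its conjugate transpose is a diagonal matrix.\<close>
theorem Hadamard_inequality:
  fixes A :: "complex ^ 'n ^ 'n"
  shows "(cmod (det A))\<^sup>2 \<le> (\<Prod>i\<in>UNIV. \<Sum>j\<in>UNIV. (cmod (A $ i $ j))\<^sup>2)"
proof -
  obtain B :: "complex ^ 'n ^ 'n" where B: "det B = det A"
    "\<And>i. Re (herm (B $ i) (B $ i)) \<le> Re (herm (A $ i) (A $ i))"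
    "\<And>i j. i \<noteq> j \<Longrightarrow> herm (B $ i) (B $ j) = 0"
    using orthogonalize_rows[of UNIV A] by auto
  define C :: "complex ^ 'n ^ 'n" where "C = (\<chi> i j. cnj (B $ i $ j))"
  have detC: "det C = cnj (det B)"
    by (simp add: Determinants.det_def C_def)
  have ent: "(B ** transpose C) $ i $ j = herm (B $ i) (B $ j)" for i j
    by (simp add: matrix_matrix_mult_def Finite_Cartesian_Product.transpose_def C_def herm_def)
  have "of_real ((cmod (det B))\<^sup>2) = det B * det C"
    unfolding detC by (rule complex_norm_square)
  also have "\<dots> = det (B ** transpose C)"
    by (simp add: Determinants.det_mul Determinants.det_transpose)
  also have "\<dots> = (\<Prod>i\<in>UNIV. herm (B $ i) (B $ i))"
    by (subst det_diagonal) (simp_all add: ent B(3))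
  also have "\<dots> = of_real (\<Prod>i\<in>UNIV. Re (herm (B $ i) (B $ i)))"
    by (simp add: herm_self)
  finally have "(cmod (det B))\<^sup>2 = (\<Prod>i\<in>UNIV. Re (herm (B $ i) (B $ i)))"
    by (simp only: of_real_eq_iff)
  also have "\<dots> \<le> (\<Prod>i\<in>UNIV. Re (herm (A $ i) (A $ i)))"
    by (intro prod_mono conjI B(2)) (simp add: herm_self sum_nonneg)
  finally show ?thesis by (simp add: B(1) herm_self)
qed

lemma embedding_det:
  fixes A :: "'k::field ^ 'n ^ 'n" and s :: "'k \<Rightarrow> 'l::field"
  assumes "embedding s"
  shows "s (det A) = det (\<chi> i j. s (A $ i $ j))"
proof -
  interpret field_hom s using assms by (rule embedding_field_hom)
  show ?thesis by (simp add: Determinants.det_def hom_sum hom_mult hom_prod hom_of_int)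
qed

text \<open>The Leibniz formula has \<open>n! \<le> n ^ n\<close> terms.\<close>
lemma det_bound_triangle:
  fixes A :: "'k::field ^ 'n ^ 'n"
  assumes v: "absolute_value v" and a: "\<And>i j. v (A $ i $ j) \<le> a"
  shows "v (det A) \<le> real (CARD('n) ^ CARD('n)) * a ^ CARD('n)"
proof -
  note D = absolute_valueD[OF v] absolute_value_simps[OF v]
  have a0: "a \<ge> 0" using a[of undefined undefined] D(1) order_trans by blast
  have sgn: "v (of_int (sign p)) = 1" for p :: "'n \<Rightarrow> 'n"
    by (cases "evenperm p") (simp_all add: sign_def D)
  have "v (det A) \<le> (\<Sum>p | p permutes (UNIV::'n set). v (of_int (sign p) * (\<Prod>i\<in>UNIV. A $ i $ p i)))"
    unfolding Determinants.det_def by (rule D)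
  also have "\<dots> \<le> (\<Sum>p | p permutes (UNIV::'n set). a ^ CARD('n))"
  proof (rule sum_mono)
    fix p :: "'n \<Rightarrow> 'n"
    have "(\<Prod>i\<in>UNIV. v (A $ i $ p i)) \<le> (\<Prod>i\<in>(UNIV::'n set). a)"
      by (intro prod_mono) (simp add: D(1) a)
    thus "v (of_int (sign p) * (\<Prod>i\<in>UNIV. A $ i $ p i)) \<le> a ^ CARD('n)"
      by (simp add: D sgn)
  qed
  also have "\<dots> = real (fact CARD('n)) * a ^ CARD('n)"
    by (simp add: card_permutations[of UNIV "CARD('n)"])
  also have "\<dots> \<le> real (CARD('n) ^ CARD('n)) * a ^ CARD('n)"
  proof (rule mult_right_mono)
    have "(fact CARD('n) :: nat) \<le> CARD('n) ^ CARD('n)"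
      using fact_le_power[of "CARD('n)", where 'a = nat] by simp
    thus "real (fact CARD('n)) \<le> real (CARD('n) ^ CARD('n))" by (rule of_nat_mono)
  qed (use a0 in simp)
  finally show ?thesis .
qed

lemma det_bound_ultrametric:
  fixes A :: "'k::field ^ 'n ^ 'n"
  assumes v: "absolute_value v" and um: "\<And>x y. v (x + y) \<le> max (v x) (v y)"
    and a: "\<And>i j. v (A $ i $ j) \<le> a i"
  shows "v (det A) \<le> (\<Prod>i\<in>UNIV. a i)"
proof -
  note D = absolute_valueD[OF v] absolute_value_simps[OF v]
  have a0: "a i \<ge> 0" for i using a[of i undefined] D(1) order_trans by blast
  have sgn: "v (of_int (sign p)) = 1" for p :: "'n \<Rightarrow> 'n"
    by (cases "evenperm p") (simp_all add: sign_def D)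
  show ?thesis
    unfolding Determinants.det_def
  proof (rule ultrametric_sum_le[OF v um])
    fix p :: "'n \<Rightarrow> 'n"
    show "v (of_int (sign p) * (\<Prod>i\<in>UNIV. A $ i $ p i)) \<le> (\<Prod>i\<in>UNIV. a i)"
      by (simp add: D sgn) (intro prod_mono, simp add: D(1) a)
  qed (simp add: a0 prod_nonneg)
qed

text \<open>The cofactor is written as a determinant of full size: in the transpose of \<open>A\<close>, row \<open>i\<close> is replaced
  by the \<open>j\<close>-th unit vector. Bounds for determinants in terms of their rows apply to it directly.\<close>
definition cofactor_matrix :: "'k::field ^ 'n ^ 'n \<Rightarrow> 'n \<Rightarrow> 'n \<Rightarrow> 'k ^ 'n ^ 'n" where
  "cofactor_matrix A i j = (\<chi> l k. if l = i then (if k = j then 1 else 0) else A $ k $ l)"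

text \<open>Cramer's rule for the column \<open>j\<close> of the inverse matrix.\<close>
lemma matrix_inv_entry:
  fixes A :: "'k::field ^ 'n ^ 'n"
  assumes A: "invertible A"
  shows "matrix_inv A $ i $ j = det (cofactor_matrix A i j) / det A"
    and "det A \<noteq> 0"
proof -
  show nz: "det A \<noteq> 0" using A by (simp add: invertible_det_nz)
  define e :: "'k ^ 'n" where "e = axis j 1"
  have "A *v (matrix_inv A *v e) = e"
  proof -
    have "A ** matrix_inv A = mat 1 \<and> matrix_inv A ** A = mat 1"
      unfolding matrix_inv_def by (rule someI_ex) (use A in \<open>simp add: invertible_def\<close>)
    thus ?thesis by (simp add: matrix_vector_mul_assoc)
  qed
  hence "matrix_inv A *v e = (\<chi> k. det (\<chi> i l. if l = k then e $ i else A $ i $ l) / det A)"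
    using cramer[OF nz] by blast
  hence "(matrix_inv A *v e) $ i = det (\<chi> k l. if l = i then e $ k else A $ k $ l) / det A"
    by simp
  moreover have "(matrix_inv A *v e) $ i = matrix_inv A $ i $ j"
    by (simp add: matrix_vector_mult_def e_def axis_def if_distrib[of "\<lambda>t. _ * t"] cong: if_cong)
  moreover have "(\<chi> k l. if l = i then e $ k else A $ k $ l) = transpose (cofactor_matrix A i j)"
    by (auto simp: Finite_Cartesian_Product.vec_eq_iff Finite_Cartesian_Product.transpose_def cofactor_matrix_def e_def axis_def)
  ultimately show "matrix_inv A $ i $ j = det (cofactor_matrix A i j) / det A"
    by (simp add: Determinants.det_transpose)
qed

lemma prod_all_but_one:
  fixes i :: "'n::finite" and c :: real
  shows "(\<Prod>l\<in>UNIV. if l = i then 1 else c) = c ^ (CARD('n) - 1)"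
proof -
  have "(\<Prod>l\<in>UNIV. if l = i then 1 else c) = (\<Prod>l\<in>UNIV - {i}. c)"
    by (subst prod.remove[of _ i]) auto
  thus ?thesis by (simp add: card_Diff_singleton)
qed

lemma cofactor_bound_ultrametric:
  fixes A :: "'k::field ^ 'n ^ 'n"
  assumes v: "absolute_value v" and um: "\<And>x y. v (x + y) \<le> max (v x) (v y)"
    and a: "\<And>i j. v (A $ i $ j) \<le> a"
  shows "v (det (cofactor_matrix A i j)) \<le> a ^ (CARD('n) - 1)"
proof -
  have "v (det (cofactor_matrix A i j)) \<le> (\<Prod>l\<in>UNIV. if l = i then 1 else a)"
    by (rule det_bound_ultrametric[OF v um]) (auto simp: cofactor_matrix_def a absolute_value_simps[OF v])
  thus ?thesis by (simp only: prod_all_but_one)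
qed

text \<open>In Hadamard's inequality the unit row of the cofactor matrix contributes the factor \<open>1\<close>, which leaves
  the exponent \<open>n - 1\<close>.\<close>
lemma cofactor_bound_arch:
  fixes A :: "'k::number_field ^ 'n ^ 'n"
  assumes v: "v \<in> places_over arch_abs" and a: "\<And>i j. v (A $ i $ j) \<le> a"
  shows "v (det (cofactor_matrix A i j)) \<le> (sqrt (real CARD('n)) * a) ^ (CARD('n) - 1)"
proof -
  obtain s :: "'k \<Rightarrow> complex" where s: "embedding s" "v = cmod \<circ> s" using arch_place_embedding[OF v] .
  interpret field_hom s using s(1) by (rule embedding_field_hom)
  have a0: "a \<ge> 0" using a[of undefined undefined] s(2) by (metis comp_apply norm_ge_zero order_trans)
  define M :: "complex ^ 'n ^ 'n" where "M = (\<chi> l k. s (cofactor_matrix A i j $ l $ k))"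
  have row: "(\<Sum>k\<in>UNIV. (cmod (M $ l $ k))\<^sup>2) \<le> (if l = i then 1 else real CARD('n) * a\<^sup>2)" for l
  proof (cases "l = i")
    case True
    have "(\<Sum>k\<in>UNIV. (cmod (M $ l $ k))\<^sup>2) = (\<Sum>k\<in>UNIV. if k = j then 1 else 0)"
      using True by (intro sum.cong) (auto simp: M_def cofactor_matrix_def)
    thus ?thesis using True by simp
  next
    case False
    have "(\<Sum>k\<in>UNIV. (cmod (M $ l $ k))\<^sup>2) \<le> (\<Sum>k\<in>(UNIV::'n set). a\<^sup>2)"
      using False a s(2) by (intro sum_mono power_mono) (auto simp: M_def cofactor_matrix_def)
    thus ?thesis using False by simp
  qed
  have "(cmod (det M))\<^sup>2 \<le> (\<Prod>l\<in>UNIV. \<Sum>k\<in>UNIV. (cmod (M $ l $ k))\<^sup>2)"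
    by (rule Hadamard_inequality)
  also have "\<dots> \<le> (\<Prod>l\<in>UNIV. if l = i then 1 else real CARD('n) * a\<^sup>2)"
    by (intro prod_mono conjI row) (simp add: sum_nonneg)
  also have "\<dots> = (real CARD('n) * a\<^sup>2) ^ (CARD('n) - 1)" by (rule prod_all_but_one)
  also have "\<dots> = ((sqrt (real CARD('n)) * a) ^ (CARD('n) - 1))\<^sup>2"
    by (simp add: power_mult_distrib power_mult[symmetric] mult.commute flip: power_mult)
       (simp add: power_mult mult.commute)
  finally have "cmod (det M) \<le> (sqrt (real CARD('n)) * a) ^ (CARD('n) - 1)"
    by (rule power2_le_imp_le) (use a0 in simp)
  moreover have "det M = s (det (cofactor_matrix A i j))"
    by (simp add: embedding_det[OF s(1)] M_def)
  ultimately show ?thesis by (simp add: s(2))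
qed


section \<open>Heights\<close>

lemma places_upto_subset:
  assumes "\<And>p. p \<in> P \<Longrightarrow> prime p"
  shows "(places_upto P :: ('k::number_field \<Rightarrow> real) set) \<subseteq> places"
  unfolding places_eq places_upto_def using assms by auto

lemma places_absolute_value: "v \<in> places \<Longrightarrow> absolute_value v"
  by (simp add: places_def)

lemma common_good_primes:
  fixes X :: "'k::number_field set"
  assumes "finite X"
  obtains P where "finite P" "\<And>p. p \<in> P \<Longrightarrow> prime p" "\<And>x. x \<in> X \<Longrightarrow> x \<noteq> 0 \<Longrightarrow> good_primes P x"
proof -
  have "\<forall>x\<in>X - {0}. \<exists>P. finite P \<and> good_primes P x" using good_primes_exist by auto
  then obtain F where F: "\<forall>x\<in>X - {0}. finite (F x) \<and> good_primes (F x) x"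
    using bchoice[of "X - {0}" "\<lambda>x P. finite P \<and> good_primes P x"] by blast
  define P where "P = (\<Union>x\<in>X - {0}. F x) \<inter> {p. prime p}"
  have "finite P" using assms F by (auto simp: P_def)
  moreover have "good_primes P x" if "x \<in> X" "x \<noteq> 0" for x
  proof -
    have "good_primes (F x) x" using F that by blast
    thus ?thesis using that unfolding good_primes_def P_def by blast
  qed
  moreover have "prime p" if "p \<in> P" for p using that by (simp add: P_def)
  ultimately show ?thesis using that by blast
qed

lemma vec_abs_le_iff: "vec_abs v x \<le> b \<longleftrightarrow> (\<forall>i. v (x $ i) \<le> b)" for x :: "'k ^ 'N"
  by (auto simp: vec_abs_def)

lemma vec_abs_ge: "v (x $ i) \<le> vec_abs v x" for x :: "'k ^ 'N"
  by (auto simp: vec_abs_def intro: Max_ge)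

lemma vec_abs_pos:
  assumes "absolute_value v" "x $ i \<noteq> 0"
  shows "vec_abs v x > 0"
  using absolute_value_simps(11)[OF assms(1), of "x $ i"] assms(2) vec_abs_ge[of v x i] by linarith

lemma vec_abs_eq_1:
  fixes x :: "'k::number_field ^ 'N"
  assumes v: "v \<in> places" "v \<notin> places_upto P" and nz: "x $ i0 \<noteq> 0"
    and good: "\<And>i. x $ i \<noteq> 0 \<Longrightarrow> good_primes P (x $ i)"
  shows "vec_abs v x = 1"
proof -
  obtain p where p: "prime p" "v \<in> places_over (padic_abs p)" "p \<notin> P"
    using v unfolding places_eq places_upto_def by auto
  have one: "v (x $ i) = 1" if "x $ i \<noteq> 0" for i
    using good[OF that] p unfolding good_primes_def by blast
  have zero: "v 0 = 0" using absolute_value_simps(1)[OF places_absolute_value[OF v(1)]] .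
  have "vec_abs v x \<le> 1"
    unfolding vec_abs_le_iff
  proof
    fix i show "v (x $ i) \<le> 1" using one[of i] zero by (cases "x $ i = 0") auto
  qed
  moreover have "1 \<le> vec_abs v x" using one[OF nz] vec_abs_ge[of v x i0] by simp
  ultimately show ?thesis by simp
qed

text \<open>The product in the definition of the height runs over the places with \<open>vec_abs v x \<noteq> 1\<close>. All of them
  belong to \<open>places_upto P\<close> if \<open>P\<close> contains the primes at which some nonzero coordinate is not a unit.\<close>
lemma height_eq:
  fixes x :: "'k::number_field ^ 'N"
  assumes fin: "finite P" and P: "\<And>p. p \<in> P \<Longrightarrow> prime p" and nz: "x $ i0 \<noteq> 0"
    and good: "\<And>i. x $ i \<noteq> 0 \<Longrightarrow> good_primes P (x $ i)"
  shows "height x = (\<Prod>v\<in>places_upto P. vec_abs v x ^ local_degree v) powr (1 / real (field_degree TYPE('k)))"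
proof -
  have "(\<Prod>v\<in>{v\<in>places. vec_abs v x \<noteq> 1}. vec_abs v x ^ local_degree v) = (\<Prod>v\<in>places_upto P. vec_abs v x ^ local_degree v)"
  proof (rule prod.mono_neutral_left[OF prod_places_upto(2)[OF fin P]])
    show "{v\<in>places. vec_abs v x \<noteq> 1} \<subseteq> places_upto P"
      using vec_abs_eq_1[OF _ _ nz good] by blast
    show "\<forall>v\<in>places_upto P - {v\<in>places. vec_abs v x \<noteq> 1}. vec_abs v x ^ local_degree v = 1"
      using places_upto_subset[OF P] by auto
  qed
  thus ?thesis by (simp add: height_def)
qed

lemma prod_arch_constant:
  fixes K :: real
  assumes fin: "finite P" and P: "\<And>p. p \<in> P \<Longrightarrow> prime p"
  shows "(\<Prod>v\<in>(places_upto P :: ('k::number_field \<Rightarrow> real) set). (if v \<in> places_over arch_abs then K else 1) ^ local_degree v)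
    = K ^ field_degree TYPE('k)"
proof -
  have "(\<Prod>v\<in>(places_upto P :: ('k \<Rightarrow> real) set). (if v \<in> places_over arch_abs then K else 1) ^ local_degree v)
    = (\<Prod>v\<in>(places_over arch_abs :: ('k \<Rightarrow> real) set). (if v \<in> places_over arch_abs then K else 1) ^ local_degree v)"
    by (rule prod.mono_neutral_right[OF prod_places_upto(2)[OF fin P]]) (auto simp: places_upto_def)
  also have "\<dots> = (\<Prod>v\<in>(places_over arch_abs :: ('k \<Rightarrow> real) set). K ^ local_degree v)"
    by (rule prod.cong) auto
  also have "\<dots> = K ^ field_degree TYPE('k)"
    by (simp add: power_sum[symmetric] sum_arch_local_degrees(2))
  finally show ?thesis .
qed

text \<open>Local estimates are multiplied over all places. The factors \<open>v D\<close> drop out by the product formula, and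
  the constant \<open>K\<close> appears once for each unit of the local degrees at the archimedean places, which
  sum up to the degree.\<close>
theorem height_comparison:
  fixes x :: "'k::number_field ^ 'N" and y :: "'k ^ 'M"
  assumes x: "x $ i0 \<noteq> 0" and y: "y $ j0 \<noteq> 0" and D: "D \<noteq> 0" and K: "K > 0"
    and le: "\<And>v. v \<in> places \<Longrightarrow>
      vec_abs v x \<le> (if v \<in> places_over arch_abs then K else 1) * vec_abs v y ^ m / v D"
  shows "height x \<le> K * height y ^ m"
proof -
  let ?d = "field_degree TYPE('k)"
  have d: "real ?d > 0" using field_degree_pos[where 'k='k] by simp
  define X where "X = insert D (range (\<lambda>i. x $ i) \<union> range (\<lambda>i. y $ i))"
  have "finite X" by (simp add: X_def)
  then obtain P where P: "finite P" "\<And>p. p \<in> P \<Longrightarrow> prime p" "\<And>z. z \<in> X \<Longrightarrow> z \<noteq> 0 \<Longrightarrow> good_primes P z"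
    using common_good_primes[of X] by blast
  let ?V = "places_upto P :: ('k \<Rightarrow> real) set"
  have av: "absolute_value v" "v \<in> places" if "v \<in> ?V" for v
    using that places_upto_subset[OF P(2)] places_absolute_value by auto
  define k where "k = (\<lambda>v :: 'k \<Rightarrow> real. if v \<in> places_over arch_abs then K else 1)"
  define Hx where "Hx = (\<Prod>v\<in>?V. vec_abs v x ^ local_degree v)"
  define Hy where "Hy = (\<Prod>v\<in>?V. vec_abs v y ^ local_degree v)"
  have hx: "height x = Hx powr (1 / real ?d)"
    unfolding Hx_def by (rule height_eq[OF P(1,2) x]) (auto simp: X_def intro: P(3))
  have hy: "height y = Hy powr (1 / real ?d)"
    unfolding Hy_def by (rule height_eq[OF P(1,2) y]) (auto simp: X_def intro: P(3))
  have Hpos: "Hx > 0" "Hy > 0"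
    unfolding Hx_def Hy_def using vec_abs_pos[OF av(1) x] vec_abs_pos[OF av(1) y] by (auto intro!: prod_pos)
  have "Hx \<le> (\<Prod>v\<in>?V. (k v * vec_abs v y ^ m / v D) ^ local_degree v)"
    unfolding Hx_def
  proof (intro prod_mono conjI)
    fix v assume v: "v \<in> ?V"
    show "0 \<le> vec_abs v x ^ local_degree v" using vec_abs_pos[OF av(1)[OF v] x] by simp
    show "vec_abs v x ^ local_degree v \<le> (k v * vec_abs v y ^ m / v D) ^ local_degree v"
      using le[OF av(2)[OF v]] vec_abs_pos[OF av(1)[OF v] x] unfolding k_def by (intro power_mono) auto
  qed
  also have "\<dots> = (\<Prod>v\<in>?V. k v ^ local_degree v * (vec_abs v y ^ local_degree v) ^ m / v D ^ local_degree v)"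
    by (intro prod.cong refl) (simp add: power_divide power_mult_distrib power_mult[symmetric] mult.commute)
  also have "\<dots> = (\<Prod>v\<in>?V. k v ^ local_degree v) * Hy ^ m / (\<Prod>v\<in>?V. v D ^ local_degree v)"
    by (simp add: Hy_def prod_dividef prod.distrib prod_power_distrib)
  also have "(\<Prod>v\<in>?V. v D ^ local_degree v) = 1"
    by (rule product_formula[OF D P(1,2) P(3)[OF _ D]]) (auto simp: X_def)
  also have "(\<Prod>v\<in>?V. k v ^ local_degree v) = K ^ ?d"
    unfolding k_def by (rule prod_arch_constant[OF P(1,2)])
  finally have "Hx \<le> K ^ ?d * Hy ^ m" by simp
  hence "Hx powr (1 / real ?d) \<le> (K ^ ?d * Hy ^ m) powr (1 / real ?d)"
    using Hpos d by (intro powr_mono2) auto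
  also have "\<dots> = (K ^ ?d) powr (1 / real ?d) * (Hy ^ m) powr (1 / real ?d)"
    using K Hpos by (simp add: powr_mult)
  also have "(K ^ ?d) powr (1 / real ?d) = K"
    using K d by (simp add: powr_realpow[symmetric] powr_powr)
  also have "(Hy ^ m) powr (1 / real ?d) = (Hy powr (1 / real ?d)) ^ m"
    using Hpos by (simp add: powr_realpow[symmetric] powr_powr mult.commute)
  finally show ?thesis by (simp add: hx hy)
qed

lemma height_ge_1:
  fixes x :: "'k::number_field ^ 'N"
  assumes "x $ i0 = 1"
  shows "height x \<ge> 1"
proof -
  have "vec_abs v x \<ge> 1" if "v \<in> places" for v
    using vec_abs_ge[of v x i0] absolute_value_simps(2)[OF places_absolute_value[OF that]] by (simp add: assms)
  hence "(\<Prod>v\<in>{v\<in>places. vec_abs v x \<noteq> 1}. vec_abs v x ^ local_degree v) \<ge> 1"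
    by (intro prod_ge_1) (simp add: one_le_power)
  thus ?thesis unfolding height_def by (intro ge_one_powr_ge_zero) auto
qed

lemma place_cases:
  fixes v :: "'k::number_field \<Rightarrow> real"
  assumes "v \<in> places"
  obtains "v \<in> places_over arch_abs" | "v \<notin> places_over arch_abs" "\<And>x y. v (x + y) \<le> max (v x) (v y)"
  using assms padic_places(2)[where 'k = 'k] unfolding places_eq by blast

lemma cofactor_bound:
  fixes A :: "'k::number_field ^ 'n ^ 'n"
  assumes v: "v \<in> places" and a: "\<And>i j. v (A $ i $ j) \<le> a"
  shows "v (det (cofactor_matrix A i j)) \<le>
    (if v \<in> places_over arch_abs then sqrt (real CARD('n)) ^ (CARD('n) - 1) else 1) * a ^ (CARD('n) - 1)"
  using v
proof (cases rule: place_cases)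
  case 1
  thus ?thesis using cofactor_bound_arch[OF 1 a, of i j] by (simp add: power_mult_distrib)
next
  case 2
  thus ?thesis using cofactor_bound_ultrametric[OF places_absolute_value[OF v] 2(2) a, of i j] by simp
qed

lemma det_bound:
  fixes A :: "'k::number_field ^ 'n ^ 'n"
  assumes v: "v \<in> places" and a: "\<And>i j. v (A $ i $ j) \<le> a"
  shows "v (det A) \<le>
    (if v \<in> places_over arch_abs then real CARD('n) ^ CARD('n) else 1) * a ^ CARD('n)"
  using v
proof (cases rule: place_cases)
  case 1
  thus ?thesis using det_bound_triangle[OF places_absolute_value[OF v] a] by simp
next
  case 2
  thus ?thesis using det_bound_ultrametric[OF places_absolute_value[OF v] 2(2), of A "\<lambda>_. a"] a by simp
qed

lemma mat_to_vec_nth [simp]: "mat_to_vec A $ (i, j) = A $ i $ j"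
  by (simp add: mat_to_vec_def)

lemma invertible_entry_nonzero:
  fixes A :: "'k::field ^ 'n ^ 'n"
  assumes "det A \<noteq> 0"
  obtains i j where "A $ i $ j \<noteq> 0"
proof -
  have "A \<noteq> 0"
  proof
    assume "A = 0"
    hence "det A = 0" by (simp add: Determinants.det_def power_0_left)
    thus False using assms by simp
  qed
  thus ?thesis using that by (auto simp: Finite_Cartesian_Product.vec_eq_iff)
qed

theorem lemma2p3:
  fixes A :: "'k::number_field ^ 'n ^ 'n"
    and n d :: nat
    and \<Delta> :: rat
  defines "n \<equiv> CARD('n)"
    and "d \<equiv> field_degree TYPE('k)"
    and "\<Delta> \<equiv> field_discriminant TYPE('k)"
  assumes "invertible A"
  shows "mat_height (matrix_inv A) \<le> (sqrt (real n) * mat_height A) ^ (n - 1) \<and>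
         mat_inhom_height (matrix_inv A) \<le>
           real n ^ n * real_of_rat \<bar>\<Delta>\<bar> powr (1 / real d) * mat_inhom_height A ^ (2 * n - 1)"
proof
  define D where "D = det A"
  define B where "B = matrix_inv A"
  have D: "D \<noteq> 0" and B: "\<And>i j. B $ i $ j = det (cofactor_matrix A i j) / D"
    using matrix_inv_entry[OF assms(4)] by (auto simp: D_def B_def)
  have n: "n \<ge> 1" by (simp add: n_def Suc_le_eq)
  have "invertible B"
    using assms(4) someI_ex[of "\<lambda>A'. A ** A' = mat 1 \<and> A' ** A = mat 1"]
    unfolding B_def matrix_inv_def invertible_def by blast
  hence detB: "det B \<noteq> 0" by (simp add: invertible_det_nz)
  obtain i j where ij: "A $ i $ j \<noteq> 0" using invertible_entry_nonzero[OF D[unfolded D_def]] .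
  obtain i' j' where ij': "B $ i' $ j' \<noteq> 0" using invertible_entry_nonzero[OF detB] .
  have vB: "v (B $ i $ j) = v (det (cofactor_matrix A i j)) / v D" if "v \<in> places" for v i j
    using absolute_value_simps(6)[OF places_absolute_value[OF that]] by (simp add: B)
  have vD: "v D > 0" if "v \<in> places" for v
    using absolute_value_simps(11)[OF places_absolute_value[OF that]] D by simp
  have "height (mat_to_vec B) \<le> sqrt (real n) ^ (n - 1) * height (mat_to_vec A) ^ (n - 1)"
  proof (rule height_comparison[where ?i0.0 = "(i', j')" and ?j0.0 = "(i, j)" and D = D])
    fix v :: "'k \<Rightarrow> real" assume v: "v \<in> places"
    have ent: "v (A $ i $ j) \<le> vec_abs v (mat_to_vec A)" for i j
      using vec_abs_ge[of v "mat_to_vec A" "(i, j)"] by simp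
    show "vec_abs v (mat_to_vec B) \<le>
        (if v \<in> places_over arch_abs then sqrt (real n) ^ (n - 1) else 1) * vec_abs v (mat_to_vec A) ^ (n - 1) / v D"
      unfolding vec_abs_le_iff
    proof
      fix ij :: "'n \<times> 'n"
      obtain i j where ij: "ij = (i, j)" by (cases ij)
      show "v (mat_to_vec B $ ij) \<le>
          (if v \<in> places_over arch_abs then sqrt (real n) ^ (n - 1) else 1) * vec_abs v (mat_to_vec A) ^ (n - 1) / v D"
        unfolding ij mat_to_vec_nth vB[OF v]
        by (rule divide_right_mono[OF cofactor_bound[OF v ent, of i j, folded n_def] less_imp_le[OF vD[OF v]]])
    qed
  qed (use ij ij' D n in simp_all)
  thus "mat_height (matrix_inv A) \<le> (sqrt (real n) * mat_height A) ^ (n - 1)"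
    by (simp add: mat_height_def B_def power_mult_distrib)

  define a where "a = ((\<chi> i. case i of None \<Rightarrow> 1 | Some j \<Rightarrow> mat_to_vec A $ j) :: 'k ^ ('n \<times> 'n) option)"
  define b where "b = ((\<chi> i. case i of None \<Rightarrow> 1 | Some j \<Rightarrow> mat_to_vec B $ j) :: 'k ^ ('n \<times> 'n) option)"
  have a_nth: "a $ None = 1" "\<And>i j. a $ Some (i, j) = A $ i $ j"
    and b_nth: "b $ None = 1" "\<And>i j. b $ Some (i, j) = B $ i $ j"
    by (simp_all add: a_def b_def)
  have "height b \<le> real n ^ n * height a ^ n"
  proof (rule height_comparison[where ?i0.0 = None and ?j0.0 = None and D = D])
    fix v :: "'k \<Rightarrow> real" assume v: "v \<in> places"
    let ?k = "if v \<in> places_over arch_abs then real n ^ n else 1"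
    let ?a = "vec_abs v a"
    have ent: "v (A $ i $ j) \<le> ?a" for i j
      using vec_abs_ge[of v a "Some (i, j)"] by (simp add: a_nth)
    have a1: "?a \<ge> 1"
      using vec_abs_ge[of v a None] absolute_value_simps(2)[OF places_absolute_value[OF v]] by (simp add: a_nth)
    have Dle: "v D \<le> ?k * ?a ^ n"
      using det_bound[OF v ent, folded n_def] unfolding D_def .
    have cle: "v (det (cofactor_matrix A i j)) \<le> ?k * ?a ^ n" for i j
    proof -
      have "sqrt (real n) ^ (n - 1) \<le> real n ^ n"
      proof -
        have "sqrt (real n) \<le> real n"
          by (rule real_le_lsqrt) (use n in \<open>simp_all add: power2_eq_square\<close>)
        hence "sqrt (real n) ^ (n - 1) \<le> real n ^ (n - 1)" by (intro power_mono) auto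
        also have "\<dots> \<le> real n ^ n" using n by (intro power_increasing) auto
        finally show ?thesis .
      qed
      hence "(if v \<in> places_over arch_abs then sqrt (real n) ^ (n - 1) else 1) \<le> ?k" by simp
      moreover have "?a ^ (n - 1) \<le> ?a ^ n" using a1 by (intro power_increasing) auto
      ultimately have "(if v \<in> places_over arch_abs then sqrt (real n) ^ (n - 1) else 1) * ?a ^ (n - 1) \<le> ?k * ?a ^ n"
        using a1 by (intro mult_mono) auto
      thus ?thesis using cofactor_bound[OF v ent, of i j, folded n_def] by linarith
    qed
    show "vec_abs v b \<le> ?k * ?a ^ n / v D"
      unfolding vec_abs_le_iff
    proof
      fix c :: "('n \<times> 'n) option"
      show "v (b $ c) \<le> ?k * ?a ^ n / v D"
      proof (cases c)
        case None
        \<comment> \<open>the coordinate \<open>1\<close> of \<open>b\<close> is \<open>D / D\<close>, so the bound for \<open>det A\<close> applies\<close>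
        have "v (1::'k) = 1" using absolute_value_simps(2)[OF places_absolute_value[OF v]] .
        moreover have "1 \<le> ?k * ?a ^ n / v D"
          using Dle vD[OF v] unfolding le_divide_eq by simp
        ultimately show ?thesis by (simp only: None b_nth)
      next
        case (Some ij)
        obtain i j where ij: "ij = (i, j)" by (cases ij)
        show ?thesis unfolding Some ij b_nth vB[OF v]
          by (rule divide_right_mono[OF cle less_imp_le[OF vD[OF v]]])
      qed
    qed
  qed (use D n in \<open>simp_all add: a_nth b_nth\<close>)
  also have "\<dots> \<le> real n ^ n * real_of_rat \<bar>\<Delta>\<bar> powr (1 / real d) * height a ^ (2 * n - 1)"
  proof -
    have "real_of_rat \<bar>\<Delta>\<bar> \<ge> 1"
      using field_discriminant_ge_1[where 'k = 'k] unfolding \<Delta>_def by (metis of_rat_1 of_rat_less_eq)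
    hence "real_of_rat \<bar>\<Delta>\<bar> powr (1 / real d) \<ge> 1" by (intro ge_one_powr_ge_zero) auto
    hence "real n ^ n * 1 \<le> real n ^ n * real_of_rat \<bar>\<Delta>\<bar> powr (1 / real d)"
      by (intro mult_left_mono) auto
    moreover have h1: "height a \<ge> 1" by (rule height_ge_1[OF a_nth(1)])
    moreover have "height a ^ n \<le> height a ^ (2 * n - 1)"
      using h1 n by (intro power_increasing) auto
    ultimately show ?thesis by (intro mult_mono) auto
  qed
  finally show "mat_inhom_height (matrix_inv A) \<le>
      real n ^ n * real_of_rat \<bar>\<Delta>\<bar> powr (1 / real d) * mat_inhom_height A ^ (2 * n - 1)"
    unfolding mat_inhom_height_def inhom_height_def a_def b_def B_def .
qed

end
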